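(* In the setting of the context (reducible case $\rho_1=\mu_{q-1}$, $\rho_2=\mu_q$): (1) For $1\le i\le p-1$, $1\le k\le r_i$, $1\le h\le\ell_{i,k}$ one has, for $x\in\mathcal S_i^+\cup\mathcal S_{i+1}^-$, $$U''_{t_i,k,h}(x)=\sum_{\tilde k=1}^{r_{i+1}}\sum_{\tilde h=1}^{\ell_{i+1,\tilde k}}C''_{t_{i+1},\tilde k,\tilde h;t_i,k,h}\,U''_{t_{i+1},\tilde k,\tilde h}(x)+\mathrm{hol}(x-t_{i+1}),$$ $$C''_{t_{i+1},\tilde k,\tilde h;t_i,k,h}=\frac{e^{\pi\sqrt{-1}\lambda_{i,k}}(t_i-t_{p+1})^{2\lambda_{i,k}-\mu_{q-1}-\mu_q}}{e^{\pi\sqrt{-1}\lambda_{i+1,\tilde k}}(t_{i+1}-t_{p+1})^{2\lambda_{i+1,\tilde k}-\mu_{q-1}-\mu_q}}\,c_{t'_{i+1},\tilde k,\tilde h;t'_i,k,h}.$$ (2) For $2\le i\le p$, $1\le k\le r_i$, $1\le h\le\ell_{i,k}$ one has, for $x\in\mathcal S_i^-\cup\mathcal S_{i-1}^+$, $$U''_{t_i,k,h}(x)=\sum_{\tilde k=1}^{r_{i-1}}\sum_{\tilde h=1}^{\ell_{i-1,\tilde k}}C''_{t_{i-1},\tilde k,\tilde h;t_i,k,h}\,U''_{t_{i-1},\tilde k,\tilde h}(x)+\mathrm{hol}(x-t_{i-1}),$$ $$C''_{t_{i-1},\tilde k,\tilde h;t_i,k,h}=\frac{e^{\pi\sqrt{-1}\lambda_{i,k}}(t_i-t_{p+1})^{2\lambda_{i,k}-\mu_{q-1}-\mu_q}}{e^{\pi\sqrt{-1}\lambda_{i-1,\tilde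 k}}(t_{i-1}-t_{p+1})^{2\lambda_{i-1,\tilde k}-\mu_{q-1}-\mu_q}}\,c_{t'_{i-1},\tilde k,\tilde h;t'_i,k,h}.$$
   Context: **System.** Let $t_1,\dots,t_{p+1}\in\mathbb C$ be distinct, no three on a straight line; $T=\mathrm{diag}(t_1I_{n_1},\dots,t_pI_{n_p})$, $n=n_1+\dots+n_p$. Let $A\in M(n;\mathbb C)$, partitioned in blocks $A_{ij}$ like $T$, have diagonal blocks $A_{ii}=\mathrm{diag}(\lambda_{i,1}I_{\ell_{i,1}},\dots,\lambda_{i,r_i}I_{\ell_{i,r_i}})$ ($\lambda_{i,k}$ distinct for fixed $i$), and let $P\in GL(n;\mathbb C)$ be such that $A'=P^{-1}AP=\mathrm{diag}(\mu_1I_{m_1},\dots,\mu_qI_{m_q})$ ($\mu_k$ distinct, $q\ge2$). Let $\rho_1=\mu_{q-1}$, $\rho_2=\mu_q$. Put $$\mathcal A_P=\begin{pmatrix}A&P\\-(A'-\rho_1I_n)(A'-\rho_2I_n)P^{-1}&(\rho_1+\rho_2)I_n-A'\end{pmatrix}.$$ Then $\mathcal A_P=\begin{pmatrix}\mathcal A''_P&*\\O&\mathrm{diag}(\mu_qI_{m_{q-1}},\mu_{q-1}I_{m_q})\end{pmatrix}$ with $\mathcal A''_P\in M(N;\mathbb C)$, $N=2n-m_{q-1}-m_q$. The system considered is $$(xI_{N}-\mathcal T'')\frac{dU''}{dx}=\mathcal A''_PU'',\qquad \mathcal T''=\begin{pmatrix}T&\\&t_{p+1}I_{n-m_{q-1}-m_q}\end{pmatrix}.$$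 **Assumptions.** None of the following is an integer: $\lambda_{i,k}$; $\lambda_{i,k}-\lambda_{i,h}$ ($k\ne h$); $\mu_k$; $\mu_k-\mu_h$ ($k\neq h$); $\lambda_{i,k}-\mu_h$ (all admissible indices). **Sectors.** Arguments $\theta_i=\arg(t_i-t_{p+1})$ are fixed with $\theta_1<\dots<\theta_p<\theta_1+2\pi$, and $\theta_{p+1}$ is a fixed real number with $\theta_p<\theta_{p+1}<\theta_1+2\pi$; $\theta_0=\theta_{p+1}-2\pi$. With $\delta>0$ fixed and sufficiently small, $\mathcal S_i^+=\{\theta_i<\arg(x-t_{p+1})<\min(\theta_{i+1}-\delta,\theta_i+\pi)\}$, $\mathcal S_i^-=\{\max(\theta_{i-1}+\delta,\theta_i-\pi)<\arg(x-t_{p+1})<\theta_i\}$ ($1\le i\le p$). $\arg(x-t_i)\in(\theta_i,\theta_i+\pi)$ in $\mathcal S_i^+$ and $\in(\theta_i-\pi,\theta_i)$ in $\mathcal S_i^-$. Powers of $t_i-t_{p+1}$ use $\arg=\theta_i$. In (1) $U''_{t_i,k,h}$ is taken with its branch on $\mathcal S_i^+$ and $U''_{t_{i+1},\tilde k,\tilde h}$ with its branch on $\mathcal S_{i+1}^-$, both continued analytically in the (connected) sector $\mathcal S_i^+\cup\mathcal S_{i+1}^-$; similarly in (2). **Local solutions.** $\varepsilon_m(k)$ is the $k$-th unit $m$-vector. $U''_{t_i,k,h}$ ($1\le i\le p$) is the unique solution of the system of the form $U''_{t_i,k,h}(x)=(x-t_i)^{\lambda_{i,k}}\{\varepsilon_{N}(n_1+\dots+n_{i-1}+\ell_{i,1}+\dots+\ell_{i,k-1}+h)+\sum_{m\ge1}G''(m)(x-t_i)^m\}$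 (convergent near $t_i$). $\mathrm{hol}(x-a)$ denotes a vector function holomorphic in a neighbourhood of $x=a$. **Underlying system.** Fix $\eta_0\in\mathbb C$; $t'_i=\eta_0+\frac1{t_i-t_{p+1}}$, $T'=\mathrm{diag}(t'_1I_{n_1},\dots,t'_pI_{n_p})$, $\theta'_i=\arg(t'_i-\eta_0)=-\theta_i$. The underlying system is $(\zeta I_n-T')\frac{dw}{d\zeta}=(\rho I_n+A)w$. For $\rho=0$ it has the unique solutions $w_{t'_i,k,h}(0;\zeta)=(\zeta-t'_i)^{\lambda_{i,k}}\{\varepsilon_n(n_1+\dots+n_{i-1}+\ell_{i,1}+\dots+\ell_{i,k-1}+h)+O(\zeta-t'_i)\}$ near $t'_i$ ($O$-term a convergent power series). Let $\mathcal P'=\mathbb C\setminus\bigcup_i\{\eta_0+(t'_i-\eta_0)s: s\ge1\}$; in $\mathcal P'$ the branch of $w_{t'_i,k,h}$ is fixed by $\arg(\zeta-t'_i)\in(\theta'_i-2\pi,\theta'_i)$. The constants $c_{t'_\nu,\tilde k,\tilde h;t'_i,k,h}$ ($\nu\ne i$) are the connection coefficients of the underlying system with $\rho=0$, defined in $\mathcal P'$ by $$w_{t'_i,k,h}(0;\zeta)=\sum_{\tilde k=1}^{r_\nu}\sum_{\tilde h=1}^{\ell_{\nu,\tilde k}}c_{t'_\nu,\tilde k,\tilde h;t'_i,k,h}\,w_{t'_\nu,\tilde k,\tilde h}(0;\zeta)+\mathrm{hol}(\zeta-t'_\nu).$$ *)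

theory Defs
  imports "HOL-Complex_Analysis.Complex_Analysis" "Jordan_Normal_Form.Matrix"
begin

no_notation vec_nth (infixl "$" 90)
no_notation fps_nth (infixl "$" 75)
no_notation fls_nth (infixl "$$" 75)

section \<open>Block matrices\<close>

text \<open>
  Indices of blocks start at 1, as is usual in mathematics; entries of matrices and vectors are
  numbered from 0, as in the matrix library.
\<close>

definition block_scalar :: "nat \<Rightarrow> (nat \<Rightarrow> complex) \<Rightarrow> (nat \<Rightarrow> nat) \<Rightarrow> complex mat" where
  \<comment> \<open>\<open>diag(c\<^sub>1 I\<^bsub>d\<^sub>1\<^esub>, \<dots>, c\<^sub>K I\<^bsub>d\<^sub>K\<^esub>)\<close>\<close>
  "block_scalar K c d = diag_block_mat (map (\<lambda>k. c k \<cdot>\<^sub>m 1\<^sub>m (d k)) [1..<Suc K])"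

definition offset :: "(nat \<Rightarrow> nat) \<Rightarrow> nat \<Rightarrow> nat" where
  "offset d i = (\<Sum>j=1..<i. d j)"

definition diagonal_block :: "complex mat \<Rightarrow> (nat \<Rightarrow> nat) \<Rightarrow> nat \<Rightarrow> complex mat" where
  "diagonal_block A d i = mat (d i) (d i) (\<lambda>(a, b). A $$ (offset d i + a, offset d i + b))"

definition unit_at :: "nat \<Rightarrow> nat \<Rightarrow> complex vec" where
  \<comment> \<open>\<open>\<epsilon>\<^sub>m(k)\<close>, with \<open>1 \<le> k \<le> m\<close>\<close>
  "unit_at m k = unit_vec m (k - 1)"

definition position :: "(nat \<Rightarrow> nat) \<Rightarrow> (nat \<Rightarrow> nat \<Rightarrow> nat) \<Rightarrow> nat \<Rightarrow> nat \<Rightarrow> nat \<Rightarrow> nat" where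
  \<comment> \<open>\<open>n\<^sub>1 + \<dots> + n\<^bsub>i-1\<^esub> + l\<^bsub>i,1\<^esub> + \<dots> + l\<^bsub>i,k-1\<^esub> + h\<close>\<close>
  "position nb l i k h = offset nb i + offset (l i) k + h"

definition extended_matrix ::
  "nat \<Rightarrow> complex mat \<Rightarrow> complex mat \<Rightarrow> complex mat \<Rightarrow> complex mat \<Rightarrow> complex \<Rightarrow> complex \<Rightarrow> complex mat" where
  \<comment> \<open>the \<open>2n \<times> 2n\<close> matrix \<open>\<A>\<^sub>P\<close>; \<open>Q\<close> stands for the inverse of \<open>P\<close> and \<open>D\<close> for \<open>P\<^sup>-\<^sup>1AP\<close>\<close>
  "extended_matrix n A P Q D \<rho>1 \<rho>2 =
     four_block_mat
       A P
       (- ((D - \<rho>1 \<cdot>\<^sub>m 1\<^sub>m n) * (D - \<rho>2 \<cdot>\<^sub>m 1\<^sub>m n) * Q)) ((\<rho>1 + \<rho>2) \<cdot>\<^sub>m 1\<^sub>m n - D)"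

definition leading_block :: "nat \<Rightarrow> complex mat \<Rightarrow> complex mat" where
  "leading_block N M = mat N N (\<lambda>(a, b). M $$ (a, b))"


section \<open>Powers, sectors and cut plane\<close>

definition pow_arg :: "complex \<Rightarrow> real \<Rightarrow> complex \<Rightarrow> complex" where
  \<comment> \<open>\<open>z\<^sup>a\<close> for \<open>z \<noteq> 0\<close>, computed with the value \<open>\<phi>\<close> of the argument of \<open>z\<close>\<close>
  "pow_arg z \<phi> a = exp (a * Complex (ln (cmod z)) \<phi>)"

definition is_arg_of :: "real \<Rightarrow> complex \<Rightarrow> bool" where
  "is_arg_of \<phi> z \<longleftrightarrow> z \<noteq> 0 \<and> z = of_real (cmod z) * cis \<phi>"

definition sector :: "complex \<Rightarrow> real \<Rightarrow> real \<Rightarrow> complex set" where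
  "sector c \<alpha> \<beta> = {x. \<exists>\<phi>. \<alpha> < \<phi> \<and> \<phi> < \<beta> \<and> is_arg_of \<phi> (x - c)}"

definition sector_plus :: "complex \<Rightarrow> (nat \<Rightarrow> real) \<Rightarrow> real \<Rightarrow> nat \<Rightarrow> complex set" where
  "sector_plus c \<theta> \<delta> i = sector c (\<theta> i) (min (\<theta> (i + 1) - \<delta>) (\<theta> i + pi))"

definition sector_minus :: "complex \<Rightarrow> (nat \<Rightarrow> real) \<Rightarrow> real \<Rightarrow> nat \<Rightarrow> complex set" where
  "sector_minus c \<theta> \<delta> i = sector c (max (\<theta> (i - 1) + \<delta>) (\<theta> i - pi)) (\<theta> i)"

definition cut_plane :: "complex \<Rightarrow> nat \<Rightarrow> (nat \<Rightarrow> complex) \<Rightarrow> complex set" where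
  "cut_plane \<eta> p t' = - (\<Union>i\<in>{1..p}. {\<eta> + (t' i - \<eta>) * of_real s |s. 1 \<le> (s :: real)})"


section \<open>Systems and their local solutions\<close>

definition system_solution ::
  "nat \<Rightarrow> complex mat \<Rightarrow> complex mat \<Rightarrow> complex set \<Rightarrow> (complex \<Rightarrow> complex vec) \<Rightarrow> bool" where
  \<comment> \<open>\<open>U\<close> is a single-valued holomorphic solution of \<open>(x I\<^sub>N - S) dU/dx = B U\<close> on \<open>D\<close>\<close>
  "system_solution N S B D U \<longleftrightarrow>
     (\<forall>x\<in>D. U x \<in> carrier_vec N) \<and>
     (\<forall>j<N. (\<lambda>x. U x $ j) holomorphic_on D) \<and>
     (\<forall>x\<in>D. (x \<cdot>\<^sub>m 1\<^sub>m N - S) *\<^sub>v vec N (\<lambda>j. deriv (\<lambda>z. U z $ j) x) = B *\<^sub>v U x)"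

text \<open>
  \<open>solution_branch N S B a lam v G E \<alpha> \<beta> D U\<close>: the function \<open>U\<close> is the solution on \<open>D\<close> obtained by
  analytic continuation from \<open>E \<subseteq> D\<close> of the local solution
  \<open>(x - a)\<^sup>l\<^sup>a\<^sup>m {v + \<Sum>\<^bsub>m\<ge>1\<^esub> G(m) (x - a)\<^sup>m}\<close>, with a power series convergent near \<open>a\<close>, whose branch is
  fixed on \<open>E\<close> (near \<open>a\<close>) by \<open>arg (x - a) \<in> (\<alpha>, \<beta>)\<close>. In the applications \<open>D\<close> is open and
  connected, \<open>a\<close> is a boundary point of \<open>E\<close> and \<open>\<beta> - \<alpha> \<le> 2\<pi>\<close>, so that \<open>U\<close> is determined by the germ.
\<close>

definition solution_branch ::
  "nat \<Rightarrow> complex mat \<Rightarrow> complex mat \<Rightarrow> complex \<Rightarrow> complex \<Rightarrow> complex vec \<Rightarrow> (nat \<Rightarrow> complex vec) \<Rightarrow>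
   complex set \<Rightarrow> real \<Rightarrow> real \<Rightarrow> complex set \<Rightarrow> (complex \<Rightarrow> complex vec) \<Rightarrow> bool" where
  "solution_branch N S B a lam v G E \<alpha> \<beta> D U \<longleftrightarrow>
     system_solution N S B D U \<and>
     G 0 = v \<and> (\<forall>m. G m \<in> carrier_vec N) \<and>
     (\<exists>r>0. \<exists>\<Phi>.
        (\<forall>x\<in>ball a r. \<Phi> x \<in> carrier_vec N \<and> (\<forall>j<N. (\<lambda>m. G m $ j * (x - a) ^ m) sums (\<Phi> x $ j))) \<and>
        (\<forall>x\<in>ball a r \<inter> E. \<exists>\<phi>. \<alpha> < \<phi> \<and> \<phi> < \<beta> \<and> is_arg_of \<phi> (x - a) \<and>
           U x = pow_arg (x - a) \<phi> lam \<cdot>\<^sub>v \<Phi> x))"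

definition connection_relation ::
  "nat \<Rightarrow> complex set \<Rightarrow> complex \<Rightarrow> nat \<Rightarrow> (nat \<Rightarrow> nat) \<Rightarrow> (complex \<Rightarrow> complex vec) \<Rightarrow>
   (nat \<Rightarrow> nat \<Rightarrow> complex) \<Rightarrow> (nat \<Rightarrow> nat \<Rightarrow> complex \<Rightarrow> complex vec) \<Rightarrow> bool" where
  \<comment> \<open>\<open>F = \<Sum>\<^bsub>k \<le> R\<^esub> \<Sum>\<^bsub>h \<le> d k\<^esub> c\<^bsub>k,h\<^esub> V\<^bsub>k,h\<^esub> + hol(x - a)\<close> on \<open>D\<close>, componentwise\<close>
  "connection_relation N D a R d F c V \<longleftrightarrow>
     (\<exists>H. (\<forall>j<N. (\<lambda>x. H x $ j) analytic_on {a}) \<and>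
        (\<forall>x\<in>D. \<forall>j<N. F x $ j = (\<Sum>k=1..R. \<Sum>h=1..d k. c k h * V k h x $ j) + H x $ j))"

definition connection_factor ::
  "(nat \<Rightarrow> complex) \<Rightarrow> nat \<Rightarrow> (nat \<Rightarrow> real) \<Rightarrow> (nat \<Rightarrow> nat \<Rightarrow> complex) \<Rightarrow> complex \<Rightarrow> complex \<Rightarrow>
   nat \<Rightarrow> nat \<Rightarrow> complex" where
  \<comment> \<open>\<open>e\<^bsup>\<pi>\<i>\<lambda>\<^esup> (t\<^sub>i - t\<^bsub>p+1\<^esub>)\<^bsup>2\<lambda> - \<rho>\<^sub>1 - \<rho>\<^sub>2\<^esup>\<close> with \<open>\<lambda> = \<lambda>\<^bsub>i,k\<^esub>\<close> and \<open>arg (t\<^sub>i - t\<^bsub>p+1\<^esub>) = \<theta>\<^sub>i\<close>\<close>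
  "connection_factor t p \<theta> lam \<rho>1 \<rho>2 i k =
     exp (of_real pi * \<i> * lam i k) * pow_arg (t i - t (p + 1)) (\<theta> i) (2 * lam i k - \<rho>1 - \<rho>2)"

end

theory Submission
  imports Defs
begin

text \<open>
  In the logarithmic coordinate \<open>\<omega>\<close> with \<open>x = t\<^bsub>p+1\<^esub> + e\<^sup>\<omega>\<close> and \<open>\<zeta> = \<eta>\<^sub>0 + e\<^bsup>-\<omega>\<^esup>\<close> the sectors become a
  horizontal strip with the two singular points \<open>\<omega>\<^sub>i = log (t\<^sub>i - t\<^bsub>p+1\<^esub>)\<close> on opposite edges. Eliminating
  the last components of the extended system leaves an equation of order two for the first \<open>n\<close>
  components \<open>u\<close>. If \<open>w\<close> solves the underlying system, \<open>c = \<rho>\<^sub>1 + \<rho>\<^sub>2\<close>, and \<open>K\<close> is the solution, regular with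
  \<open>K 0 = 1\<close>, of a hypergeometric equation, then \<open>u = e\<^bsup>c\<omega>\<^esup> (d/d\<omega> + A) (K * w)\<close>, with the
  convolution taken from \<open>\<omega>\<^sub>i\<close>, solves that equation. Since \<open>K 0 = 1\<close>, the leading coefficient of \<open>u\<close> at
  \<open>\<omega>\<^sub>i\<close> is that of \<open>w\<close> times \<open>e\<^bsup>c\<omega>\<^sub>i\<^esup>\<close>; comparing the normalizations of the two local solutions gives
  the factors of the theorem. Changing the starting point of the convolution to the other endpoint
  changes it by a function that is holomorphic there (Cauchy's theorem), so the transform preserves
  the connection coefficients. The local solution is determined by its exponent and leading
  coefficient, which identifies the transform with the given solution.

  The convolution integral only converges for exponents with large real part. This is no
  restriction: \<open>w = dW/d\<zeta>\<close> where \<open>W\<close> solves the system with \<open>A\<close> replaced by \<open>A + 1\<close>, and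
  \<open>d/dx\<close> maps the solutions of the extended equation for \<open>A + 1\<close>, \<open>\<rho>\<^sub>1 + 1\<close>, \<open>\<rho>\<^sub>2 + 1\<close> to those for \<open>A\<close>, \<open>\<rho>\<^sub>1\<close>, \<open>\<rho>\<^sub>2\<close>.
\<close>

section \<open>The kernel\<close>


text \<open>The kernel equation comes from one computation. On the strip the underlying system reads
  w' = \<tau> e^(-\<omega>) (w' + A w), and e^(-\<omega>) = e^(-(\<omega> - \<sigma>)) e^(-\<sigma>)
  passes under a convolution over \<sigma>, one factor to the kernel and one to the function. With M
  = K' + c K, the terms close up to an equation for the transform once (e^(-z) M)' = K'' + c K' + d
  K. This equation is singular where e^z = 1. Neighbouring arguments differ by less than 2 pi, so
  differences of points of a strip satisfy |Im z| < 2 pi, where 0 is the only singular point. The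
  exponent 2 \<lambda> of the factors has two sources: near \<omega>_i, x - t_i behaves like
  e^(\<omega>_i) (\<omega> - \<omega>_i), and \<zeta> - t'_i like -e^(-\<omega>_i) (\<omega> -
  \<omega>_i). The prescribed arguments make the minus sign e^(-i pi), whence e^(i pi \<lambda>). In
  the uniqueness argument the non-integral differences of exponents exclude resonances after the
  leading term, and non-integral \<mu>_k keep A + 1, A + 2, ... invertible for the shifts.\<close>

lemma exp_difference_factor:
  obtains g where "g holomorphic_on UNIV" "g 0 = 1" "\<And>z. 1 - exp (- z :: complex) = z * g z"
proof -
  let ?f = "\<lambda>z::complex. (1 - exp (- z)) / z"
  have "((\<lambda>z::complex. 1 - exp (- z)) has_field_derivative 1) (at 0)"
    by (auto intro!: derivative_eq_intros)
  then have "?f \<midarrow>0\<rightarrow> 1"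
    by (simp add: has_field_derivative_iff)
  moreover have "?f holomorphic_on UNIV - {0}"
    by (auto intro!: holomorphic_intros)
  ultimately have "(\<lambda>z. if z = 0 then 1 else ?f z) holomorphic_on UNIV"
    by (intro removable_singularity) auto
  then show thesis
    by (rule that) auto
qed

text \<open>Along the ray from 0 to z the bound on \<open>F'\<close> becomes M |z|^(k+1) t^k, whose
  integral over [0, 1] produces the divisor k + 1. Iterating this divisor builds the factorial in
  the estimate of the Picard terms.\<close>

lemma norm_primitive_le:
  fixes F :: "complex \<Rightarrow> complex"
  assumes F0: "F 0 = 0" and cont: "continuous_on (closed_segment 0 z) F"
    and der: "\<And>t. 0 < t \<Longrightarrow> t < 1 \<Longrightarrow> (F has_field_derivative F' (of_real t * z)) (at (of_real t * z))"
    and bd: "\<And>t. 0 < t \<Longrightarrow> t < 1 \<Longrightarrow> cmod (F' (of_real t * z)) \<le> M * cmod (of_real t * z) ^ k"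
  shows "cmod (F z) \<le> M * cmod z ^ Suc k / real (Suc k)"
proof -
  let ?f = "\<lambda>t::real. F (of_real t * z)"
  let ?\<phi> = "\<lambda>t::real. M * cmod z ^ Suc k * t ^ Suc k / real (Suc k)"
  have "norm (?f 1 - ?f 0) \<le> ?\<phi> 1 - ?\<phi> 0"
  proof (rule differentiable_bound_general)
    show "continuous_on {0..1} ?f"
      by (rule continuous_on_compose2[OF cont])
         (auto simp: closed_segment_def scaleR_conv_of_real intro!: continuous_intros)
    show "continuous_on {0..1} ?\<phi>" by (intro continuous_intros) auto
    fix t :: real assume t: "0 < t" "t < 1"
    show "(?f has_vector_derivative F' (of_real t * z) * z) (at t)"
    proof -
      have "((\<lambda>t. of_real t * z) has_vector_derivative z) (at t)"
        by (auto intro!: derivative_eq_intros)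
      from field_vector_diff_chain_at[OF this der[OF t]] show ?thesis
        by (simp add: o_def mult.commute)
    qed
    have "real (Suc k) * t ^ k / real (Suc k) = t ^ k" by simp
    then have "M * cmod z ^ Suc k * (real (Suc k) * t ^ k) / real (Suc k) = M * cmod z ^ Suc k * t ^ k"
      by (metis times_divide_eq_right)
    then have "(?\<phi> has_real_derivative M * cmod z ^ Suc k * t ^ k) (at t)"
      using t by (auto intro!: derivative_eq_intros simp del: power_Suc of_nat_Suc)
    then show "(?\<phi> has_vector_derivative M * cmod z ^ Suc k * t ^ k) (at t)"
      by (simp add: has_real_derivative_iff_has_vector_derivative)
    show "norm (F' (of_real t * z) * z) \<le> M * cmod z ^ Suc k * t ^ k"
      using mult_right_mono[OF bd[OF t], of "cmod z"] t
      by (simp add: norm_mult power_mult_distrib mult_ac)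
  qed simp
  then show ?thesis using F0 by simp
qed

text \<open>The widest strip symmetric about the real axis in which \<open>1 - exp (- z)\<close>
  vanishes only at 0; the next zeros, 2 pi i and -2 pi i, lie on its boundary. It contains every
  difference of two points of a strip of width less than 2 pi.\<close>

definition wide_strip :: "complex set" where
  "wide_strip = {z. \<bar>Im z\<bar> < 2 * pi}"

lemma open_wide_strip: "open wide_strip"
proof -
  have "wide_strip = {z. Im z < 2 * pi} \<inter> {z. Im z > - (2 * pi)}"
    by (auto simp: wide_strip_def)
  then show ?thesis by (metis open_Int open_halfspace_Im_lt open_halfspace_Im_gt)
qed

lemma convex_wide_strip: "convex wide_strip"
proof -
  have "wide_strip = {z. Im z < 2 * pi} \<inter> {z. Im z > - (2 * pi)}"
    by (auto simp: wide_strip_def)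
  then show ?thesis by (metis convex_Int convex_halfspace_Im_lt convex_halfspace_Im_gt)
qed

lemma zero_in_wide_strip: "0 \<in> wide_strip" by (simp add: wide_strip_def)

lemma exp_eq_one_in_wide_strip:
  assumes "z \<in> wide_strip" "exp (- z) = 1"
  shows "z = 0"
proof -
  obtain k :: int where "Re (- z) = 0" "Im (- z) = of_int (2 * k) * pi"
    using assms(2) unfolding exp_eq_1 by blast
  moreover have "\<bar>real_of_int (2 * k) * pi\<bar> < 2 * pi"
    using assms(1) calculation(2)[symmetric] by (simp add: wide_strip_def)
  then have "k = 0" by (simp add: abs_mult)
  ultimately show ?thesis by (simp add: complex_eq_iff)
qed

lemma primitive_at_zero:
  assumes "f holomorphic_on wide_strip"
  obtains F where "F holomorphic_on wide_strip" "F 0 = 0"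
    "\<And>z. z \<in> wide_strip \<Longrightarrow> (F has_field_derivative f z) (at z)"
proof -
  obtain G where G: "\<And>z. z \<in> wide_strip \<Longrightarrow> (G has_field_derivative f z) (at z within wide_strip)"
    using holomorphic_convex_primitive'[OF convex_wide_strip open_wide_strip assms] by blast
  have G': "((\<lambda>z. G z - G 0) has_field_derivative f z) (at z)" if "z \<in> wide_strip" for z
    using G[OF that] that at_within_open[OF that open_wide_strip]
    by (auto intro!: derivative_eq_intros)
  show thesis
  proof (rule that[OF _ _ G'])
    show "(\<lambda>z. G z - G 0) holomorphic_on wide_strip"
      using G' by (auto simp: holomorphic_on_open[OF open_wide_strip])
  qed auto
qed

text \<open>
  The kernel satisfies \<open>K'' + c K' + d K = (e\<^bsup>-z\<^esup> (K' + c K))'\<close>, that is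
  \<open>(e\<^bsup>cz\<^esup> (1 - e\<^bsup>-z\<^esup>) K')' = - e\<^bsup>cz\<^esup> (d + c e\<^bsup>-z\<^esup>) K\<close>. It is found by Picard iteration on the second form; the
  simple zero of \<open>1 - e\<^bsup>-z\<^esup>\<close> at \<open>0\<close> is compensated by the zero of the integral of the right-hand side.
\<close>

context
  fixes c d :: complex
begin

text \<open>One Picard step from \<open>f\<close> to \<open>f1\<close>: \<open>F\<close> is minus
  the integral from 0 of the right-hand side. It is a relation, since \<open>F\<close> and
  \<open>f1\<close> come from existence statements for primitives and are chosen afterwards.\<close>

definition kernel_step :: "(complex \<Rightarrow> complex) \<Rightarrow> (complex \<Rightarrow> complex) \<Rightarrow> bool" where
  "kernel_step f f1 \<longleftrightarrow> f1 holomorphic_on wide_strip \<and> f1 0 = 0 \<and>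
     (\<exists>F. F holomorphic_on wide_strip \<and> F 0 = 0 \<and>
       (\<forall>z\<in>wide_strip. (F has_field_derivative exp (c * z) * (d + c * exp (- z)) * f z) (at z) \<and>
          exp (c * z) * (1 - exp (- z)) * deriv f1 z = - F z))"

text \<open>\<open>F\<close> vanishes at 0, so \<open>F z / z\<close> extends holomorphically over 0
  with value \<open>deriv F 0\<close>. With \<open>1 - exp (- z) = z * g z\<close> and
  \<open>g\<close> free of zeros in the strip, the required derivative of \<open>f1\<close> is
  \<open>- (F z / z) / (exp (c * z) * g z)\<close>, which is holomorphic and has a
  primitive.\<close>

lemma kernel_step_exists:
  assumes "f holomorphic_on wide_strip"
  shows "\<exists>f1. kernel_step f f1"
proof -
  obtain g :: "complex \<Rightarrow> complex" where g: "g holomorphic_on UNIV" "g 0 = 1" "\<And>z. 1 - exp (- z) = z * g z"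
    using exp_difference_factor by blast
  have g0: "g z \<noteq> 0" if "z \<in> wide_strip" for z
    using g(2) g(3)[of z] exp_eq_one_in_wide_strip[OF that] by (cases "z = 0") auto
  have "(\<lambda>z. exp (c * z) * (d + c * exp (- z)) * f z) holomorphic_on wide_strip"
    using assms by (auto intro!: holomorphic_intros)
  then obtain F where F: "F holomorphic_on wide_strip" "F 0 = 0"
    "\<And>z. z \<in> wide_strip \<Longrightarrow> (F has_field_derivative exp (c * z) * (d + c * exp (- z)) * f z) (at z)"
    using primitive_at_zero by blast
  define F1 where "F1 = (\<lambda>z. if z = 0 then deriv F 0 else F z / z)"
  have "(F has_field_derivative deriv F 0) (at 0)"
    using holomorphic_derivI[OF F(1) open_wide_strip zero_in_wide_strip] .
  then have "(\<lambda>z. F z / z) \<midarrow>0\<rightarrow> deriv F 0"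
    by (simp add: has_field_derivative_iff F(2))
  then have F1: "F1 holomorphic_on wide_strip" unfolding F1_def
    by (intro removable_singularity)
       (auto intro!: holomorphic_intros holomorphic_on_subset[OF F(1)] open_wide_strip)
  have "(\<lambda>z. - F1 z / (exp (c * z) * g z)) holomorphic_on wide_strip"
    using F1 g0 by (auto intro!: holomorphic_intros holomorphic_on_subset[OF g(1)])
  then obtain f1 where f1: "f1 holomorphic_on wide_strip" "f1 0 = 0"
    "\<And>z. z \<in> wide_strip \<Longrightarrow> (f1 has_field_derivative - F1 z / (exp (c * z) * g z)) (at z)"
    using primitive_at_zero by blast
  have "exp (c * z) * (1 - exp (- z)) * deriv f1 z = - F z" if "z \<in> wide_strip" for z
    using DERIV_imp_deriv[OF f1(3)[OF that]] g0[OF that] F(2) by (simp add: g(3) F1_def)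
  then show ?thesis
    unfolding kernel_step_def using f1 F by blast
qed

primrec kernel_term :: "nat \<Rightarrow> complex \<Rightarrow> complex" where
  "kernel_term 0 = (\<lambda>_. 1)"
| "kernel_term (Suc k) = (SOME f1. kernel_step (kernel_term k) f1)"

lemma kernel_term_holomorphic: "kernel_term k holomorphic_on wide_strip"
  and kernel_term_step: "kernel_step (kernel_term k) (kernel_term (Suc k))"
proof -
  have *: "kernel_step (kernel_term k) (kernel_term (Suc k))"
    if "kernel_term k holomorphic_on wide_strip" for k
    using someI_ex[OF kernel_step_exists[OF that]] by simp
  have **: "kernel_term k holomorphic_on wide_strip" for k
  proof (induction k)
    case (Suc k) then show ?case using *[OF Suc] by (simp add: kernel_step_def)
  qed simp
  show "kernel_term k holomorphic_on wide_strip" by (fact **)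
  show "kernel_step (kernel_term k) (kernel_term (Suc k))" by (rule *[OF **])
qed

lemma kernel_term_zero: "kernel_term (Suc k) 0 = 0"
  using kernel_term_step[of k] by (simp add: kernel_step_def)

text \<open>\<open>C\<close> is convex and contains 0, so the segments of integration stay in it.
  One integration bounds \<open>F\<close> by a multiple of |w|^(k+1) / (k+1); dividing by the zero
  of \<open>1 - exp (- w)\<close> costs one power of |w|, and the second integration restores it.
  \<open>B\<close> is the product of bounds for \<open>1 / (exp (c * z) * g z)\<close> and
  \<open>exp (c * z) * (d + c * exp (- z))\<close> on \<open>C\<close>.\<close>

lemma kernel_term_bound:
  assumes C: "compact C" "convex C" "C \<subseteq> wide_strip" "0 \<in> C"
  obtains B where "0 \<le> B" "\<And>k z. z \<in> C \<Longrightarrow> cmod (kernel_term k z) \<le> B ^ k * cmod z ^ k / fact k"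
proof -
  obtain g :: "complex \<Rightarrow> complex" where g: "g holomorphic_on UNIV" "g 0 = 1" "\<And>z. 1 - exp (- z) = z * g z"
    using exp_difference_factor by blast
  have g0: "g z \<noteq> 0" if "z \<in> wide_strip" for z
    using g(2) g(3)[of z] exp_eq_one_in_wide_strip[OF that] by (cases "z = 0") auto
  let ?H = "\<lambda>z. 1 / (exp (c * z) * g z)" and ?Q = "\<lambda>z. exp (c * z) * (d + c * exp (- z))"
  have "continuous_on C g" using g(1) by (meson holomorphic_on_imp_continuous_on continuous_on_subset subset_UNIV)
  then have "continuous_on C ?H" using g0 C(3) by (intro continuous_intros) auto
  then obtain B1 where B1: "\<And>z. z \<in> C \<Longrightarrow> cmod (?H z) \<le> B1"
    using compact_imp_bounded[OF compact_continuous_image[OF _ C(1)]] by (force simp: bounded_iff)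
  have "continuous_on C ?Q" by (intro continuous_intros)
  then obtain B2 where B2: "\<And>z. z \<in> C \<Longrightarrow> cmod (?Q z) \<le> B2"
    using compact_imp_bounded[OF compact_continuous_image[OF _ C(1)]] by (force simp: bounded_iff)
  have B1_0: "0 \<le> B1" and B2_0: "0 \<le> B2"
    using B1[OF C(4)] B2[OF C(4)] norm_ge_zero order_trans by blast+
  have star: "of_real t * z \<in> C" if "z \<in> C" "0 \<le> t" "t \<le> 1" for z t
    using convexD[OF C(2) that(1) C(4), of t "1 - t"] that by (simp add: scaleR_conv_of_real)
  have seg: "closed_segment 0 z \<subseteq> wide_strip" if "z \<in> C" for z
    using C that by (meson closed_segment_subset order_trans)
  define B where "B = B1 * B2"
  have "cmod (kernel_term k z) \<le> B ^ k * cmod z ^ k / fact k" if "z \<in> C" for k z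
    using that
  proof (induction k arbitrary: z)
    case (Suc k)
    obtain F where F: "F holomorphic_on wide_strip" "F 0 = 0"
       "\<And>z. z \<in> wide_strip \<Longrightarrow> (F has_field_derivative ?Q z * kernel_term k z) (at z)"
       "\<And>z. z \<in> wide_strip \<Longrightarrow> exp (c * z) * (1 - exp (- z)) * deriv (kernel_term (Suc k)) z = - F z"
      using kernel_term_step[of k] unfolding kernel_step_def by blast
    let ?M = "B2 * (B ^ k / fact k)"
    have FB: "cmod (F w) \<le> ?M * cmod w ^ Suc k / real (Suc k)" if w: "w \<in> C" for w
    proof (rule norm_primitive_le[where F' = "\<lambda>z. ?Q z * kernel_term k z"])
      show "continuous_on (closed_segment 0 w) F"
        using F(1) seg[OF w] by (meson holomorphic_on_imp_continuous_on continuous_on_subset)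
      fix t :: real assume t: "0 < t" "t < 1"
      have in_C: "of_real t * w \<in> C" using star[OF w] t by simp
      show "(F has_field_derivative ?Q (of_real t * w) * kernel_term k (of_real t * w)) (at (of_real t * w))"
        using F(3) in_C C(3) by blast
      have "cmod (?Q (of_real t * w)) * cmod (kernel_term k (of_real t * w)) \<le>
        B2 * (B ^ k * cmod (of_real t * w) ^ k / fact k)"
        by (intro mult_mono B2 Suc.IH in_C B2_0) auto
      then show "cmod (?Q (of_real t * w) * kernel_term k (of_real t * w)) \<le> ?M * cmod (of_real t * w) ^ k"
        by (simp only: norm_mult) (simp add: mult_ac)
    qed (fact F(2))
    let ?N = "B * (B ^ k / fact k) / real (Suc k)"
    have "cmod (kernel_term (Suc k) z) \<le> ?N * cmod z ^ Suc k / real (Suc k)"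
    proof (cases "z = 0")
      case True
      then show ?thesis using kernel_term_zero[of k] by simp
    next
      case False
      show ?thesis
      proof (rule norm_primitive_le[where F' = "deriv (kernel_term (Suc k))"])
      show "continuous_on (closed_segment 0 z) (kernel_term (Suc k))"
        using kernel_term_holomorphic seg[OF Suc.prems] by (meson holomorphic_on_imp_continuous_on continuous_on_subset)
      fix t :: real assume t: "0 < t" "t < 1"
      let ?w = "of_real t * z"
      have in_C: "?w \<in> C" using star[OF Suc.prems] t by simp
      then have in_D: "?w \<in> wide_strip" using C(3) by blast
      show "(kernel_term (Suc k) has_field_derivative deriv (kernel_term (Suc k)) ?w) (at ?w)"
        by (rule holomorphic_derivI[OF kernel_term_holomorphic open_wide_strip in_D])
      show "cmod (deriv (kernel_term (Suc k)) ?w) \<le> ?N * cmod ?w ^ k"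
      proof -
        have "?w * deriv (kernel_term (Suc k)) ?w = - ?H ?w * F ?w"
          using F(4)[OF in_D] g0[OF in_D] by (simp add: g(3) field_simps)
        then have "cmod ?w * cmod (deriv (kernel_term (Suc k)) ?w) = cmod (?H ?w) * cmod (F ?w)"
          by (metis norm_minus_cancel norm_mult)
        also have "\<dots> \<le> B1 * (?M * cmod ?w ^ Suc k / real (Suc k))"
          by (intro mult_mono B1 FB in_C B1_0) auto
        also have "\<dots> = cmod ?w * (?N * cmod ?w ^ k)"
          by (simp add: B_def mult_ac)
        finally show ?thesis
          by (rule mult_left_le_imp_le) (use \<open>z \<noteq> 0\<close> t in simp)
      qed
    qed (fact kernel_term_zero)
    qed
    \<comment> \<open>Both integrations yield a divisor k + 1; the one already in \<open>?N\<close>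
      completes the factorial, the other is discarded.\<close>
    also have "\<dots> \<le> ?N * cmod z ^ Suc k"
      using B1_0 B2_0 by (intro divide_left_mono[where b=1, simplified] ) (auto simp: B_def field_simps)
    also have "\<dots> = B ^ Suc k * cmod z ^ Suc k / fact (Suc k)"
      by (simp add: field_simps)
    finally show ?case .
  qed simp
  moreover have "0 \<le> B" using B1_0 B2_0 by (simp add: B_def)
  ultimately show thesis using that by blast
qed


text \<open>On compact rectangles the Picard series is dominated by an exponential series, so its
  partial sums and their derivatives converge locally uniformly. The differential operator sends the
  partial sum with n + 1 terms to \<open>- ?Q\<close> times the one with n terms, and this survives
  the limit.\<close>

lemma kernel_exists:
  obtains K where "K holomorphic_on wide_strip" "K 0 = 1"
    "\<And>z. z \<in> wide_strip \<Longrightarrow> deriv (deriv K) z + c * deriv K z + d * K z =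
       exp (- z) * (deriv (deriv K) z + (c - 1) * deriv K z - c * K z)"
proof -
  let ?f = kernel_term
  define K where "K = (\<lambda>z. \<Sum>k. ?f k z)"
  define S where "S = (\<lambda>n z. \<Sum>k<n. ?f k z)"
  have lim: "\<exists>e>0. cball x e \<subseteq> wide_strip \<and> uniform_limit (cball x e) S K sequentially"
    if x: "x \<in> wide_strip" for x
  proof -
    define R where "R = \<bar>Re x\<bar> + 1"
    \<comment> \<open>The mean of |Im x| and 2 pi: the closed rectangle of half-height
      \<open>h\<close> still lies in the open strip and leaves room for a disc about
      \<open>x\<close>.\<close>
    define h where "h = (\<bar>Im x\<bar> + 2 * pi) / 2"
    define e where "e = min 1 (h - \<bar>Im x\<bar>)"
    define C where "C = cbox (Complex (- R) (- h)) (Complex R h)"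
    have h: "\<bar>Im x\<bar> < h" "h < 2 * pi" using x by (auto simp: h_def wide_strip_def)
    have C: "compact C" "convex C" "C \<subseteq> wide_strip" "0 \<in> C"
      using h by (auto simp: C_def wide_strip_def in_cbox_complex_iff R_def)
    have sub: "cball x e \<subseteq> C"
    proof
      fix y assume "y \<in> cball x e"
      then have "cmod (y - x) \<le> e" by (simp add: dist_norm norm_minus_commute)
      then have "\<bar>Re y - Re x\<bar> \<le> e" "\<bar>Im y - Im x\<bar> \<le> e"
        using abs_Re_le_cmod[of "y - x"] abs_Im_le_cmod[of "y - x"] by auto
      then show "y \<in> C" by (auto simp: C_def in_cbox_complex_iff R_def e_def)
    qed
    obtain B where B: "0 \<le> B" "\<And>k z. z \<in> C \<Longrightarrow> cmod (?f k z) \<le> B ^ k * cmod z ^ k / fact k"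
      using kernel_term_bound[OF C] by blast
    obtain M where M: "\<And>z. z \<in> C \<Longrightarrow> cmod z \<le> M"
      using compact_imp_bounded[OF C(1)] by (auto simp: bounded_iff)
    have "uniform_limit C S K sequentially"
      unfolding S_def K_def
    proof (rule Weierstrass_m_test)
      fix k z assume z: "z \<in> C"
      have "cmod (?f k z) \<le> B ^ k * cmod z ^ k / fact k" by (rule B(2)[OF z])
      also have "\<dots> \<le> B ^ k * M ^ k / fact k"
        by (intro divide_right_mono mult_left_mono power_mono M z) (use B(1) in auto)
      finally show "cmod (?f k z) \<le> (B * M) ^ k /\<^sub>R fact k"
        by (simp add: power_mult_distrib divide_inverse mult_ac)
    qed (use summable_exp_generic[of "B * M"] in simp)
    then have "uniform_limit (cball x e) S K sequentially"
      by (rule uniform_limit_on_subset[OF _ sub])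
    then show ?thesis using sub C(3) h by (intro exI[of _ e]) (auto simp: e_def)
  qed
  have S_hol: "S n holomorphic_on wide_strip" for n
    unfolding S_def by (intro holomorphic_intros kernel_term_holomorphic)
  have K_hol: "K holomorphic_on wide_strip"
    using open_wide_strip S_hol lim by (rule holomorphic_uniform_sequence)
  have "?f k 0 = (if k = 0 then 1 else 0)" for k
    using kernel_term_zero by (cases k) (auto simp del: kernel_term.simps(2))
  then have K0: "K 0 = 1"
    using suminf_finite[of "{0::nat}" "\<lambda>k. ?f k 0"] by (simp add: K_def)
  have ode: "deriv (deriv K) z + c * deriv K z + d * K z =
       exp (- z) * (deriv (deriv K) z + (c - 1) * deriv K z - c * K z)" if z: "z \<in> wide_strip" for z
  proof -
    let ?p = "\<lambda>z. exp (c * z) * (1 - exp (- z))"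
    let ?p' = "exp (c * z) * (c + (1 - c) * exp (- z))"
    let ?Q = "exp (c * z) * (d + c * exp (- z))"
    have d1: "(?f k has_field_derivative deriv (?f k) w) (at w)" if "w \<in> wide_strip" for k w
      by (rule holomorphic_derivI[OF kernel_term_holomorphic open_wide_strip that])
    have d2: "(deriv (?f k) has_field_derivative deriv (deriv (?f k)) w) (at w)" if "w \<in> wide_strip" for k w
      by (rule holomorphic_derivI[OF holomorphic_deriv[OF kernel_term_holomorphic open_wide_strip] open_wide_strip that])
    have step: "?p z * deriv (deriv (?f (Suc k))) z + ?p' * deriv (?f (Suc k)) z = - ?Q * ?f k z" for k
    proof -
      obtain F where F: "\<And>w. w \<in> wide_strip \<Longrightarrow>
          (F has_field_derivative exp (c * w) * (d + c * exp (- w)) * ?f k w) (at w)"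
        "\<And>w. w \<in> wide_strip \<Longrightarrow> ?p w * deriv (?f (Suc k)) w = - F w"
        using kernel_term_step[of k] unfolding kernel_step_def by blast
      have "((\<lambda>w. - F w) has_field_derivative - (?Q * ?f k z)) (at z)"
        by (intro DERIV_minus F z)
      then have "((\<lambda>w. ?p w * deriv (?f (Suc k)) w) has_field_derivative - (?Q * ?f k z)) (at z)"
        by (rule has_field_derivative_transform_within_open[OF _ open_wide_strip z]) (simp add: F del: kernel_term.simps)
      moreover have "((\<lambda>w. ?p w * deriv (?f (Suc k)) w) has_field_derivative
          ?p' * deriv (?f (Suc k)) z + ?p z * deriv (deriv (?f (Suc k))) z) (at z)"
        by (rule derivative_eq_intros d2[OF z] refl | simp)+ (simp add: algebra_simps)
      ultimately show ?thesis using DERIV_unique by fastforce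
    qed
    have d1S: "deriv (S n) w = (\<Sum>k<n. deriv (?f k) w)" if "w \<in> wide_strip" for n w
      unfolding S_def by (intro DERIV_imp_deriv DERIV_sum d1 that)
    have d2S: "deriv (deriv (S n)) z = (\<Sum>k<n. deriv (deriv (?f k)) z)" for n
    proof (rule DERIV_imp_deriv)
      have "((\<lambda>w. \<Sum>k<n. deriv (?f k) w) has_field_derivative (\<Sum>k<n. deriv (deriv (?f k)) z)) (at z)"
        by (intro DERIV_sum d2 z)
      then show "(deriv (S n) has_field_derivative (\<Sum>k<n. deriv (deriv (?f k)) z)) (at z)"
        by (rule has_field_derivative_transform_within_open[OF _ open_wide_strip z]) (simp add: d1S)
    qed
    have "deriv (?f 0) = (\<lambda>_. 0)" by (auto simp: fun_eq_iff)
    then have f0: "deriv (?f 0) z = 0" "deriv (deriv (?f 0)) z = 0" by auto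
    \<comment> \<open>The constant term 1 has zero derivatives, so the sum on the left starts at
      index 1 and pairs with the terms of \<open>S n\<close> one index lower.\<close>
    have sums: "?p z * deriv (deriv (S (Suc n))) z + ?p' * deriv (S (Suc n)) z = - ?Q * S n z" for n
    proof -
      have "?p z * deriv (deriv (S (Suc n))) z + ?p' * deriv (S (Suc n)) z =
        (\<Sum>k<n. ?p z * deriv (deriv (?f (Suc k))) z + ?p' * deriv (?f (Suc k)) z)"
        by (simp only: d1S[OF z] d2S sum.lessThan_Suc_shift f0 sum.distrib sum_distrib_left add_0)
      also have "\<dots> = (\<Sum>k<n. - ?Q * ?f k z)" by (simp only: step)
      finally show ?thesis by (simp add: S_def sum_distrib_left)
    qed
    obtain e where e: "0 < e" "cball z e \<subseteq> wide_strip" "uniform_limit (cball z e) S K sequentially"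
      using lim[OF z] by blast
    have ulim: "uniform_limit (ball z e) S K sequentially"
      by (rule uniform_limit_on_subset[OF e(3) ball_subset_cball])
    have hol: "\<forall>\<^sub>F n in sequentially. S n holomorphic_on ball z e"
      using S_hol e(2) ball_subset_cball by (meson always_eventually holomorphic_on_subset)
    have zb: "z \<in> ball z e" using e(1) by simp
    have l0: "(\<lambda>n. S n z) \<longlonglongrightarrow> K z"
      by (rule tendsto_uniform_limitI[OF ulim zb])
    have l1: "(\<lambda>n. deriv (S (Suc n)) z) \<longlonglongrightarrow> deriv K z"
      using deriv_complex_uniform_limit[OF ulim hol _ open_ball zb] LIMSEQ_Suc by auto
    have l2: "(\<lambda>n. deriv (deriv (S (Suc n))) z) \<longlonglongrightarrow> deriv (deriv K) z"
      using higher_deriv_complex_uniform_limit[OF ulim hol _ open_ball zb, of 2] LIMSEQ_Suc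
      by (auto simp: numeral_2_eq_2)
    have "(\<lambda>n. ?p z * deriv (deriv (S (Suc n))) z + ?p' * deriv (S (Suc n)) z) \<longlonglongrightarrow>
        ?p z * deriv (deriv K) z + ?p' * deriv K z"
      by (intro tendsto_intros l1 l2)
    moreover have "(\<lambda>n. - ?Q * S n z) \<longlonglongrightarrow> - ?Q * K z"
      by (intro tendsto_intros l0)
    ultimately have "?p z * deriv (deriv K) z + ?p' * deriv K z = - ?Q * K z"
      unfolding sums by (rule LIMSEQ_unique)
    then have "exp (c * z) * ((1 - exp (- z)) * deriv (deriv K) z + (c + (1 - c) * exp (- z)) * deriv K z
        + (d + c * exp (- z)) * K z) = 0"
      by (simp add: algebra_simps)
    then have "(1 - exp (- z)) * deriv (deriv K) z + (c + (1 - c) * exp (- z)) * deriv K z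
        + (d + c * exp (- z)) * K z = 0"
      by simp
    then show ?thesis by (simp add: algebra_simps)
  qed
  show thesis using that K_hol K0 ode by blast
qed

end

section \<open>Convolution on the strip\<close>

text \<open>The integral of K(\<omega> - \<sigma>) f(\<sigma>) over the segment from
  \<open>a\<close> to \<omega>, with \<sigma> = a + t (\<omega> - a). The fixed interval [0, 1] puts
  all dependence on \<omega> into the integrand, which can then be differentiated under the integral
  sign.\<close>

definition conv :: "(complex \<Rightarrow> complex) \<Rightarrow> complex \<Rightarrow> (complex \<Rightarrow> complex) \<Rightarrow> complex \<Rightarrow> complex" where
  "conv K a f \<omega> = integral (cbox 0 1)
     (\<lambda>t::real. (\<omega> - a) * K ((1 - of_real t) * (\<omega> - a)) * f (a + of_real t * (\<omega> - a)))"

lemma conv_cong: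
  assumes "\<And>t. 0 \<le> t \<Longrightarrow> t \<le> 1 \<Longrightarrow> f (a + of_real t * (\<omega> - a)) = g (a + of_real t * (\<omega> - a))"
  shows "conv K a f \<omega> = conv K a g \<omega>"
  unfolding conv_def by (rule integral_cong) (use assms in simp)

lemma vector_derivative_compose_affine:
  assumes "(F has_field_derivative F') (at (p + of_real t * v))"
  shows "((\<lambda>t::real. F (p + of_real t * v)) has_vector_derivative v * F') (at t)"
proof -
  have "((\<lambda>t. p + of_real t * v) has_vector_derivative v) (at t)"
    by (auto intro!: derivative_eq_intros)
  from field_vector_diff_chain_at[OF this assms] show ?thesis
    by (simp add: o_def)
qed

text \<open>The condition \<open>star\<close> is imposed for t > 0 only, which allows
  \<open>a\<close> to be a boundary point of \<open>S\<close> where \<open>f\<close> and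
  \<open>f'\<close> are just continuous. The other use has \<open>S\<close> a disc with centre
  \<open>a\<close>.\<close>

locale convolution =
  fixes S D :: "complex set" and a :: complex and K f f' :: "complex \<Rightarrow> complex"
  assumes open_S: "open S" and convex_S: "convex S" and open_D: "open D"
    and star: "\<And>\<omega> t. \<omega> \<in> S \<Longrightarrow> 0 < t \<Longrightarrow> t \<le> 1 \<Longrightarrow> a + of_real t * (\<omega> - a) \<in> S"
    and in_D: "\<And>\<omega> t. \<omega> \<in> S \<Longrightarrow> 0 \<le> t \<Longrightarrow> t \<le> 1 \<Longrightarrow> of_real t * (\<omega> - a) \<in> D"
    and K: "K holomorphic_on D"
    and f: "continuous_on (insert a S) f" "continuous_on (insert a S) f'"
      "\<And>\<omega>. \<omega> \<in> S \<Longrightarrow> (f has_field_derivative f' \<omega>) (at \<omega>)"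
begin

lemma star': "\<omega> \<in> S \<Longrightarrow> 0 \<le> t \<Longrightarrow> t \<le> 1 \<Longrightarrow> a + of_real t * (\<omega> - a) \<in> insert a S"
  using star[of \<omega> t] by (cases "t = 0") auto

lemma in_D': "\<omega> \<in> S \<Longrightarrow> 0 \<le> t \<Longrightarrow> t \<le> 1 \<Longrightarrow> (1 - of_real t) * (\<omega> - a) \<in> D"
  using in_D[of \<omega> "1 - t"] by simp

lemma K': "deriv K holomorphic_on D" by (rule holomorphic_deriv[OF K open_D])

lemma cont_pair:
  "continuous_on (S \<times> {0..1}) (\<lambda>(\<omega>, t). K ((1 - of_real t) * (\<omega> - a)))"
  "continuous_on (S \<times> {0..1}) (\<lambda>(\<omega>, t). deriv K ((1 - of_real t) * (\<omega> - a)))"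
  "continuous_on (S \<times> {0..1}) (\<lambda>(\<omega>, t). f (a + of_real t * (\<omega> - a)))"
  "continuous_on (S \<times> {0..1}) (\<lambda>(\<omega>, t). f' (a + of_real t * (\<omega> - a)))"
proof -
  have c: "continuous_on (S \<times> {0..1}) (\<lambda>p. (1 - of_real (snd p)) * (fst p - a))"
    "continuous_on (S \<times> {0..1}) (\<lambda>p. a + of_real (snd p) * (fst p - a))"
    by (intro continuous_intros)+
  have s: "(\<lambda>p. (1 - of_real (snd p)) * (fst p - a)) ` (S \<times> {0..1::real}) \<subseteq> D"
    "(\<lambda>p. a + of_real (snd p) * (fst p - a)) ` (S \<times> {0..1::real}) \<subseteq> insert a S"
    by ((rule image_subsetI, rule in_D'); auto) ((rule image_subsetI, rule star'); auto)
  show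
  "continuous_on (S \<times> {0..1}) (\<lambda>(\<omega>, t). K ((1 - of_real t) * (\<omega> - a)))"
  "continuous_on (S \<times> {0..1}) (\<lambda>(\<omega>, t). deriv K ((1 - of_real t) * (\<omega> - a)))"
  "continuous_on (S \<times> {0..1}) (\<lambda>(\<omega>, t). f (a + of_real t * (\<omega> - a)))"
  "continuous_on (S \<times> {0..1}) (\<lambda>(\<omega>, t). f' (a + of_real t * (\<omega> - a)))"
    unfolding split_beta
    by (rule continuous_on_compose2[OF holomorphic_on_imp_continuous_on[OF K] c(1) s(1)]
      continuous_on_compose2[OF holomorphic_on_imp_continuous_on[OF K'] c(1) s(1)]
      continuous_on_compose2[OF f(1) c(2) s(2)] continuous_on_compose2[OF f(2) c(2) s(2)])+
qed

lemma cont_t: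
  assumes "\<omega> \<in> S"
  shows "continuous_on {0..1} (\<lambda>t::real. K ((1 - of_real t) * (\<omega> - a)))"
    "continuous_on {0..1} (\<lambda>t::real. deriv K ((1 - of_real t) * (\<omega> - a)))"
    "continuous_on {0..1} (\<lambda>t::real. f (a + of_real t * (\<omega> - a)))"
    "continuous_on {0..1} (\<lambda>t::real. f' (a + of_real t * (\<omega> - a)))"
proof -
  have c: "continuous_on {0..1} (\<lambda>t::real. (\<omega>, t))" by (intro continuous_intros)
  have s: "(\<lambda>t. (\<omega>, t)) ` {0..1} \<subseteq> S \<times> {0..1::real}" using assms by auto
  show "continuous_on {0..1} (\<lambda>t::real. K ((1 - of_real t) * (\<omega> - a)))"
    "continuous_on {0..1} (\<lambda>t::real. deriv K ((1 - of_real t) * (\<omega> - a)))"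
    "continuous_on {0..1} (\<lambda>t::real. f (a + of_real t * (\<omega> - a)))"
    "continuous_on {0..1} (\<lambda>t::real. f' (a + of_real t * (\<omega> - a)))"
    using cont_pair[THEN continuous_on_compose2, OF c s] by simp_all
qed

lemma K_derivative:
  assumes "\<omega> \<in> S" "0 \<le> t" "t \<le> 1"
  shows "(K has_field_derivative deriv K ((1 - of_real t) * (\<omega> - a))) (at ((1 - of_real t) * (\<omega> - a)))"
  by (rule holomorphic_derivI[OF K open_D in_D'[OF assms]])

lemma K_path_derivative:
  assumes "\<omega> \<in> S" "0 < t" "t < 1"
  shows "((\<lambda>t::real. K ((1 - of_real t) * (\<omega> - a))) has_vector_derivative
    - ((\<omega> - a) * deriv K ((1 - of_real t) * (\<omega> - a)))) (at t)"
  using vector_derivative_compose_affine[of K "deriv K ((1 - of_real t) * (\<omega> - a))" "\<omega> - a" t "- (\<omega> - a)"]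
    K_derivative[of \<omega> t] assms by (simp add: algebra_simps)

lemma f_path_derivative:
  assumes "\<omega> \<in> S" "0 < t" "t < 1"
  shows "((\<lambda>t::real. f (a + of_real t * (\<omega> - a))) has_vector_derivative
    (\<omega> - a) * f' (a + of_real t * (\<omega> - a))) (at t)"
  by (rule vector_derivative_compose_affine[OF f(3)]) (use star assms in simp)

lemma conv_integrable:
  assumes "\<omega> \<in> S"
  shows "(\<lambda>t::real. (\<omega> - a) * K ((1 - of_real t) * (\<omega> - a)) * f (a + of_real t * (\<omega> - a))) integrable_on cbox 0 1"
    "(\<lambda>t::real. (\<omega> - a) * K ((1 - of_real t) * (\<omega> - a)) * f' (a + of_real t * (\<omega> - a))) integrable_on cbox 0 1"
  unfolding box_real by (intro integrable_continuous_interval continuous_intros cont_t assms)+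

text \<open>Differentiation under the integral sign gives \<open>fx\<close>. It differs from the
  integrand of the convolution with \<open>deriv K\<close> by the t-derivative of t K((1 -
  t)(\<omega> - a)) f(a + t (\<omega> - a)), whose integral is the boundary term
  \<open>K 0 * f \<omega>\<close>.\<close>

lemma conv_derivative:
  assumes "\<omega> \<in> S"
  shows "(conv K a f has_field_derivative K 0 * f \<omega> + conv (deriv K) a f \<omega>) (at \<omega>)"
proof -
  let ?k = "\<lambda>x t::real. K ((1 - of_real t) * (x - a))"
  let ?k' = "\<lambda>x t::real. deriv K ((1 - of_real t) * (x - a))"
  let ?f = "\<lambda>x t::real. f (a + of_real t * (x - a))"
  let ?f' = "\<lambda>x t::real. f' (a + of_real t * (x - a))"
  define fx where "fx = (\<lambda>x t. ?k x t * ?f x t + (x - a) * (1 - of_real t) * ?k' x t * ?f x t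
     + (x - a) * ?k x t * (of_real t * ?f' x t))"
  have "((\<lambda>x. integral (cbox 0 1) (\<lambda>t. (x - a) * ?k x t * ?f x t)) has_field_derivative
      integral (cbox 0 1) (fx \<omega>)) (at \<omega> within S)"
  proof (rule leibniz_rule_field_derivative[OF _ _ _ assms convex_S])
    fix x and t :: real assume x: "x \<in> S" and t: "t \<in> cbox 0 1"
    have kd: "((\<lambda>x. ?k x t) has_field_derivative (1 - of_real t) * ?k' x t) (at x)"
    proof -
      have "((\<lambda>x. (1 - of_real t) * (x - a)) has_field_derivative (1 - of_real t)) (at x)"
        by (auto intro!: derivative_eq_intros)
      from DERIV_chain[OF K_derivative[of x t] this] show ?thesis
        using x t by (simp add: o_def mult.commute)
    qed
    have fd: "((\<lambda>x. ?f x t) has_field_derivative of_real t * ?f' x t) (at x)"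
    proof (cases "t = 0")
      case False
      have "((\<lambda>x. a + of_real t * (x - a)) has_field_derivative of_real t) (at x)"
        by (auto intro!: derivative_eq_intros)
      from DERIV_chain[OF f(3) this] show ?thesis
        using x t False star[of x t] by (simp add: o_def mult.commute)
    qed simp
    have "((\<lambda>x. (x - a) * ?k x t * ?f x t) has_field_derivative fx x t) (at x)"
      unfolding fx_def
      by (rule derivative_eq_intros kd fd refl | simp)+ (simp add: algebra_simps)
    then show "((\<lambda>x. (x - a) * ?k x t * ?f x t) has_field_derivative fx x t) (at x within S)"
      by (rule has_field_derivative_at_within)
  next
    fix x assume "x \<in> S"
    then show "(\<lambda>t. (x - a) * ?k x t * ?f x t) integrable_on cbox 0 1"
      unfolding box_real by (intro integrable_continuous_interval continuous_intros cont_t)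
  next
    show "continuous_on (S \<times> cbox 0 1) (\<lambda>(x, t). fx x t)"
      using cont_pair unfolding fx_def split_beta box_real by (intro continuous_intros)
  qed
  then have der: "(conv K a f has_field_derivative integral (cbox 0 1) (fx \<omega>)) (at \<omega>)"
    unfolding conv_def using at_within_open[OF assms open_S] by simp
  let ?P' = "\<lambda>t. ?k \<omega> t * ?f \<omega> t - of_real t * (\<omega> - a) * ?k' \<omega> t * ?f \<omega> t + of_real t * (\<omega> - a) * ?k \<omega> t * ?f' \<omega> t"
  have I1: "(?P' has_integral (of_real 1 * ?k \<omega> 1 * ?f \<omega> 1 - of_real 0 * ?k \<omega> 0 * ?f \<omega> 0)) {0..1}"
  proof (rule fundamental_theorem_of_calculus_interior)
    show "continuous_on {0..1} (\<lambda>t. of_real t * ?k \<omega> t * ?f \<omega> t)"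
      by (intro continuous_intros cont_t assms)
    fix t :: real assume "t \<in> {0<..<1}"
    then have t: "0 < t" "t < 1" by auto
    have of_real_der: "(complex_of_real has_vector_derivative 1) (at t)"
      by (auto intro!: derivative_eq_intros)
    show "((\<lambda>t. of_real t * ?k \<omega> t * ?f \<omega> t) has_vector_derivative ?P' t) (at t)"
      using has_vector_derivative_mult[OF has_vector_derivative_mult[OF of_real_der
          K_path_derivative[OF assms t]] f_path_derivative[OF assms t]]
      by (simp add: algebra_simps)
  qed simp
  have I2: "((\<lambda>t. (\<omega> - a) * ?k' \<omega> t * ?f \<omega> t) has_integral conv (deriv K) a f \<omega>) {0..1}"
    unfolding conv_def box_real
    by (intro integrable_integral integrable_continuous_interval continuous_intros cont_t assms)
  have "of_real 1 * ?k \<omega> 1 * ?f \<omega> 1 - of_real 0 * ?k \<omega> 0 * ?f \<omega> 0 = K 0 * f \<omega>" by simp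
  from has_integral_add[OF I1[unfolded this] I2]
  have "((\<lambda>t. ?P' t + (\<omega> - a) * ?k' \<omega> t * ?f \<omega> t) has_integral
      K 0 * f \<omega> + conv (deriv K) a f \<omega>) {0..1}" .
  moreover have "?P' t + (\<omega> - a) * ?k' \<omega> t * ?f \<omega> t = fx \<omega> t" for t
    by (simp add: fx_def algebra_simps)
  ultimately have "integral (cbox 0 1) (fx \<omega>) = K 0 * f \<omega> + conv (deriv K) a f \<omega>"
    by (simp add: integral_unique)
  with der show ?thesis by simp
qed

text \<open>Integrates the t-derivative of K((1 - t)(\<omega> - a)) f(a + t (\<omega> - a)): the end
  t = 1 gives \<open>K 0 * f \<omega>\<close>, the end t = 0 gives
  \<open>K (\<omega> - a) * f a\<close>. In the transform \<open>f a = 0\<close>, so a derivative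
  moves between kernel and function at the cost of the term at \<omega> alone.\<close>

lemma conv_by_parts:
  assumes "\<omega> \<in> S"
  shows "conv (deriv K) a f \<omega> + K 0 * f \<omega> = conv K a f' \<omega> + K (\<omega> - a) * f a"
proof -
  let ?k = "\<lambda>t::real. K ((1 - of_real t) * (\<omega> - a))"
  let ?k' = "\<lambda>t::real. deriv K ((1 - of_real t) * (\<omega> - a))"
  let ?f = "\<lambda>t::real. f (a + of_real t * (\<omega> - a))"
  let ?f' = "\<lambda>t::real. f' (a + of_real t * (\<omega> - a))"
  have 1: "((\<lambda>t. (\<omega> - a) * ?k t * ?f' t - (\<omega> - a) * ?k' t * ?f t) has_integral ?k 1 * ?f 1 - ?k 0 * ?f 0) {0..1}"
  proof (rule fundamental_theorem_of_calculus_interior)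
    show "continuous_on {0..1} (\<lambda>t. ?k t * ?f t)"
      by (intro continuous_intros cont_t assms)
    fix t :: real assume "t \<in> {0<..<1}"
    then have t: "0 < t" "t < 1" by auto
    show "((\<lambda>t. ?k t * ?f t) has_vector_derivative (\<omega> - a) * ?k t * ?f' t - (\<omega> - a) * ?k' t * ?f t) (at t)"
      using has_vector_derivative_mult[OF K_path_derivative[OF assms t] f_path_derivative[OF assms t]]
      by (simp add: algebra_simps)
  qed simp
  have 2: "((\<lambda>t. (\<omega> - a) * ?k' t * ?f t) has_integral conv (deriv K) a f \<omega>) {0..1}"
    unfolding conv_def box_real
    by (intro integrable_integral integrable_continuous_interval continuous_intros cont_t assms)
  have 3: "((\<lambda>t. (\<omega> - a) * ?k t * ?f' t) has_integral conv K a f' \<omega>) {0..1}"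
    unfolding conv_def box_real
    by (intro integrable_integral integrable_continuous_interval continuous_intros cont_t assms)
  have "?k 1 * ?f 1 - ?k 0 * ?f 0 = conv K a f' \<omega> - conv (deriv K) a f \<omega>"
    using has_integral_unique[OF 1 has_integral_diff[OF 3 2]] .
  then show ?thesis by (simp add: algebra_simps)
qed

end

lemma conv_kernel_cong:
  assumes "\<And>t. 0 \<le> t \<Longrightarrow> t \<le> 1 \<Longrightarrow> K (of_real t * (\<omega> - a)) = L (of_real t * (\<omega> - a))"
  shows "conv K a f \<omega> = conv L a f \<omega>"
  unfolding conv_def
proof (rule integral_cong)
  fix t :: real assume "t \<in> cbox 0 1"
  then show "(\<omega> - a) * K ((1 - of_real t) * (\<omega> - a)) * f (a + of_real t * (\<omega> - a)) =
    (\<omega> - a) * L ((1 - of_real t) * (\<omega> - a)) * f (a + of_real t * (\<omega> - a))"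
    using assms[of "1 - t"] by simp
qed

lemma conv_kernel_add:
  assumes "(\<lambda>t::real. (\<omega> - a) * K ((1 - of_real t) * (\<omega> - a)) * f (a + of_real t * (\<omega> - a))) integrable_on cbox 0 1"
    "(\<lambda>t::real. (\<omega> - a) * L ((1 - of_real t) * (\<omega> - a)) * f (a + of_real t * (\<omega> - a))) integrable_on cbox 0 1"
  shows "conv (\<lambda>z. K z + k * L z) a f \<omega> = conv K a f \<omega> + k * conv L a f \<omega>"
proof -
  have "conv (\<lambda>z. K z + k * L z) a f \<omega> = integral (cbox 0 1) (\<lambda>t::real.
      (\<omega> - a) * K ((1 - of_real t) * (\<omega> - a)) * f (a + of_real t * (\<omega> - a)) +
      k * ((\<omega> - a) * L ((1 - of_real t) * (\<omega> - a)) * f (a + of_real t * (\<omega> - a))))"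
    unfolding conv_def by (rule integral_cong) (simp add: algebra_simps)
  also have "\<dots> = conv K a f \<omega> + integral (cbox 0 1) (\<lambda>t::real.
      k * ((\<omega> - a) * L ((1 - of_real t) * (\<omega> - a)) * f (a + of_real t * (\<omega> - a))))"
    unfolding conv_def by (rule integral_add[OF assms(1) integrable_on_mult_right[OF assms(2)]])
  finally show ?thesis by (simp add: conv_def integral_mult_right)
qed

lemma conv_add:
  assumes "(\<lambda>t::real. (\<omega> - a) * K ((1 - of_real t) * (\<omega> - a)) * f (a + of_real t * (\<omega> - a))) integrable_on cbox 0 1"
    "(\<lambda>t::real. (\<omega> - a) * K ((1 - of_real t) * (\<omega> - a)) * g (a + of_real t * (\<omega> - a))) integrable_on cbox 0 1"
  shows "conv K a (\<lambda>z. f z + g z) \<omega> = conv K a f \<omega> + conv K a g \<omega>"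
proof -
  have "conv K a (\<lambda>z. f z + g z) \<omega> = integral (cbox 0 1) (\<lambda>t::real.
      (\<omega> - a) * K ((1 - of_real t) * (\<omega> - a)) * f (a + of_real t * (\<omega> - a)) +
      (\<omega> - a) * K ((1 - of_real t) * (\<omega> - a)) * g (a + of_real t * (\<omega> - a)))"
    unfolding conv_def by (rule integral_cong) (simp add: algebra_simps)
  then show ?thesis
    unfolding conv_def by (simp only: integral_add[OF assms])
qed

lemma conv_sum:
  assumes "finite I" "\<And>i. i \<in> I \<Longrightarrow> (\<lambda>t::real. (\<omega> - a) * K ((1 - of_real t) * (\<omega> - a)) * f i (a + of_real t * (\<omega> - a))) integrable_on cbox 0 1"
  shows "conv K a (\<lambda>z. \<Sum>i\<in>I. c i * f i z) \<omega> = (\<Sum>i\<in>I. c i * conv K a (f i) \<omega>)"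
proof -
  have "conv K a (\<lambda>z. \<Sum>i\<in>I. c i * f i z) \<omega> = integral (cbox 0 1) (\<lambda>t::real. \<Sum>i\<in>I. c i *
     ((\<omega> - a) * K ((1 - of_real t) * (\<omega> - a)) * f i (a + of_real t * (\<omega> - a))))"
    unfolding conv_def by (rule integral_cong) (simp add: sum_distrib_left mult_ac)
  also have "\<dots> = (\<Sum>i\<in>I. integral (cbox 0 1) (\<lambda>t::real. c i *
     ((\<omega> - a) * K ((1 - of_real t) * (\<omega> - a)) * f i (a + of_real t * (\<omega> - a)))))"
    by (rule integral_sum[OF assms(1) integrable_on_mult_right[OF assms(2)]])
  finally show ?thesis by (simp add: conv_def integral_mult_right)
qed

text \<open>On the segment f is t^lam (\<omega> - a)^lam times a holomorphic function, so (\<omega>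
  - a)^(lam + 1) comes out of the integral. What remains, \<open>X\<close>, integrates t^lam against
  functions holomorphic in \<omega> near \<open>a\<close>; \<open>0 < Re lam\<close> makes t^lam
  continuous at t = 0.\<close>

lemma conv_branch:
  assumes "0 < r" "\<Phi> holomorphic_on ball a r" "open D" "0 \<in> D" "K holomorphic_on D" "0 < Re lam"
    and f: "\<And>\<omega>. \<omega> \<in> S \<Longrightarrow> \<omega> \<in> ball a r \<Longrightarrow> f \<omega> = (\<omega> - a) powr lam * \<Phi> \<omega>" "f a = 0"
    and star: "\<And>\<omega> t. \<omega> \<in> S \<Longrightarrow> 0 < t \<Longrightarrow> t \<le> 1 \<Longrightarrow> a + of_real t * (\<omega> - a) \<in> S" and "a \<notin> S"
  obtains r' X where "0 < r'" "r' \<le> r" "X holomorphic_on ball a r'"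
    "\<And>\<omega>. \<omega> \<in> S \<Longrightarrow> \<omega> \<in> ball a r' \<Longrightarrow> conv K a f \<omega> = (\<omega> - a) powr (lam + 1) * X \<omega>"
proof -
  obtain e where e: "0 < e" "ball 0 e \<subseteq> D" using assms(3,4) by (meson open_contains_ball)
  define r' where "r' = min e r"
  have r': "0 < r'" "r' \<le> r" "r' \<le> e" using e assms(1) by (auto simp: r'_def)
  define X where "X = (\<lambda>\<omega>. integral (cbox 0 1) (\<lambda>t::real. of_real t powr lam *
     (K ((1 - of_real t) * (\<omega> - a)) * \<Phi> (a + of_real t * (\<omega> - a)))))"
  have in_ball: "of_real t * (\<omega> - a) \<in> ball 0 r'" if "\<omega> \<in> ball a r'" "0 \<le> t" "t \<le> 1" for \<omega> t
  proof -
    have "t * dist a \<omega> \<le> dist a \<omega>" using that by (simp add: mult_left_le_one_le)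
    then show ?thesis using that by (simp add: norm_mult dist_norm norm_minus_commute)
  qed
  have inK: "(1 - of_real t) * (\<omega> - a) \<in> D" if "\<omega> \<in> ball a r'" "0 \<le> t" "t \<le> 1" for \<omega> t
    using in_ball[of \<omega> "1 - t"] that e(2) r' by auto
  have inP: "a + of_real t * (\<omega> - a) \<in> ball a r" if "\<omega> \<in> ball a r'" "0 \<le> t" "t \<le> 1" for \<omega> t
    using in_ball[OF that] r' by (simp add: dist_norm)
  have powr_cont: "continuous_on {0..1::real} (\<lambda>t. of_real t powr lam)"
    using assms(6) by (intro continuous_intros) auto
  note Kd = holomorphic_deriv[OF assms(5,3)] and Pd = holomorphic_deriv[OF assms(2) open_ball]
  have cont:
    "continuous_on (ball a r' \<times> {0..1}) (\<lambda>(\<omega>, t). K ((1 - of_real t) * (\<omega> - a)))"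
    "continuous_on (ball a r' \<times> {0..1}) (\<lambda>(\<omega>, t). deriv K ((1 - of_real t) * (\<omega> - a)))"
    "continuous_on (ball a r' \<times> {0..1}) (\<lambda>(\<omega>, t). \<Phi> (a + of_real t * (\<omega> - a)))"
    "continuous_on (ball a r' \<times> {0..1}) (\<lambda>(\<omega>, t). deriv \<Phi> (a + of_real t * (\<omega> - a)))"
    "continuous_on (ball a r' \<times> {0..1}) (\<lambda>(\<omega>, t::real). of_real t powr lam)"
  proof -
    have c: "continuous_on (ball a r' \<times> {0..1}) (\<lambda>p. (1 - of_real (snd p)) * (fst p - a))"
      "continuous_on (ball a r' \<times> {0..1}) (\<lambda>p. a + of_real (snd p) * (fst p - a))"
      "continuous_on (ball a r' \<times> {0..1::real}) snd"
      by (intro continuous_intros)+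
    have s: "(\<lambda>p. (1 - of_real (snd p)) * (fst p - a)) ` (ball a r' \<times> {0..1::real}) \<subseteq> D"
      "(\<lambda>p. a + of_real (snd p) * (fst p - a)) ` (ball a r' \<times> {0..1::real}) \<subseteq> ball a r"
      by ((rule image_subsetI, rule inK); auto) ((rule image_subsetI, rule inP); auto)
    have s': "snd ` (ball a r' \<times> {0..1::real}) \<subseteq> {0..1}" by auto
    show "continuous_on (ball a r' \<times> {0..1}) (\<lambda>(\<omega>, t). K ((1 - of_real t) * (\<omega> - a)))"
      "continuous_on (ball a r' \<times> {0..1}) (\<lambda>(\<omega>, t). deriv K ((1 - of_real t) * (\<omega> - a)))"
      "continuous_on (ball a r' \<times> {0..1}) (\<lambda>(\<omega>, t). \<Phi> (a + of_real t * (\<omega> - a)))"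
      "continuous_on (ball a r' \<times> {0..1}) (\<lambda>(\<omega>, t). deriv \<Phi> (a + of_real t * (\<omega> - a)))"
      "continuous_on (ball a r' \<times> {0..1}) (\<lambda>(\<omega>, t::real). of_real t powr lam)"
      unfolding split_beta
      by (rule continuous_on_compose2[OF holomorphic_on_imp_continuous_on[OF assms(5)] c(1) s(1)]
        continuous_on_compose2[OF holomorphic_on_imp_continuous_on[OF Kd] c(1) s(1)]
        continuous_on_compose2[OF holomorphic_on_imp_continuous_on[OF assms(2)] c(2) s(2)]
        continuous_on_compose2[OF holomorphic_on_imp_continuous_on[OF Pd] c(2) s(2)]
        continuous_on_compose2[OF powr_cont c(3) s'])+
  qed
  have X: "X holomorphic_on ball a r'"
    unfolding X_def
  proof (rule leibniz_rule_holomorphic)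
    fix \<omega> and t :: real assume *: "\<omega> \<in> ball a r'" "t \<in> cbox 0 1"
    have kd: "((\<lambda>\<omega>. K ((1 - of_real t) * (\<omega> - a))) has_field_derivative
        (1 - of_real t) * deriv K ((1 - of_real t) * (\<omega> - a))) (at \<omega>)"
    proof -
      have "((\<lambda>x. (1 - of_real t) * (x - a)) has_field_derivative (1 - of_real t)) (at \<omega>)"
        by (auto intro!: derivative_eq_intros)
      from DERIV_chain[OF holomorphic_derivI[OF assms(5,3) inK] this] show ?thesis
        using * by (simp add: o_def mult.commute)
    qed
    have pd: "((\<lambda>\<omega>. \<Phi> (a + of_real t * (\<omega> - a))) has_field_derivative
        of_real t * deriv \<Phi> (a + of_real t * (\<omega> - a))) (at \<omega>)"
    proof -
      have "((\<lambda>x. a + of_real t * (x - a)) has_field_derivative of_real t) (at \<omega>)"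
        by (auto intro!: derivative_eq_intros)
      from DERIV_chain[OF holomorphic_derivI[OF assms(2) open_ball inP] this] show ?thesis
        using * by (simp add: o_def mult.commute)
    qed
    show "((\<lambda>\<omega>. of_real t powr lam * (K ((1 - of_real t) * (\<omega> - a)) * \<Phi> (a + of_real t * (\<omega> - a))))
      has_field_derivative of_real t powr lam *
       ((1 - of_real t) * deriv K ((1 - of_real t) * (\<omega> - a)) * \<Phi> (a + of_real t * (\<omega> - a))
        + of_real t * deriv \<Phi> (a + of_real t * (\<omega> - a)) * K ((1 - of_real t) * (\<omega> - a)))) (at \<omega> within ball a r')"
      by (intro has_field_derivative_at_within[OF DERIV_cmult] DERIV_mult kd pd)
  next
    fix \<omega> assume \<omega>: "\<omega> \<in> ball a r'"
    have c: "continuous_on {0..1} (\<lambda>t. (\<omega>, t))" by (intro continuous_intros)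
    have s: "(\<lambda>t. (\<omega>, t)) ` {0..1} \<subseteq> ball a r' \<times> {0..1::real}" using \<omega> by auto
    show "(\<lambda>t::real. of_real t powr lam * (K ((1 - of_real t) * (\<omega> - a)) * \<Phi> (a + of_real t * (\<omega> - a)))) integrable_on cbox 0 1"
      using cont[THEN continuous_on_compose2, OF c s] unfolding box_real
      by (intro integrable_continuous_interval continuous_on_mult) simp_all
  next
    show "continuous_on (ball a r' \<times> cbox 0 1) (\<lambda>(\<omega>, t::real). of_real t powr lam *
       ((1 - of_real t) * deriv K ((1 - of_real t) * (\<omega> - a)) * \<Phi> (a + of_real t * (\<omega> - a))
        + of_real t * deriv \<Phi> (a + of_real t * (\<omega> - a)) * K ((1 - of_real t) * (\<omega> - a))))"
      using cont unfolding split_beta box_real by (intro continuous_intros) (use assms(6) in auto)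
  qed simp
  have "conv K a f \<omega> = (\<omega> - a) powr (lam + 1) * X \<omega>" if \<omega>: "\<omega> \<in> S" "\<omega> \<in> ball a r'" for \<omega>
  proof -
    have ne: "\<omega> - a \<noteq> 0" using \<omega>(1) \<open>a \<notin> S\<close> by auto
    have "(\<omega> - a) * K ((1 - of_real t) * (\<omega> - a)) * f (a + of_real t * (\<omega> - a)) =
      (\<omega> - a) powr (lam + 1) * (of_real t powr lam * (K ((1 - of_real t) * (\<omega> - a)) * \<Phi> (a + of_real t * (\<omega> - a))))"
      if t: "t \<in> cbox 0 1" for t :: real
    proof (cases "t = 0")
      case True then show ?thesis by (simp add: f(2))
    next
      case False
      then have t0: "0 < t" "t \<le> 1" using t by auto
      \<comment> \<open>A positive factor changes the principal logarithm by a real number, so the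
        power of the product splits without a change of branch.\<close>
      have "Ln (of_real t * (\<omega> - a)) = of_real (ln t) + Ln (\<omega> - a)"
        using Ln_times_of_real[OF t0(1) ne] t0 by (simp add: Ln_of_real)
      then have "(of_real t * (\<omega> - a)) powr lam = of_real t powr lam * (\<omega> - a) powr lam"
        using ne t0 by (simp add: powr_def exp_add ring_distribs Ln_of_real)
      then show ?thesis
        using f(1)[OF star[OF \<omega>(1) t0] inP[OF \<omega>(2)]] t0 ne
        by (simp add: powr_add mult_ac)
    qed
    then show ?thesis
      unfolding conv_def X_def integral_mult_right[symmetric] by (rule integral_cong)
  qed
  then show thesis using that[OF r'(1,2) X] by blast
qed

section \<open>Functions with a power singularity\<close>

text \<open>\<open>powr\<close> is the principal power. In the applications \<open>S\<close> lies
  strictly above or strictly below \<open>a\<close>, hence off the cut. The leading coefficient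
  \<open>e\<close> may be 0, which is how terms of higher order are absorbed.\<close>

definition branch_at :: "complex set \<Rightarrow> complex \<Rightarrow> complex \<Rightarrow> complex \<Rightarrow> (complex \<Rightarrow> complex) \<Rightarrow> bool" where
  "branch_at S a lam e f \<longleftrightarrow> (\<exists>r>0. \<exists>\<Phi>. \<Phi> holomorphic_on ball a r \<and> \<Phi> a = e \<and>
     (\<forall>\<omega>\<in>S \<inter> ball a r. f \<omega> = (\<omega> - a) powr lam * \<Phi> \<omega>))"

text \<open>The counterpart of hol(x - b) for functions given on one side of \<open>b\<close>
  only.\<close>

definition extends_at :: "complex set \<Rightarrow> complex \<Rightarrow> (complex \<Rightarrow> complex) \<Rightarrow> bool" where
  "extends_at S b f \<longleftrightarrow> (\<exists>r>0. \<exists>H. H holomorphic_on ball b r \<and> (\<forall>\<omega>\<in>S \<inter> ball b r. f \<omega> = H \<omega>))"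

lemma branch_atI:
  "0 < r \<Longrightarrow> \<Phi> holomorphic_on ball a r \<Longrightarrow> \<Phi> a = e \<Longrightarrow>
   (\<And>\<omega>. \<omega> \<in> S \<Longrightarrow> \<omega> \<in> ball a r \<Longrightarrow> f \<omega> = (\<omega> - a) powr lam * \<Phi> \<omega>) \<Longrightarrow> branch_at S a lam e f"
  unfolding branch_at_def by blast

lemma branch_atE:
  assumes "branch_at S a lam e f"
  obtains r \<Phi> where "0 < r" "\<Phi> holomorphic_on ball a r" "\<Phi> a = e"
    "\<And>\<omega>. \<omega> \<in> S \<Longrightarrow> \<omega> \<in> ball a r \<Longrightarrow> f \<omega> = (\<omega> - a) powr lam * \<Phi> \<omega>"
  using assms unfolding branch_at_def by blast

lemma extends_atI:
  "0 < r \<Longrightarrow> H holomorphic_on ball b r \<Longrightarrow> (\<And>\<omega>. \<omega> \<in> S \<Longrightarrow> \<omega> \<in> ball b r \<Longrightarrow> f \<omega> = H \<omega>) \<Longrightarrow> extends_at S b f"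
  unfolding extends_at_def by blast

lemma extends_atE:
  assumes "extends_at S b f"
  obtains r H where "0 < r" "H holomorphic_on ball b r" "\<And>\<omega>. \<omega> \<in> S \<Longrightarrow> \<omega> \<in> ball b r \<Longrightarrow> f \<omega> = H \<omega>"
  using assms unfolding extends_at_def by blast

lemma branch_at_cong:
  assumes "branch_at S a lam e f" "\<And>\<omega>. \<omega> \<in> S \<Longrightarrow> f \<omega> = g \<omega>"
  shows "branch_at S a lam e g"
  using assms unfolding branch_at_def by (metis IntD1)

lemma extends_at_cong:
  assumes "extends_at S a f" "\<And>\<omega>. \<omega> \<in> S \<Longrightarrow> f \<omega> = g \<omega>"
  shows "extends_at S a g"
  using assms unfolding extends_at_def by (metis IntD1)

lemma branch_at_mult:
  assumes "branch_at S a lam e f" "g holomorphic_on UNIV"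
  shows "branch_at S a lam (g a * e) (\<lambda>\<omega>. g \<omega> * f \<omega>)"
  using assms(1)
proof (rule branch_atE)
  fix r \<Phi> assume *: "0 < r" "\<Phi> holomorphic_on ball a r" "\<Phi> a = e"
    "\<And>\<omega>. \<omega> \<in> S \<Longrightarrow> \<omega> \<in> ball a r \<Longrightarrow> f \<omega> = (\<omega> - a) powr lam * \<Phi> \<omega>"
  show ?thesis
    by (rule branch_atI[of r "\<lambda>\<omega>. g \<omega> * \<Phi> \<omega>"])
       (use * holomorphic_on_subset[OF assms(2)] in \<open>auto intro!: holomorphic_intros\<close>)
qed

lemma extends_at_mult:
  assumes "extends_at S a f" "g holomorphic_on UNIV"
  shows "extends_at S a (\<lambda>\<omega>. g \<omega> * f \<omega>)"
  using assms(1)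
proof (rule extends_atE)
  fix r H assume *: "0 < r" "H holomorphic_on ball a r"
    "\<And>\<omega>. \<omega> \<in> S \<Longrightarrow> \<omega> \<in> ball a r \<Longrightarrow> f \<omega> = H \<omega>"
  show ?thesis
    by (rule extends_atI[of r "\<lambda>\<omega>. g \<omega> * H \<omega>"])
       (use * holomorphic_on_subset[OF assms(2)] in \<open>auto intro!: holomorphic_intros\<close>)
qed

lemma branch_at_add:
  assumes "branch_at S a lam e f" "branch_at S a lam e' f'"
  shows "branch_at S a lam (e + e') (\<lambda>\<omega>. f \<omega> + f' \<omega>)"
proof -
  obtain r \<Phi> where 1: "0 < r" "\<Phi> holomorphic_on ball a r" "\<Phi> a = e"
    "\<And>\<omega>. \<omega> \<in> S \<Longrightarrow> \<omega> \<in> ball a r \<Longrightarrow> f \<omega> = (\<omega> - a) powr lam * \<Phi> \<omega>"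
    using assms(1) unfolding branch_at_def by auto
  obtain r' \<Phi>' where 2: "0 < r'" "\<Phi>' holomorphic_on ball a r'" "\<Phi>' a = e'"
    "\<And>\<omega>. \<omega> \<in> S \<Longrightarrow> \<omega> \<in> ball a r' \<Longrightarrow> f' \<omega> = (\<omega> - a) powr lam * \<Phi>' \<omega>"
    using assms(2) unfolding branch_at_def by auto
  have "\<Phi> holomorphic_on ball a (min r r')" "\<Phi>' holomorphic_on ball a (min r r')"
    using 1(2) 2(2) by (auto elim!: holomorphic_on_subset)
  then show ?thesis
    by (intro branch_atI[of "min r r'" "\<lambda>\<omega>. \<Phi> \<omega> + \<Phi>' \<omega>"])
       (use 1 2 in \<open>auto intro!: holomorphic_intros simp: distrib_left\<close>)
qed

lemma extends_at_add:
  assumes "extends_at S a f" "extends_at S a f'"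
  shows "extends_at S a (\<lambda>\<omega>. f \<omega> + f' \<omega>)"
proof -
  obtain r H where 1: "0 < r" "H holomorphic_on ball a r"
    "\<And>\<omega>. \<omega> \<in> S \<Longrightarrow> \<omega> \<in> ball a r \<Longrightarrow> f \<omega> = H \<omega>"
    using assms(1) unfolding extends_at_def by auto
  obtain r' H' where 2: "0 < r'" "H' holomorphic_on ball a r'"
    "\<And>\<omega>. \<omega> \<in> S \<Longrightarrow> \<omega> \<in> ball a r' \<Longrightarrow> f' \<omega> = H' \<omega>"
    using assms(2) unfolding extends_at_def by auto
  have "H holomorphic_on ball a (min r r')" "H' holomorphic_on ball a (min r r')"
    using 1(2) 2(2) by (auto elim!: holomorphic_on_subset)
  then show ?thesis
    by (intro extends_atI[of "min r r'" "\<lambda>\<omega>. H \<omega> + H' \<omega>"])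
       (use 1 2 in \<open>auto intro!: holomorphic_intros\<close>)
qed

lemma branch_at_sum:
  assumes "\<And>i. i \<in> I \<Longrightarrow> branch_at S a lam (e i) (f i)"
  shows "branch_at S a lam (\<Sum>i\<in>I. e i) (\<lambda>\<omega>. \<Sum>i\<in>I. f i \<omega>)"
proof -
  have zero: "branch_at S a lam 0 (\<lambda>\<omega>. 0)"
    by (rule branch_atI[of 1 "\<lambda>_. 0"]) auto
  show ?thesis using assms
    by (induction I rule: infinite_finite_induct) (auto simp: zero intro!: branch_at_add)
qed

lemma extends_at_sum:
  assumes "\<And>i. i \<in> I \<Longrightarrow> extends_at S a (f i)"
  shows "extends_at S a (\<lambda>\<omega>. \<Sum>i\<in>I. f i \<omega>)"
proof -
  have zero: "extends_at S a (\<lambda>\<omega>. 0)"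
    by (rule extends_atI[of 1 "\<lambda>_. 0"]) auto
  show ?thesis using assms
    by (induction I rule: infinite_finite_induct) (auto simp: zero intro!: extends_at_add)
qed

text \<open>The surplus factor \<omega> - a goes into the holomorphic part, which then vanishes at
  \<open>a\<close>; so a term of higher order enters a comparison of leading coefficients as
  0.\<close>

lemma branch_at_raise:
  assumes "branch_at S a (lam + 1) e f" "a \<notin> S"
  shows "branch_at S a lam 0 f"
  using assms(1)
proof (rule branch_atE)
  fix r \<Phi> assume *: "0 < r" "\<Phi> holomorphic_on ball a r" "\<Phi> a = e"
    "\<And>\<omega>. \<omega> \<in> S \<Longrightarrow> \<omega> \<in> ball a r \<Longrightarrow> f \<omega> = (\<omega> - a) powr (lam + 1) * \<Phi> \<omega>"
  show ?thesis
    by (rule branch_atI[of r "\<lambda>\<omega>. (\<omega> - a) * \<Phi> \<omega>"])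
       (use * assms(2) in \<open>auto intro!: holomorphic_intros simp: powr_add\<close>)
qed

lemma deriv_cong_on:
  assumes "open U" "z \<in> U" "\<And>w. w \<in> U \<Longrightarrow> f w = g w"
  shows "deriv f z = deriv g z"
proof (rule deriv_cong_ev)
  show "\<forall>\<^sub>F x in nhds z. f x = g x" using assms unfolding eventually_nhds by blast
qed simp

lemma branch_at_deriv:
  assumes "branch_at S a lam e f" "open S" "\<And>\<omega>. \<omega> \<in> S \<Longrightarrow> \<omega> - a \<notin> \<real>\<^sub>\<le>\<^sub>0"
  shows "branch_at S a (lam - 1) (lam * e) (deriv f)"
  using assms(1)
proof (rule branch_atE)
  fix r \<Phi> assume *: "0 < r" "\<Phi> holomorphic_on ball a r" "\<Phi> a = e"
    "\<And>\<omega>. \<omega> \<in> S \<Longrightarrow> \<omega> \<in> ball a r \<Longrightarrow> f \<omega> = (\<omega> - a) powr lam * \<Phi> \<omega>"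
  show ?thesis
  proof (rule branch_atI[of r "\<lambda>\<omega>. lam * \<Phi> \<omega> + (\<omega> - a) * deriv \<Phi> \<omega>"])
    show "(\<lambda>\<omega>. lam * \<Phi> \<omega> + (\<omega> - a) * deriv \<Phi> \<omega>) holomorphic_on ball a r"
      by (intro holomorphic_intros * holomorphic_deriv open_ball)
    fix \<omega> assume \<omega>: "\<omega> \<in> S" "\<omega> \<in> ball a r"
    have ne: "\<omega> - a \<noteq> 0" using assms(3)[OF \<omega>(1)] by auto
    have "((\<lambda>\<omega>. (\<omega> - a) powr lam) has_field_derivative lam * (\<omega> - a) powr (lam - 1)) (at \<omega>)"
    proof -
      have "((\<lambda>\<omega>. \<omega> - a) has_field_derivative 1) (at \<omega>)"
        by (auto intro!: derivative_eq_intros)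
      from DERIV_chain2[where f = "\<lambda>z. z powr lam" and g = "\<lambda>\<omega>. \<omega> - a", OF
          has_field_derivative_powr[OF assms(3)[OF \<omega>(1)]] this]
      show ?thesis by simp
    qed
    from DERIV_mult[OF this holomorphic_derivI[OF *(2) open_ball \<omega>(2)]]
    have "((\<lambda>\<omega>. (\<omega> - a) powr lam * \<Phi> \<omega>) has_field_derivative
       lam * (\<omega> - a) powr (lam - 1) * \<Phi> \<omega> + deriv \<Phi> \<omega> * (\<omega> - a) powr lam) (at \<omega>)" .
    then have "deriv (\<lambda>\<omega>. (\<omega> - a) powr lam * \<Phi> \<omega>) \<omega> =
       lam * (\<omega> - a) powr (lam - 1) * \<Phi> \<omega> + deriv \<Phi> \<omega> * (\<omega> - a) powr lam"
      by (rule DERIV_imp_deriv)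
    moreover have "deriv f \<omega> = deriv (\<lambda>\<omega>. (\<omega> - a) powr lam * \<Phi> \<omega>) \<omega>"
      by (rule deriv_cong_on[of "S \<inter> ball a r"]) (use * \<omega> assms(2) in auto)
    ultimately show "deriv f \<omega> = (\<omega> - a) powr (lam - 1) * (lam * \<Phi> \<omega> + (\<omega> - a) * deriv \<Phi> \<omega>)"
      using ne by (simp add: powr_diff field_simps)
  qed (use * in auto)
qed

lemma extends_at_deriv:
  assumes "extends_at S a f" "open S"
  shows "extends_at S a (deriv f)"
  using assms(1)
proof (rule extends_atE)
  fix r H assume *: "0 < r" "H holomorphic_on ball a r"
    "\<And>\<omega>. \<omega> \<in> S \<Longrightarrow> \<omega> \<in> ball a r \<Longrightarrow> f \<omega> = H \<omega>"
  show ?thesis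
  proof (rule extends_atI[of r "deriv H"])
    show "deriv H holomorphic_on ball a r" by (intro * holomorphic_deriv open_ball)
    fix \<omega> assume "\<omega> \<in> S" "\<omega> \<in> ball a r"
    then show "deriv f \<omega> = deriv H \<omega>"
      by (intro deriv_cong_on[of "S \<inter> ball a r"]) (use * assms(2) in auto)
  qed (use * in auto)
qed

lemma branch_at_tendsto:
  assumes "branch_at S a lam e f" "0 < Re lam"
  shows "(f \<longlongrightarrow> 0) (at a within S)"
  using assms(1)
proof (rule branch_atE)
  fix r \<Phi> assume *: "0 < r" "\<Phi> holomorphic_on ball a r" "\<Phi> a = e"
    "\<And>\<omega>. \<omega> \<in> S \<Longrightarrow> \<omega> \<in> ball a r \<Longrightarrow> f \<omega> = (\<omega> - a) powr lam * \<Phi> \<omega>"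
  have "isCont \<Phi> a" using *(1,2)
    by (meson centre_in_ball continuous_on_interior holomorphic_on_imp_continuous_on interior_ball open_ball continuous_on_eq_continuous_at)
  then have "(\<Phi> \<longlongrightarrow> \<Phi> a) (at a within S)"
    using continuous_at_imp_continuous_within continuous_within by blast
  moreover have "((\<lambda>\<omega>. (\<omega> - a) powr lam) \<longlongrightarrow> 0) (at a within S)"
    by (rule tendsto_powr_complex_0[OF _ tendsto_const assms(2)]) (auto intro!: tendsto_eq_intros)
  ultimately have "((\<lambda>\<omega>. (\<omega> - a) powr lam * \<Phi> \<omega>) \<longlongrightarrow> 0) (at a within S)"
    using tendsto_mult_zero tendsto_mult by fastforce
  moreover have "\<forall>\<^sub>F \<omega> in at a within S. (\<omega> - a) powr lam * \<Phi> \<omega> = f \<omega>"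
    unfolding eventually_at using * by (intro exI[of _ r]) (auto simp: dist_commute)
  ultimately show ?thesis by (rule Lim_transform_eventually)
qed

lemma at_within_insert_eq: "at x within insert a X = at (x :: complex) within X"
proof -
  have "at x within {a} = bot"
    using trivial_limit_within[of x "{a}"] islimpt_finite[of "{a}" x] by simp
  then show ?thesis using at_within_union[of x "{a}" X] by simp
qed

lemma continuous_on_insert_value:
  fixes f :: "complex \<Rightarrow> complex"
  assumes "continuous_on X f" "(f \<longlongrightarrow> L) (at a within X)" "a \<notin> X"
  shows "continuous_on (insert a X) (\<lambda>\<omega>. if \<omega> = a then L else f \<omega>)"
  unfolding continuous_on_def at_within_insert_eq
proof
  fix x assume x: "x \<in> insert a X"
  have "(f \<longlongrightarrow> (if x = a then L else f x)) (at x within X)"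
    using x assms by (auto simp: continuous_on_def)
  moreover have "\<forall>\<^sub>F \<omega> in at x within X. f \<omega> = (if \<omega> = a then L else f \<omega>)"
    using assms(3) by (auto simp: eventually_at_topological)
  ultimately show "((\<lambda>\<omega>. if \<omega> = a then L else f \<omega>) \<longlongrightarrow> (if x = a then L else f x)) (at x within X)"
    by (rule Lim_transform_eventually)
qed

section \<open>Strips with a marked boundary point\<close>

locale strip =
  fixes S :: "complex set" and \<alpha> \<beta> :: real
  assumes S: "S = {z. \<alpha> < Im z \<and> Im z < \<beta>}" and width: "\<alpha> < \<beta>" "\<beta> < \<alpha> + 2 * pi"
begin

lemma open_S: "open S"
proof -
  have "S = {z. Im z < \<beta>} \<inter> {z. Im z > \<alpha>}" by (auto simp: S)
  then show ?thesis by (metis open_Int open_halfspace_Im_lt open_halfspace_Im_gt)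
qed

lemma convex_S: "convex S"
proof -
  have "S = {z. Im z < \<beta>} \<inter> {z. Im z > \<alpha>}" by (auto simp: S)
  then show ?thesis by (metis convex_Int convex_halfspace_Im_lt convex_halfspace_Im_gt)
qed

end

locale strip_endpoint = strip +
  fixes a :: complex
  assumes endpoint: "Im a = \<alpha> \<or> Im a = \<beta>"
begin

lemma a_notin: "a \<notin> S" using endpoint by (auto simp: S)

lemma star:
  assumes "\<omega> \<in> S" "0 < t" "t \<le> 1"
  shows "a + of_real t * (\<omega> - a) \<in> S"
proof -
  have "0 < t * (Im \<omega> - \<alpha>)" "0 < t * (\<beta> - Im \<omega>)"
    "0 \<le> (1 - t) * (\<beta> - \<alpha>)"
    using assms width by (auto simp: S)
  then show ?thesis using endpoint by (auto simp: S algebra_simps)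
qed

lemma in_wide_strip:
  assumes "\<omega> \<in> S" "0 \<le> t" "t \<le> 1"
  shows "of_real t * (\<omega> - a) \<in> wide_strip"
proof -
  have "\<bar>Im \<omega> - Im a\<bar> < 2 * pi" using assms(1) endpoint width by (auto simp: S)
  moreover have "\<bar>t * (Im \<omega> - Im a)\<bar> \<le> \<bar>Im \<omega> - Im a\<bar>"
    using assms(2,3) by (simp add: abs_mult mult_left_le_one_le)
  ultimately show ?thesis by (simp add: wide_strip_def)
qed

lemma not_nonpos:
  assumes "\<omega> \<in> S"
  shows "\<omega> - a \<notin> \<real>\<^sub>\<le>\<^sub>0"
  using assms endpoint by (auto simp: S complex_nonpos_Reals_iff)

text \<open>The bound \<open>1 < Re lam\<close> is for the derivative: \<open>deriv w\<close> has
  exponent lam - 1, and it too must tend to 0 at \<open>a\<close> for its extension by 0 to be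
  continuous.\<close>

lemma convolutionI:
  assumes "K holomorphic_on wide_strip" "w holomorphic_on S" "branch_at S a lam e w" "1 < Re lam"
  shows "convolution S wide_strip a K (\<lambda>\<omega>. if \<omega> = a then 0 else w \<omega>) (\<lambda>\<omega>. if \<omega> = a then 0 else deriv w \<omega>)"
proof
  show "continuous_on (insert a S) (\<lambda>\<omega>. if \<omega> = a then 0 else w \<omega>)"
    using assms(2-4) branch_at_tendsto a_notin
    by (intro continuous_on_insert_value holomorphic_on_imp_continuous_on) auto
  show "continuous_on (insert a S) (\<lambda>\<omega>. if \<omega> = a then 0 else deriv w \<omega>)"
    using branch_at_tendsto[OF branch_at_deriv[OF assms(3) open_S not_nonpos]] assms(2,4) a_notin
    by (intro continuous_on_insert_value holomorphic_on_imp_continuous_on holomorphic_deriv open_S) auto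
  fix \<omega> assume \<omega>: "\<omega> \<in> S"
  have "((\<lambda>\<omega>. if \<omega> = a then 0 else w \<omega>) has_field_derivative deriv w \<omega>) (at \<omega>)"
    by (rule has_field_derivative_transform_within_open[OF holomorphic_derivI[OF assms(2) open_S \<omega>] open_S \<omega>])
       (use a_notin in auto)
  then show "((\<lambda>\<omega>. if \<omega> = a then 0 else w \<omega>) has_field_derivative (if \<omega> = a then 0 else deriv w \<omega>)) (at \<omega>)"
    using \<omega> a_notin by auto
qed (use assms star in_wide_strip open_S convex_S open_wide_strip in auto)

end

section \<open>The transform of the underlying system\<close>

text \<open>
  The underlying system and the equation of order two for the first components of the extended
  system, in the coordinate \<open>\<omega>\<close>: \<open>\<tau> j\<close> is \<open>t\<^sub>i - t\<^bsub>p+1\<^esub>\<close> for \<open>j\<close> in the \<open>i\<close>-th block, \<open>c = \<rho>\<^sub>1 + \<rho>\<^sub>2\<close> and \<open>d = \<rho>\<^sub>1 \<rho>\<^sub>2\<close>.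
\<close>

definition underlying_solution ::
  "nat \<Rightarrow> (nat \<Rightarrow> complex) \<Rightarrow> (nat \<Rightarrow> nat \<Rightarrow> complex) \<Rightarrow> complex set \<Rightarrow> (nat \<Rightarrow> complex \<Rightarrow> complex) \<Rightarrow> bool" where
  "underlying_solution n \<tau> A S w \<longleftrightarrow> (\<forall>j<n. w j holomorphic_on S \<and>
     (\<forall>\<omega>\<in>S. (1 - \<tau> j * exp (- \<omega>)) * deriv (w j) \<omega> = \<tau> j * exp (- \<omega>) * (\<Sum>l<n. A j l * w l \<omega>)))"

definition extended_solution ::
  "nat \<Rightarrow> (nat \<Rightarrow> complex) \<Rightarrow> (nat \<Rightarrow> nat \<Rightarrow> complex) \<Rightarrow> complex \<Rightarrow> complex \<Rightarrow> complex set \<Rightarrow>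
   (nat \<Rightarrow> complex \<Rightarrow> complex) \<Rightarrow> bool" where
  "extended_solution n \<tau> A c d S u \<longleftrightarrow> (\<forall>j<n. u j holomorphic_on S \<and>
     (\<forall>\<omega>\<in>S. deriv (deriv (u j)) \<omega> - c * deriv (u j) \<omega> + d * u j \<omega> =
        \<tau> j * exp (- \<omega>) * (deriv (deriv (u j)) \<omega> - (1 + c) * deriv (u j) \<omega>)
        + exp (- \<omega>) * (\<Sum>l<n. A j l * \<tau> l * deriv (u l) \<omega>)))"

context strip_endpoint
begin

definition transform :: "(complex \<Rightarrow> complex) \<Rightarrow> (complex \<Rightarrow> complex) \<Rightarrow> complex \<Rightarrow> complex" where
  "transform K w = conv K a (\<lambda>\<omega>. if \<omega> = a then 0 else w \<omega>)"

context
  fixes n :: nat and \<tau> :: "nat \<Rightarrow> complex" and A :: "nat \<Rightarrow> nat \<Rightarrow> complex" and c d :: complex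
    and w :: "nat \<Rightarrow> complex \<Rightarrow> complex" and K :: "complex \<Rightarrow> complex" and lam :: complex and e :: "nat \<Rightarrow> complex"
  assumes w: "underlying_solution n \<tau> A S w" and w_branch: "\<And>j. j < n \<Longrightarrow> branch_at S a lam (e j) (w j)"
    and lam: "1 < Re lam"
    and K: "K holomorphic_on wide_strip" "K 0 = 1"
    and K_ode: "\<And>z. z \<in> wide_strip \<Longrightarrow> deriv (deriv K) z + c * deriv K z + d * K z =
       exp (- z) * (deriv (deriv K) z + (c - 1) * deriv K z - c * K z)"
begin

lemma w_holomorphic: "j < n \<Longrightarrow> w j holomorphic_on S"
  using w by (simp add: underlying_solution_def)

lemma w_ode:
  assumes "j < n" "z \<in> S"
  shows "\<tau> j * exp (- z) * (deriv (w j) z + (\<Sum>l<n. A j l * w l z)) = deriv (w j) z"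
proof -
  have "(1 - \<tau> j * exp (- z)) * deriv (w j) z = \<tau> j * exp (- z) * (\<Sum>l<n. A j l * w l z)"
    using w assms by (simp add: underlying_solution_def)
  then show ?thesis by (simp add: algebra_simps)
qed

lemma conv_w: "L holomorphic_on wide_strip \<Longrightarrow> j < n \<Longrightarrow>
    convolution S wide_strip a L (\<lambda>\<omega>. if \<omega> = a then 0 else w j \<omega>) (\<lambda>\<omega>. if \<omega> = a then 0 else deriv (w j) \<omega>)"
  by (rule convolutionI[OF _ w_holomorphic w_branch lam])

lemma transform_derivative:
  assumes "L holomorphic_on wide_strip" "j < n" "\<omega> \<in> S"
  shows "(transform L (w j) has_field_derivative L 0 * w j \<omega> + transform (deriv L) (w j) \<omega>) (at \<omega>)"
proof -
  have "\<omega> \<noteq> a" using assms(3) a_notin by blast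
  then show ?thesis
    using convolution.conv_derivative[OF conv_w[OF assms(1,2)] assms(3)] by (simp add: transform_def)
qed

lemma transform_holomorphic:
  assumes "L holomorphic_on wide_strip" "j < n"
  shows "transform L (w j) holomorphic_on S"
  using transform_derivative[OF assms] by (auto simp: holomorphic_on_open[OF open_S])

lemma transform_by_parts:
  assumes "L holomorphic_on wide_strip" "j < n" "\<omega> \<in> S"
  shows "transform (deriv L) (w j) \<omega> + L 0 * w j \<omega> = transform L (deriv (w j)) \<omega>"
proof -
  have "\<omega> \<noteq> a" using assms(3) a_notin by blast
  then show ?thesis
    using convolution.conv_by_parts[OF conv_w[OF assms(1,2)] assms(3)] by (simp add: transform_def)
qed

lemma deriv_K: "deriv K holomorphic_on wide_strip" "deriv (deriv K) holomorphic_on wide_strip"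
  by (intro holomorphic_deriv K open_wide_strip)+

text \<open>With \<open>?M\<close> for K' + c K, the bracket on the right is w' + A w plus the
  convolution of \<open>?M\<close> with w' + A w. Multiplied by \<tau> e^(-\<omega>), the first part
  becomes w'; in the second, e^(-\<omega>) splits and leaves the convolution of \<open>?L\<close>
  with w'. Integration by parts turns this into the convolution of \<open>deriv ?L\<close> with w,
  and by the kernel equation \<open>deriv ?L\<close> is K'' + c K' + d K.\<close>

lemma transform_ode:
  assumes j: "j < n" and \<omega>: "\<omega> \<in> S"
  defines "y \<equiv> \<lambda>j. transform K (w j)"
  shows "deriv (deriv (y j)) \<omega> + c * deriv (y j) \<omega> + d * y j \<omega> =
     \<tau> j * exp (- \<omega>) * (deriv (deriv (y j)) \<omega> + c * deriv (y j) \<omega> + (\<Sum>l<n. A j l * (deriv (y l) \<omega> + c * y l \<omega>)))"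
proof -
  let ?M = "\<lambda>z. deriv K z + c * K z"
  let ?L = "\<lambda>z. exp (- z) * ?M z"
  have M: "?M holomorphic_on wide_strip" and L: "?L holomorphic_on wide_strip"
    by (intro holomorphic_intros deriv_K K)+
  have y1: "deriv (y l) z = w l z + transform (deriv K) (w l) z" if "l < n" "z \<in> S" for l z
    using DERIV_imp_deriv[OF transform_derivative[OF K(1) that]] by (simp add: y_def K(2))
  \<comment> \<open>The derivative sits on the kernel in \<open>y2\<close> and on \<open>w\<close>
    in \<open>y2'\<close>; the left-hand side of the claim needs the former, the bracket on the
    right the latter.\<close>
  have y2: "deriv (deriv (y j)) \<omega> = deriv (w j) \<omega> + (deriv K 0 * w j \<omega> + transform (deriv (deriv K)) (w j) \<omega>)"
  proof -
    have "deriv (deriv (y j)) \<omega> = deriv (\<lambda>z. w j z + transform (deriv K) (w j) z) \<omega>"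
      by (rule deriv_cong_on[OF open_S \<omega>]) (rule y1[OF j])
    also have "\<dots> = deriv (w j) \<omega> + (deriv K 0 * w j \<omega> + transform (deriv (deriv K)) (w j) \<omega>)"
      by (intro DERIV_imp_deriv DERIV_add transform_derivative deriv_K j \<omega>
           holomorphic_derivI[OF w_holomorphic[OF j] open_S])
    finally show ?thesis .
  qed
  have y1': "deriv (y j) \<omega> = transform K (deriv (w j)) \<omega>"
    using y1[OF j \<omega>] transform_by_parts[OF K(1) j \<omega>] K(2) by (simp add: add.commute)
  have y2': "deriv (deriv (y j)) \<omega> = deriv (w j) \<omega> + transform (deriv K) (deriv (w j)) \<omega>"
    using y2 transform_by_parts[OF deriv_K(1) j \<omega>] by (simp add: add_ac)
  have M_transform: "transform ?M f \<omega> = transform (deriv K) f \<omega> + c * transform K f \<omega>"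
    if "f \<in> insert (deriv (w j)) (w ` {..<n})" for f
  proof -
    have "(\<lambda>t::real. (\<omega> - a) * G ((1 - of_real t) * (\<omega> - a)) * (if a + of_real t * (\<omega> - a) = a then 0
        else f (a + of_real t * (\<omega> - a)))) integrable_on cbox 0 1" if "G holomorphic_on wide_strip" for G
      using convolution.conv_integrable[OF conv_w[OF that] \<omega>] j \<open>f \<in> _\<close> by auto
    from this[OF deriv_K(1)] this[OF K(1)] show ?thesis
      unfolding transform_def by (rule conv_kernel_add)
  qed
  have "deriv (deriv (y j)) \<omega> + c * deriv (y j) \<omega> + (\<Sum>l<n. A j l * (deriv (y l) \<omega> + c * y l \<omega>)) =
    deriv (w j) \<omega> + (\<Sum>l<n. A j l * w l \<omega>) + (transform ?M (deriv (w j)) \<omega> + (\<Sum>l<n. A j l * transform ?M (w l) \<omega>))"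
  proof -
    have "A j l * (deriv (y l) \<omega> + c * y l \<omega>) = A j l * w l \<omega> + A j l * transform ?M (w l) \<omega>" if "l < n" for l
      using that by (simp only: y1[OF that \<omega>] M_transform image_eqI lessThan_iff insertI2) (simp add: y_def algebra_simps)
    then have "(\<Sum>l<n. A j l * (deriv (y l) \<omega> + c * y l \<omega>)) =
       (\<Sum>l<n. A j l * w l \<omega>) + (\<Sum>l<n. A j l * transform ?M (w l) \<omega>)"
      by (simp add: sum.distrib)
    then show ?thesis by (simp only: y1' y2' M_transform insertI1) (simp only: add_ac)
  qed
  also have "transform ?M (deriv (w j)) \<omega> + (\<Sum>l<n. A j l * transform ?M (w l) \<omega>) =
      transform ?M (\<lambda>z. deriv (w j) z + (\<Sum>l<n. A j l * w l z)) \<omega>"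
  proof -
    let ?w = "\<lambda>l \<omega>. if \<omega> = a then 0 else w l \<omega>"
    have i: "(\<lambda>t::real. (\<omega> - a) * ?M ((1 - of_real t) * (\<omega> - a)) * ?w l (a + of_real t * (\<omega> - a))) integrable_on cbox 0 1"
      if "l < n" for l
      using convolution.conv_integrable(1)[OF conv_w[OF M that] \<omega>] .
    have i': "(\<lambda>t::real. (\<omega> - a) * ?M ((1 - of_real t) * (\<omega> - a)) * (\<Sum>l<n. A j l * ?w l (a + of_real t * (\<omega> - a)))) integrable_on cbox 0 1"
    proof -
      have "(\<lambda>t::real. \<Sum>l<n. A j l * ((\<omega> - a) * ?M ((1 - of_real t) * (\<omega> - a)) * ?w l (a + of_real t * (\<omega> - a)))) integrable_on cbox 0 1"
        by (intro integrable_sum integrable_on_mult_right i) auto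
      then show ?thesis by (simp add: sum_distrib_left mult_ac)
    qed
    have "transform ?M (\<lambda>z. deriv (w j) z + (\<Sum>l<n. A j l * w l z)) \<omega> =
       conv ?M a (\<lambda>z. (if z = a then 0 else deriv (w j) z) + (\<Sum>l<n. A j l * ?w l z)) \<omega>"
      unfolding transform_def by (rule conv_cong) simp
    also have "\<dots> = transform ?M (deriv (w j)) \<omega> + conv ?M a (\<lambda>z. \<Sum>l<n. A j l * ?w l z) \<omega>"
      unfolding transform_def
      using convolution.conv_integrable(2)[OF conv_w[OF M j] \<omega>] i' by (rule conv_add)
    also have "conv ?M a (\<lambda>z. \<Sum>l<n. A j l * ?w l z) \<omega> = (\<Sum>l<n. A j l * transform ?M (w l) \<omega>)"
      unfolding transform_def by (rule conv_sum) (use i in auto)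
    finally show ?thesis by simp
  qed
  finally have "\<tau> j * exp (- \<omega>) * (deriv (deriv (y j)) \<omega> + c * deriv (y j) \<omega> + (\<Sum>l<n. A j l * (deriv (y l) \<omega> + c * y l \<omega>))) =
     \<tau> j * exp (- \<omega>) * (deriv (w j) \<omega> + (\<Sum>l<n. A j l * w l \<omega>)) +
     \<tau> j * exp (- \<omega>) * transform ?M (\<lambda>z. deriv (w j) z + (\<Sum>l<n. A j l * w l z)) \<omega>"
    by (simp add: distrib_left)
  also have "\<tau> j * exp (- \<omega>) * transform ?M (\<lambda>z. deriv (w j) z + (\<Sum>l<n. A j l * w l z)) \<omega> = transform ?L (deriv (w j)) \<omega>"
    unfolding transform_def conv_def integral_mult_right[symmetric]
  proof (rule integral_cong)
    fix t :: real assume t: "t \<in> cbox 0 1"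
    let ?s = "a + of_real t * (\<omega> - a)"
    show "\<tau> j * exp (- \<omega>) * ((\<omega> - a) * ?M ((1 - of_real t) * (\<omega> - a)) *
        (if ?s = a then 0 else deriv (w j) ?s + (\<Sum>l<n. A j l * w l ?s))) =
      (\<omega> - a) * ?L ((1 - of_real t) * (\<omega> - a)) * (if ?s = a then 0 else deriv (w j) ?s)"
    proof (cases "?s = a")
      case False
      then have "0 < t" "t \<le> 1" using t by (auto simp: less_le)
      then have "?s \<in> S" using star \<omega> by blast
      note * = w_ode[OF j this]
      \<comment> \<open>One factor belongs to the argument of the kernel, the other to the
        integration point, where it meets the differential equation of \<open>w\<close>.\<close>
      have **: "exp (- \<omega>) = exp (- ((1 - of_real t) * (\<omega> - a))) * exp (- ?s)"
        by (simp add: exp_add[symmetric] algebra_simps)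
      let ?E = "exp (- ((1 - of_real t) * (\<omega> - a)))"
      have "\<tau> j * exp (- \<omega>) * ((\<omega> - a) * ?M ((1 - of_real t) * (\<omega> - a)) * (deriv (w j) ?s + (\<Sum>l<n. A j l * w l ?s))) =
        (\<omega> - a) * (?E * ?M ((1 - of_real t) * (\<omega> - a))) * (\<tau> j * exp (- ?s) * (deriv (w j) ?s + (\<Sum>l<n. A j l * w l ?s)))"
        unfolding ** by (simp only: mult_ac)
      then show ?thesis unfolding * using False by simp
    qed simp
  qed
  also have "transform ?L (deriv (w j)) \<omega> = transform (deriv ?L) (w j) \<omega> + ?L 0 * w j \<omega>"
    using transform_by_parts[OF L j \<omega>] by simp
  also have "transform (deriv ?L) (w j) \<omega> =
      transform (deriv (deriv K)) (w j) \<omega> + c * transform (deriv K) (w j) \<omega> + d * transform K (w j) \<omega>"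
  proof -
    have "transform (deriv ?L) (w j) \<omega> = transform (\<lambda>z. deriv (deriv K) z + c * deriv K z + d * K z) (w j) \<omega>"
      unfolding transform_def
    proof (rule conv_kernel_cong)
      fix t :: real assume t: "0 \<le> t" "t \<le> 1"
      let ?z = "of_real t * (\<omega> - a)"
      have z: "?z \<in> wide_strip" by (rule in_wide_strip[OF \<omega> t])
      have "(?L has_field_derivative exp (- ?z) * (deriv (deriv K) ?z + (c - 1) * deriv K ?z - c * K ?z)) (at ?z)"
        by (rule derivative_eq_intros holomorphic_derivI[OF K(1) open_wide_strip z]
             holomorphic_derivI[OF deriv_K(1) open_wide_strip z] refl | simp)+ (simp add: algebra_simps)
      then show "deriv ?L ?z = deriv (deriv K) ?z + c * deriv K ?z + d * K ?z"
        using K_ode[OF z] by (simp add: DERIV_imp_deriv)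
    qed
    also have "\<dots> = transform (\<lambda>z. deriv (deriv K) z + c * deriv K z) (w j) \<omega> + d * transform K (w j) \<omega>"
      unfolding transform_def
      by (intro conv_kernel_add convolution.conv_integrable(1)[OF conv_w] holomorphic_intros deriv_K K j \<omega>)
    also have "transform (\<lambda>z. deriv (deriv K) z + c * deriv K z) (w j) \<omega> =
       transform (deriv (deriv K)) (w j) \<omega> + c * transform (deriv K) (w j) \<omega>"
      unfolding transform_def
      by (intro conv_kernel_add convolution.conv_integrable(1)[OF conv_w] holomorphic_intros deriv_K K j \<omega>)
    finally show ?thesis .
  qed
  also have "\<tau> j * exp (- \<omega>) * (deriv (w j) \<omega> + (\<Sum>l<n. A j l * w l \<omega>)) = deriv (w j) \<omega>"
    by (rule w_ode[OF j \<omega>])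
  finally show ?thesis
    unfolding y2 y1[OF j \<omega>] by (simp add: y_def K(2) algebra_simps)
qed

lemma transform_branch:
  assumes "L holomorphic_on wide_strip" "j < n"
  shows "\<exists>e'. branch_at S a (lam + 1) e' (transform L (w j))"
  using w_branch[OF assms(2)]
proof (rule branch_atE)
  fix r \<Phi> assume *: "0 < r" "\<Phi> holomorphic_on ball a r" "\<Phi> a = e j"
    "\<And>\<omega>. \<omega> \<in> S \<Longrightarrow> \<omega> \<in> ball a r \<Longrightarrow> w j \<omega> = (\<omega> - a) powr lam * \<Phi> \<omega>"
  obtain r' X where "0 < r'" "X holomorphic_on ball a r'"
    "\<And>\<omega>. \<omega> \<in> S \<Longrightarrow> \<omega> \<in> ball a r' \<Longrightarrow> transform L (w j) \<omega> = (\<omega> - a) powr (lam + 1) * X \<omega>"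
    unfolding transform_def
    by (rule conv_branch[OF *(1,2) open_wide_strip zero_in_wide_strip assms(1), of lam S "\<lambda>\<omega>. if \<omega> = a then 0 else w j \<omega>"])
       (use lam *(4) a_notin star in auto)
  then show ?thesis by (intro exI[of _ "X a"] branch_atI[of r' X]) auto
qed

definition extension :: "nat \<Rightarrow> complex \<Rightarrow> complex" where
  "extension j \<omega> = exp (c * \<omega>) * (deriv (transform K (w j)) \<omega> + (\<Sum>l<n. A j l * transform K (w l) \<omega>))"

text \<open>The derivative of the j-th transform is w_j plus the convolution of
  \<open>deriv K\<close> with w_j. Only w_j has a term with exponent lam; every convolution has
  exponent lam + 1 and contributes 0 to the leading coefficient.\<close>

lemma extension_branch:
  assumes j: "j < n"
  shows "branch_at S a lam (exp (c * a) * e j) (extension j)"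
proof -
  have 1: "branch_at S a lam 0 (transform L (w l))" if "L holomorphic_on wide_strip" "l < n" for L l
    using transform_branch[OF that] branch_at_raise a_notin by blast
  have 2: "branch_at S a lam (A j l * 0) (\<lambda>\<omega>. A j l * transform K (w l) \<omega>)" if "l < n" for l
    by (intro branch_at_mult 1 K that) auto
  have "branch_at S a lam (exp (c * a) * ((e j + 0) + (\<Sum>l<n. A j l * 0)))
     (\<lambda>\<omega>. exp (c * \<omega>) * ((w j \<omega> + transform (deriv K) (w j) \<omega>) + (\<Sum>l<n. A j l * transform K (w l) \<omega>)))"
    by (intro branch_at_mult[of S a lam _ _ "\<lambda>\<omega>. exp (c * \<omega>)"] branch_at_add branch_at_sum 2 1 w_branch deriv_K j holomorphic_intros) auto
  then have "branch_at S a lam (exp (c * a) * ((e j + 0) + (\<Sum>l<n. A j l * 0))) (extension j)"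
    by (rule branch_at_cong)
       (use DERIV_imp_deriv[OF transform_derivative[OF K(1) j]] K(2) in \<open>simp add: extension_def\<close>)
  then show ?thesis by simp
qed

text \<open>Put g = y' + A y. The equation of y is y'' + c y' + d y = \<tau> e^(-\<omega>) (g' + c
  g); applying d/d\<omega> + A to it gives an equation for g alone. For u = e^(c \<omega>) g one has
  u' = e^(c \<omega>) (g' + c g), and g'' + c g' + d g turns into u'' - c u' + d u.\<close>

lemma extension_solution: "extended_solution n \<tau> A c d S extension"
  unfolding extended_solution_def
proof (intro allI impI conjI ballI)
  let ?y = "\<lambda>j. transform K (w j)"
  define g where "g = (\<lambda>j \<omega>. deriv (?y j) \<omega> + (\<Sum>l<n. A j l * ?y l \<omega>))"
  have y: "?y j holomorphic_on S" if "j < n" for j by (rule transform_holomorphic[OF K(1) that])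
  have y': "deriv (?y j) holomorphic_on S" if "j < n" for j by (rule holomorphic_deriv[OF y[OF that] open_S])
  have y'': "deriv (deriv (?y j)) holomorphic_on S" if "j < n" for j by (rule holomorphic_deriv[OF y'[OF that] open_S])
  have g: "g j holomorphic_on S" if "j < n" for j
    unfolding g_def by (intro holomorphic_intros y y' that) auto
  have g': "deriv (g j) holomorphic_on S" if "j < n" for j
    by (rule holomorphic_deriv[OF g[OF that] open_S])
  have dg: "deriv (g j) \<omega> = deriv (deriv (?y j)) \<omega> + (\<Sum>l<n. A j l * deriv (?y l) \<omega>)" if "j < n" "\<omega> \<in> S" for j \<omega>
    unfolding g_def
    by (intro DERIV_imp_deriv DERIV_add DERIV_sum DERIV_cmult holomorphic_derivI[OF _ open_S] y y' that) auto
  have ddg: "deriv (deriv (g j)) \<omega> = deriv (deriv (deriv (?y j))) \<omega> + (\<Sum>l<n. A j l * deriv (deriv (?y l)) \<omega>)"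
    if "j < n" "\<omega> \<in> S" for j \<omega>
  proof -
    have "deriv (deriv (g j)) \<omega> = deriv (\<lambda>\<omega>. deriv (deriv (?y j)) \<omega> + (\<Sum>l<n. A j l * deriv (?y l) \<omega>)) \<omega>"
      by (rule deriv_cong_on[OF open_S that(2)]) (rule dg[OF that(1)])
    also have "\<dots> = deriv (deriv (deriv (?y j))) \<omega> + (\<Sum>l<n. A j l * deriv (deriv (?y l)) \<omega>)"
      by (intro DERIV_imp_deriv DERIV_add DERIV_sum DERIV_cmult holomorphic_derivI[OF _ open_S] y' y'' that) auto
    finally show ?thesis .
  qed
  have ode: "deriv (deriv (?y j)) \<omega> + c * deriv (?y j) \<omega> + d * ?y j \<omega> = \<tau> j * exp (- \<omega>) * (deriv (g j) \<omega> + c * g j \<omega>)"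
    if "j < n" "\<omega> \<in> S" for j \<omega>
    using transform_ode[OF that] dg[OF that]
    by (simp add: g_def ring_distribs sum.distrib sum_distrib_left mult_ac add_ac)
  have ode': "deriv (deriv (deriv (?y j))) \<omega> + c * deriv (deriv (?y j)) \<omega> + d * deriv (?y j) \<omega> =
      \<tau> j * exp (- \<omega>) * (deriv (deriv (g j)) \<omega> + c * deriv (g j) \<omega> - deriv (g j) \<omega> - c * g j \<omega>)"
    if j: "j < n" and \<omega>: "\<omega> \<in> S" for j \<omega>
  proof -
    have "((\<lambda>\<omega>. deriv (deriv (?y j)) \<omega> + c * deriv (?y j) \<omega> + d * ?y j \<omega>) has_field_derivative
      deriv (deriv (deriv (?y j))) \<omega> + c * deriv (deriv (?y j)) \<omega> + d * deriv (?y j) \<omega>) (at \<omega>)"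
      by (intro DERIV_add DERIV_cmult holomorphic_derivI[OF _ open_S] y y' y'' that)
    then have "((\<lambda>\<omega>. \<tau> j * exp (- \<omega>) * (deriv (g j) \<omega> + c * g j \<omega>)) has_field_derivative
      deriv (deriv (deriv (?y j))) \<omega> + c * deriv (deriv (?y j)) \<omega> + d * deriv (?y j) \<omega>) (at \<omega>)"
      by (rule has_field_derivative_transform_within_open[OF _ open_S \<omega>]) (rule ode[OF j])
    moreover have "((\<lambda>\<omega>. \<tau> j * exp (- \<omega>) * (deriv (g j) \<omega> + c * g j \<omega>)) has_field_derivative
      \<tau> j * exp (- \<omega>) * (deriv (deriv (g j)) \<omega> + c * deriv (g j) \<omega> - deriv (g j) \<omega> - c * g j \<omega>)) (at \<omega>)"
      by (rule derivative_eq_intros holomorphic_derivI[OF g[OF j] open_S \<omega>]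
             holomorphic_derivI[OF g'[OF j] open_S \<omega>] refl | simp)+ (simp add: algebra_simps)
    ultimately show ?thesis by (rule DERIV_unique)
  qed
  have ext: "extension j = (\<lambda>\<omega>. exp (c * \<omega>) * g j \<omega>)" for j
    by (simp add: extension_def g_def fun_eq_iff)
  have du: "(extension j has_field_derivative exp (c * \<omega>) * (deriv (g j) \<omega> + c * g j \<omega>)) (at \<omega>)"
    if "j < n" "\<omega> \<in> S" for j \<omega>
    unfolding ext by (rule derivative_eq_intros holomorphic_derivI[OF g[OF that(1)] open_S that(2)] refl | simp)+
      (simp add: algebra_simps)
  fix j assume j: "j < n"
  show "extension j holomorphic_on S"
    using du[OF j] by (auto simp: holomorphic_on_open[OF open_S])
  fix \<omega> assume \<omega>: "\<omega> \<in> S"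
  have u1: "deriv (extension l) z = exp (c * z) * (deriv (g l) z + c * g l z)" if "l < n" "z \<in> S" for l z
    using du[OF that] by (rule DERIV_imp_deriv)
  have u2: "deriv (deriv (extension j)) \<omega> = exp (c * \<omega>) * (deriv (deriv (g j)) \<omega> + 2 * c * deriv (g j) \<omega> + c ^ 2 * g j \<omega>)"
  proof -
    have "deriv (deriv (extension j)) \<omega> = deriv (\<lambda>z. exp (c * z) * (deriv (g j) z + c * g j z)) \<omega>"
      by (rule deriv_cong_on[OF open_S \<omega>]) (rule u1[OF j])
    also have "\<dots> = exp (c * \<omega>) * (deriv (deriv (g j)) \<omega> + 2 * c * deriv (g j) \<omega> + c ^ 2 * g j \<omega>)"
      by (rule DERIV_imp_deriv)
         ((rule derivative_eq_intros holomorphic_derivI[OF g[OF j] open_S \<omega>]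
             holomorphic_derivI[OF g'[OF j] open_S \<omega>] refl | simp)+, simp add: algebra_simps power2_eq_square)
    finally show ?thesis .
  qed
  let ?E = "exp (- \<omega>)"
  have "deriv (deriv (g j)) \<omega> + c * deriv (g j) \<omega> + d * g j \<omega> =
     (deriv (deriv (deriv (?y j))) \<omega> + c * deriv (deriv (?y j)) \<omega> + d * deriv (?y j) \<omega>) +
     (\<Sum>l<n. A j l * (deriv (deriv (?y l)) \<omega> + c * deriv (?y l) \<omega> + d * ?y l \<omega>))"
    by (simp add: dg[OF j \<omega>] ddg[OF j \<omega>]) (simp add: g_def ring_distribs sum.distrib sum_distrib_left mult_ac add_ac)
  also have "\<dots> = \<tau> j * ?E * (deriv (deriv (g j)) \<omega> + c * deriv (g j) \<omega> - deriv (g j) \<omega> - c * g j \<omega>) +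
     (\<Sum>l<n. A j l * (\<tau> l * ?E * (deriv (g l) \<omega> + c * g l \<omega>)))"
    using \<omega> by (simp add: ode'[OF j \<omega>] ode)
  finally have main: "deriv (deriv (g j)) \<omega> + c * deriv (g j) \<omega> + d * g j \<omega> = \<dots>" .
  have s: "(\<Sum>l<n. A j l * \<tau> l * deriv (extension l) \<omega>) =
     exp (c * \<omega>) * (\<Sum>l<n. A j l * (\<tau> l * (deriv (g l) \<omega> + c * g l \<omega>)))"
    using \<omega> by (simp add: u1 sum_distrib_left mult_ac)
  have s': "(\<Sum>l<n. A j l * (\<tau> l * ?E * (deriv (g l) \<omega> + c * g l \<omega>))) =
     ?E * (\<Sum>l<n. A j l * (\<tau> l * (deriv (g l) \<omega> + c * g l \<omega>)))"
    by (simp add: sum_distrib_left mult_ac)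
  have "deriv (deriv (extension j)) \<omega> - c * deriv (extension j) \<omega> + d * extension j \<omega> =
     exp (c * \<omega>) * (deriv (deriv (g j)) \<omega> + c * deriv (g j) \<omega> + d * g j \<omega>)"
    unfolding u2 u1[OF j \<omega>] by (simp add: ext algebra_simps power2_eq_square)
  also have "\<dots> = \<tau> j * ?E * (deriv (deriv (extension j)) \<omega> - (1 + c) * deriv (extension j) \<omega>) +
      ?E * (\<Sum>l<n. A j l * \<tau> l * deriv (extension l) \<omega>)"
    unfolding main s s' u2 u1[OF j \<omega>] by (simp add: algebra_simps power2_eq_square)
  finally show "deriv (deriv (extension j)) \<omega> - c * deriv (extension j) \<omega> + d * extension j \<omega> =
     \<tau> j * ?E * (deriv (deriv (extension j)) \<omega> - (1 + c) * deriv (extension j) \<omega>) +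
      ?E * (\<Sum>l<n. A j l * \<tau> l * deriv (extension l) \<omega>)" .
qed

end
end

section \<open>Transfer of the connection relation\<close>

lemma contour_integral_linepath_eq:
  "contour_integral (linepath p q) f = integral (cbox 0 1) (\<lambda>t::real. (q - p) * f (p + of_real t * (q - p)))"
  unfolding contour_integral_integral box_real
proof (rule integral_cong)
  fix t :: real assume "t \<in> {0..1}"
  moreover have "linepath p q t = p + of_real t * (q - p)"
    by (simp add: linepath_def scaleR_conv_of_real algebra_simps)
  ultimately show "f (linepath p q t) * vector_derivative (linepath p q) (at t) =
     (q - p) * f (p + of_real t * (q - p))"
    by (simp add: vector_derivative_linepath_at mult.commute)
qed

locale strip_endpoints = A: strip_endpoint S \<alpha> \<beta> a + B: strip_endpoint S \<alpha> \<beta> b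
  for S \<alpha> \<beta> a b +
  assumes opposite: "Im a \<noteq> Im b"
begin

text \<open>A triangle with vertices \<open>a\<close>, \<open>b\<close> on opposite edges and
  \<omega> inside touches the edges at \<open>a\<close> and \<open>b\<close> only. Cauchy's theorem
  is applied to an integrand that is holomorphic in \<open>S\<close> and merely continuous at the
  two endpoints.\<close>

lemma hull_subset:
  assumes "\<omega> \<in> S"
  shows "convex hull {a, \<omega>, b} \<subseteq> insert a (insert b S)"
proof
  fix z assume "z \<in> convex hull {a, \<omega>, b}"
  then obtain x y v where xyv: "0 \<le> x" "0 \<le> y" "0 \<le> v" "x + y + v = 1"
    and z: "z = x *\<^sub>R a + y *\<^sub>R \<omega> + v *\<^sub>R b"
    unfolding convex_hull_3 by blast
  have Im: "Im z = x * Im a + y * Im \<omega> + v * Im b" using z by simp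
  have x: "x = 1 - y - v" using xyv by simp
  have \<omega>: "0 < Im \<omega> - \<alpha>" "0 < \<beta> - Im \<omega>" using assms by (auto simp: A.S)
  have w: "0 < \<beta> - \<alpha>" using A.width by simp
  show "z \<in> insert a (insert b S)"
  proof (cases "y = 0 \<and> (x = 0 \<or> v = 0)")
    case True
    then show ?thesis using z xyv by auto
  next
    case False
    then consider "0 < y" | "0 < x" "0 < v" using xyv by fastforce
    moreover have "0 \<le> y * (Im \<omega> - \<alpha>)" "0 \<le> v * (\<beta> - \<alpha>)" "0 \<le> x * (\<beta> - \<alpha>)" "0 \<le> y * (\<beta> - Im \<omega>)"
      using xyv \<omega> w by simp_all
    moreover have "0 < y \<Longrightarrow> 0 < y * (Im \<omega> - \<alpha>)" "0 < y \<Longrightarrow> 0 < y * (\<beta> - Im \<omega>)"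
      "0 < x \<Longrightarrow> 0 < x * (\<beta> - \<alpha>)" "0 < v \<Longrightarrow> 0 < v * (\<beta> - \<alpha>)"
      using \<omega> w by simp_all
    \<comment> \<open>The distances of z from the two edges, for both positions of \<open>a\<close>
      and \<open>b\<close>; they are positive unless all the weight sits on a single
      endpoint.\<close>
    ultimately have pos: "0 < y * (Im \<omega> - \<alpha>) + v * (\<beta> - \<alpha>)" "0 < x * (\<beta> - \<alpha>) + y * (\<beta> - Im \<omega>)"
      "0 < y * (Im \<omega> - \<alpha>) + x * (\<beta> - \<alpha>)" "0 < v * (\<beta> - \<alpha>) + y * (\<beta> - Im \<omega>)"
      by (cases; linarith)+
    consider "Im a = \<alpha>" "Im b = \<beta>" | "Im a = \<beta>" "Im b = \<alpha>"
      using A.endpoint B.endpoint opposite by auto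
    then have "\<alpha> < Im z \<and> Im z < \<beta>"
      using pos unfolding Im x by cases (simp_all add: algebra_simps)
    then show ?thesis by (simp add: A.S)
  qed
qed

lemma in_wide_strip_diff:
  assumes "\<omega> \<in> S" "\<sigma> \<in> insert a (insert b S)"
  shows "\<omega> - \<sigma> \<in> wide_strip"
  using assms A.endpoint B.endpoint A.width by (auto simp: A.S wide_strip_def)

text \<open>By Cauchy's theorem the path from \<open>a\<close> to \<omega> may be replaced by that
  from \<open>a\<close> to \<open>b\<close> followed by that from \<open>b\<close> to \<omega>. The
  first part, \<open>P\<close>, depends on \<omega> through the kernel only and is holomorphic near
  \<open>b\<close>. In the second, \<open>wa\<close> is replaced by the combination of the
  \<open>wb i\<close> plus \<open>H\<close>, and the convolution of \<open>H\<close> from its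
  regular point \<open>b\<close> is again holomorphic.\<close>

lemma transform_connection:
  assumes K: "K holomorphic_on wide_strip"
    and wa: "wa holomorphic_on S" "branch_at S a la ea wa" "1 < Re la"
    and I: "finite I"
    and wb: "\<And>i. i \<in> I \<Longrightarrow> wb i holomorphic_on S" "\<And>i. i \<in> I \<Longrightarrow> branch_at S b (lb i) (eb i) (wb i)"
      "\<And>i. i \<in> I \<Longrightarrow> 1 < Re (lb i)"
    and conn: "extends_at S b (\<lambda>\<omega>. wa \<omega> - (\<Sum>i\<in>I. cc i * wb i \<omega>))"
  shows "extends_at S b (\<lambda>\<omega>. A.transform K wa \<omega> - (\<Sum>i\<in>I. cc i * B.transform K (wb i) \<omega>))"
proof -
  obtain r H where r: "0 < r" and H: "H holomorphic_on ball b r"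
    and H_eq: "\<And>\<omega>. \<omega> \<in> S \<Longrightarrow> \<omega> \<in> ball b r \<Longrightarrow> wa \<omega> - (\<Sum>i\<in>I. cc i * wb i \<omega>) = H \<omega>"
    using conn unfolding extends_at_def by auto
  have wa_eq: "wa \<omega> = (\<Sum>i\<in>I. cc i * wb i \<omega>) + H \<omega>" if "\<omega> \<in> S" "\<omega> \<in> ball b r" for \<omega>
    using H_eq[OF that] by (simp add: algebra_simps)
  let ?wb = "\<lambda>i \<omega>. if \<omega> = b then 0 else wb i \<omega>"
  \<comment> \<open>The branches \<open>wb i\<close> tend to 0 at \<open>b\<close>, so
    \<open>wa\<close> tends to \<open>H b\<close>. \<open>f1\<close> and then \<open>wf\<close>
    extend \<open>wa\<close> continuously to \<open>b\<close> and to \<open>a\<close>.\<close>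
  define f1 where "f1 = (\<lambda>\<omega>. if \<omega> = b then H b else wa \<omega>)"
  define wf where "wf = (\<lambda>\<omega>. if \<omega> = a then 0 else f1 \<omega>)"
  have ab: "a \<noteq> b" using opposite by auto
  have wf_S: "wf \<omega> = wa \<omega>" if "\<omega> \<in> S" for \<omega>
    using that A.a_notin B.a_notin by (auto simp: wf_def f1_def)
  have wa_cont: "continuous_on S wa" using wa(1) by (rule holomorphic_on_imp_continuous_on)
  have "(wa \<longlongrightarrow> H b) (at b within S)"
  proof -
    have "isCont H b" using H r
      by (meson centre_in_ball holomorphic_on_imp_continuous_on open_ball continuous_on_eq_continuous_at)
    then have "(H \<longlongrightarrow> H b) (at b within S)"
      using continuous_at_imp_continuous_within continuous_within by blast
    then have "((\<lambda>\<omega>. (\<Sum>i\<in>I. cc i * wb i \<omega>) + H \<omega>) \<longlongrightarrow> (\<Sum>i\<in>I. cc i * 0) + H b) (at b within S)"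
      using branch_at_tendsto[OF wb(2)] wb(3) by (intro tendsto_intros) force+
    moreover have "\<forall>\<^sub>F \<omega> in at b within S. (\<Sum>i\<in>I. cc i * wb i \<omega>) + H \<omega> = wa \<omega>"
      unfolding eventually_at using r wa_eq by (intro exI[of _ r]) (auto simp: dist_commute)
    ultimately show ?thesis using Lim_transform_eventually by fastforce
  qed
  then have f1_cont: "continuous_on (insert b S) f1"
    unfolding f1_def by (intro continuous_on_insert_value wa_cont B.a_notin)
  have "(f1 \<longlongrightarrow> 0) (at a within insert b S)"
    unfolding at_within_insert_eq
  proof (rule Lim_transform_eventually)
    show "(wa \<longlongrightarrow> 0) (at a within S)" using branch_at_tendsto wa(2,3) by force
    show "\<forall>\<^sub>F \<omega> in at a within S. wa \<omega> = f1 \<omega>"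
      using B.a_notin by (auto simp: eventually_at_topological f1_def)
  qed
  then have wf_cont: "continuous_on (insert a (insert b S)) wf"
    unfolding wf_def using f1_cont A.a_notin ab by (intro continuous_on_insert_value) auto
  define P where "P = (\<lambda>\<omega>. integral (cbox 0 1) (\<lambda>t::real. (b - a) * (K (\<omega> - (a + of_real t * (b - a))) * wf (a + of_real t * (b - a)))))"
  have seg: "a + of_real t * (b - a) \<in> insert a (insert b S)" if "0 \<le> t" "t \<le> 1" for t
  proof (cases "t = 0 \<or> t = 1")
    case False
    then have "0 < t" "t < 1" using that by auto
    then have "0 < t * (\<beta> - \<alpha>)" "0 < (1 - t) * (\<beta> - \<alpha>)" using A.width by auto
    then show ?thesis using A.endpoint B.endpoint opposite by (auto simp: A.S algebra_simps)
  qed auto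
  have split_conv: "A.transform K wa \<omega> = P \<omega> + conv K b wf \<omega>" if \<omega>: "\<omega> \<in> S" for \<omega>
  proof -
    let ?g = "\<lambda>\<sigma>. K (\<omega> - \<sigma>) * wf \<sigma>"
    have gc: "continuous_on (insert a (insert b S)) ?g"
      by (intro continuous_on_mult wf_cont continuous_on_compose2[OF holomorphic_on_imp_continuous_on[OF K]]
           continuous_intros) (use in_wide_strip_diff[OF \<omega>] in blast)
    have "(\<lambda>\<sigma>. K (\<omega> - \<sigma>) * wa \<sigma>) holomorphic_on S"
      by (intro holomorphic_intros wa holomorphic_on_compose_gen[OF _ K, unfolded o_def])
         (use in_wide_strip_diff[OF \<omega>] in blast)
    then have gh: "?g holomorphic_on S"
      by (rule holomorphic_transform) (simp add: wf_S)
    have "(?g has_contour_integral 0) (linepath a \<omega> +++ linepath \<omega> b +++ linepath b a)"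
    proof (rule Cauchy_theorem_triangle_cofinite[where S = "{a, b}"])
      show "continuous_on (convex hull {a, \<omega>, b}) ?g"
        by (rule continuous_on_subset[OF gc hull_subset[OF \<omega>]])
      fix x assume "x \<in> interior (convex hull {a, \<omega>, b}) - {a, b}"
      then have "x \<in> S" using hull_subset[OF \<omega>] interior_subset by blast
      then show "?g field_differentiable at x"
        using gh A.open_S holomorphic_on_imp_differentiable_at by blast
    qed simp
    then have sum0: "contour_integral (linepath a \<omega>) ?g + contour_integral (linepath \<omega> b) ?g + contour_integral (linepath b a) ?g = 0"
      by (rule has_chain_integral_chain_integral3)
    have sub: "closed_segment p q \<subseteq> insert a (insert b S)" if "p \<in> {a, \<omega>, b}" "q \<in> {a, \<omega>, b}" for p q
      using hull_subset[OF \<omega>] closed_segment_subset_convex_hull[of p "{a, \<omega>, b}" q] that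
      by (meson closed_segment_subset_convex_hull hull_inc order_trans)
    have rev: "contour_integral (linepath \<omega> b) ?g = - contour_integral (linepath b \<omega>) ?g"
      "contour_integral (linepath b a) ?g = - contour_integral (linepath a b) ?g"
      by (intro contour_integral_reverse_linepath continuous_on_subset[OF gc sub]; simp)+
    have conv_eq: "contour_integral (linepath p \<omega>) ?g = conv K p wf \<omega>" for p
      unfolding contour_integral_linepath_eq conv_def by (rule integral_cong) (simp add: algebra_simps)
    have "A.transform K wa \<omega> = conv K a wf \<omega>"
      unfolding A.transform_def
    proof (rule conv_cong)
      fix t :: real assume t: "0 \<le> t" "t \<le> 1"
      show "(if a + of_real t * (\<omega> - a) = a then 0 else wa (a + of_real t * (\<omega> - a))) = wf (a + of_real t * (\<omega> - a))"
      proof (cases "t = 0")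
        case False
        then show ?thesis using A.star[OF \<omega>, of t] t wf_S A.a_notin by auto
      qed (simp add: wf_def)
    qed
    also have "\<dots> = contour_integral (linepath a b) ?g + conv K b wf \<omega>"
      using sum0 unfolding rev conv_eq by (simp add: algebra_simps)
    finally show ?thesis by (simp add: P_def contour_integral_linepath_eq)
  qed
  \<comment> \<open>The margin 2 pi - (\<beta> - \<alpha>) lets \<omega> leave \<open>S\<close> near
    \<open>b\<close> while \<omega> - \<sigma>, for \<sigma> on the segment from \<open>a\<close> to
    \<open>b\<close>, stays in the domain of the kernel.\<close>
  define r' where "r' = min r (2 * pi - (\<beta> - \<alpha>))"
  have r': "0 < r'" "r' \<le> r" "r' \<le> 2 * pi - (\<beta> - \<alpha>)" using r A.width by (auto simp: r'_def)
  have ball_wide: "\<omega> - (a + of_real t * (b - a)) \<in> wide_strip" if "\<omega> \<in> ball b r'" "0 \<le> t" "t \<le> 1" for \<omega> t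
  proof -
    have "\<bar>Im \<omega> - Im b\<bar> < r'"
      using that(1) abs_Im_le_cmod[of "\<omega> - b"] by (simp add: dist_norm norm_minus_commute)
    moreover have "\<bar>Im b - Im (a + of_real t * (b - a))\<bar> \<le> \<beta> - \<alpha>"
    proof -
      have "Im b - Im (a + of_real t * (b - a)) = (1 - t) * (Im b - Im a)" by (simp add: algebra_simps)
      moreover have "(1 - t) * \<bar>Im b - Im a\<bar> \<le> \<bar>Im b - Im a\<bar>"
        using that by (intro mult_left_le_one_le) auto
      ultimately show ?thesis
        using that A.endpoint B.endpoint A.width by (auto simp: abs_mult)
    qed
    ultimately show ?thesis using r'(3) by (simp add: wide_strip_def)
  qed
  have P: "P holomorphic_on ball b r'"
    unfolding P_def
  proof (rule leibniz_rule_holomorphic)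
    fix \<omega> and t :: real assume *: "\<omega> \<in> ball b r'" "t \<in> cbox 0 1"
    have "((\<lambda>\<omega>. \<omega> - (a + of_real t * (b - a))) has_field_derivative 1) (at \<omega>)"
      by (auto intro!: derivative_eq_intros)
    from DERIV_chain2[OF holomorphic_derivI[OF K open_wide_strip ball_wide] this]
    have "((\<lambda>\<omega>. K (\<omega> - (a + of_real t * (b - a)))) has_field_derivative deriv K (\<omega> - (a + of_real t * (b - a)))) (at \<omega>)"
      using * by simp
    from DERIV_cmult[OF DERIV_cmult_right[OF this]]
    show "((\<lambda>\<omega>. (b - a) * (K (\<omega> - (a + of_real t * (b - a))) * wf (a + of_real t * (b - a)))) has_field_derivative
      (b - a) * (deriv K (\<omega> - (a + of_real t * (b - a))) * wf (a + of_real t * (b - a)))) (at \<omega> within ball b r')"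
      by (rule has_field_derivative_at_within)
  next
    fix \<omega> assume *: "\<omega> \<in> ball b r'"
    have "continuous_on {0..1::real} (\<lambda>t. wf (a + of_real t * (b - a)))"
      by (rule continuous_on_compose2[OF wf_cont], intro continuous_intros, (rule image_subsetI, rule seg); simp)
    moreover have "continuous_on {0..1::real} (\<lambda>t. K (\<omega> - (a + of_real t * (b - a))))"
      by (rule continuous_on_compose2[OF holomorphic_on_imp_continuous_on[OF K]])
         (use ball_wide[OF *] in \<open>auto intro!: continuous_intros\<close>)
    ultimately show "(\<lambda>t::real. (b - a) * (K (\<omega> - (a + of_real t * (b - a))) * wf (a + of_real t * (b - a)))) integrable_on cbox 0 1"
      unfolding box_real by (intro integrable_continuous_interval continuous_intros)
  next
    have 1: "continuous_on (ball b r' \<times> {0..1::real}) (\<lambda>p. wf (a + of_real (snd p) * (b - a)))"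
      by (rule continuous_on_compose2[OF wf_cont], intro continuous_intros, (rule image_subsetI, rule seg); auto)
    have 2: "continuous_on (ball b r' \<times> {0..1::real}) (\<lambda>p. deriv K (fst p - (a + of_real (snd p) * (b - a))))"
      by (rule continuous_on_compose2[OF holomorphic_on_imp_continuous_on[OF holomorphic_deriv[OF K open_wide_strip]]])
         (use ball_wide in \<open>auto intro!: continuous_intros\<close>)
    show "continuous_on (ball b r' \<times> cbox 0 1) (\<lambda>(\<omega>, t::real).
      (b - a) * (deriv K (\<omega> - (a + of_real t * (b - a))) * wf (a + of_real t * (b - a))))"
      unfolding split_beta box_real by (intro continuous_on_mult continuous_on_const 1 2)
  qed simp
  interpret CH: convolution "ball b r'" wide_strip b K H "deriv H"
  proof
    have H': "H holomorphic_on ball b r'" using H r'(2) by (auto elim!: holomorphic_on_subset)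
    have [simp]: "insert b (ball b r') = ball b r'" using r'(1) by auto
    show "continuous_on (insert b (ball b r')) H" "continuous_on (insert b (ball b r')) (deriv H)"
      using H' by (auto intro!: holomorphic_on_imp_continuous_on holomorphic_deriv)
    show "\<And>\<omega>. \<omega> \<in> ball b r' \<Longrightarrow> (H has_field_derivative deriv H \<omega>) (at \<omega>)"
      by (rule holomorphic_derivI[OF H' open_ball])
    have *: "cmod (of_real t * (\<omega> - b)) < r'" if "\<omega> \<in> ball b r'" "0 \<le> t" "t \<le> 1" for \<omega> and t :: real
    proof -
      have "t * cmod (\<omega> - b) \<le> cmod (\<omega> - b)" using that by (simp add: mult_left_le_one_le)
      then show ?thesis using that by (simp add: norm_mult dist_norm norm_minus_commute)
    qed
    show "\<And>\<omega> t. \<omega> \<in> ball b r' \<Longrightarrow> 0 < t \<Longrightarrow> t \<le> 1 \<Longrightarrow> b + complex_of_real t * (\<omega> - b) \<in> ball b r'"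
      using * by (simp add: dist_norm)
    show "complex_of_real t * (\<omega> - b) \<in> wide_strip" if "\<omega> \<in> ball b r'" "0 \<le> t" "t \<le> 1" for \<omega> t
    proof -
      have "\<bar>Im (of_real t * (\<omega> - b))\<bar> < r'"
        using *[OF that] abs_Im_le_cmod le_less_trans by blast
      then show ?thesis using r'(3) A.width by (simp add: wide_strip_def)
    qed
  qed (use K open_wide_strip in auto)
  have conv_b: "conv K b wf \<omega> = (\<Sum>i\<in>I. cc i * B.transform K (wb i) \<omega>) + conv K b H \<omega>"
    if \<omega>: "\<omega> \<in> S" "\<omega> \<in> ball b r'" for \<omega>
  proof -
    have i: "(\<lambda>t::real. (\<omega> - b) * K ((1 - of_real t) * (\<omega> - b)) * ?wb i (b + of_real t * (\<omega> - b))) integrable_on cbox 0 1"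
      if "i \<in> I" for i
      by (rule convolution.conv_integrable(1)[OF B.convolutionI[OF K wb(1)[OF that] wb(2)[OF that] wb(3)[OF that]] \<omega>(1)])
    have i': "(\<lambda>t::real. (\<omega> - b) * K ((1 - of_real t) * (\<omega> - b)) * (\<Sum>i\<in>I. cc i * ?wb i (b + of_real t * (\<omega> - b)))) integrable_on cbox 0 1"
    proof -
      have "(\<lambda>t::real. \<Sum>i\<in>I. cc i * ((\<omega> - b) * K ((1 - of_real t) * (\<omega> - b)) * ?wb i (b + of_real t * (\<omega> - b)))) integrable_on cbox 0 1"
        by (intro integrable_sum integrable_on_mult_right i I)
      then show ?thesis by (simp add: sum_distrib_left mult_ac)
    qed
    have "conv K b wf \<omega> = conv K b (\<lambda>z. (\<Sum>i\<in>I. cc i * ?wb i z) + H z) \<omega>"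
    proof (rule conv_cong)
      fix t :: real assume t: "0 \<le> t" "t \<le> 1"
      let ?z = "b + of_real t * (\<omega> - b)"
      show "wf ?z = (\<Sum>i\<in>I. cc i * ?wb i ?z) + H ?z"
      proof (cases "t = 0")
        case True
        then show ?thesis using ab by (simp add: wf_def f1_def)
      next
        case False
        then have z: "?z \<in> S" "?z \<in> ball b r'" using B.star[OF \<omega>(1), of t] CH.star[OF \<omega>(2), of t] t by auto
        then have "?z \<noteq> b" using B.a_notin by metis
        then show ?thesis using wa_eq[OF z(1)] wf_S[OF z(1)] z(2) r'(2) by simp
      qed
    qed
    also have "\<dots> = conv K b (\<lambda>z. \<Sum>i\<in>I. cc i * ?wb i z) \<omega> + conv K b H \<omega>"
      by (rule conv_add[OF i' CH.conv_integrable(1)[OF \<omega>(2)]])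
    also have "conv K b (\<lambda>z. \<Sum>i\<in>I. cc i * ?wb i z) \<omega> = (\<Sum>i\<in>I. cc i * B.transform K (wb i) \<omega>)"
      unfolding B.transform_def by (rule conv_sum[OF I i])
    finally show ?thesis .
  qed
  have "conv K b H holomorphic_on ball b r'"
    unfolding holomorphic_on_open[OF open_ball] using CH.conv_derivative by blast
  then have "(\<lambda>\<omega>. P \<omega> + conv K b H \<omega>) holomorphic_on ball b r'"
    by (intro holomorphic_intros P)
  then show ?thesis
    by (rule extends_atI[OF r'(1)]) (simp add: split_conv conv_b)
qed

end

section \<open>Shifting all exponents by one\<close>

definition shift_matrix :: "(nat \<Rightarrow> nat \<Rightarrow> complex) \<Rightarrow> complex \<Rightarrow> nat \<Rightarrow> nat \<Rightarrow> complex" where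
  "shift_matrix A z i l = A i l + (if i = l then z else 0)"

definition is_inverse :: "nat \<Rightarrow> (nat \<Rightarrow> nat \<Rightarrow> complex) \<Rightarrow> (nat \<Rightarrow> nat \<Rightarrow> complex) \<Rightarrow> bool" where
  "is_inverse n M B \<longleftrightarrow> (\<forall>j<n. \<forall>l<n.
     (\<Sum>i<n. B j i * M i l) = (if j = l then 1 else 0) \<and> (\<Sum>i<n. M j i * B i l) = (if j = l then 1 else 0))"

lemma sum_times_delta:
  fixes j n :: nat and f :: "nat \<Rightarrow> complex"
  assumes "j < n"
  shows "(\<Sum>l<n. (if j = l then 1 else 0) * f l) = f j"
proof -
  have "(\<Sum>l<n. (if j = l then 1 else 0) * f l) = (\<Sum>l<n. if j = l then f l else 0)"
    by (rule sum.cong) auto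
  then show ?thesis using assms by (simp add: sum.delta')
qed

lemma is_inverse_apply:
  assumes "is_inverse n M B" "j < n"
  shows "(\<Sum>i<n. B j i * (\<Sum>l<n. M i l * f l)) = f j" "(\<Sum>i<n. M j i * (\<Sum>l<n. B i l * f l)) = f j"
proof -
  have "(\<Sum>i<n. B j i * (\<Sum>l<n. M i l * f l)) = (\<Sum>l<n. (\<Sum>i<n. B j i * M i l) * f l)"
    unfolding sum_distrib_left sum_distrib_right by (subst sum.swap) (simp add: mult_ac)
  also have "\<dots> = (\<Sum>l<n. (if j = l then 1 else 0) * f l)"
    using assms by (intro sum.cong) (auto simp: is_inverse_def)
  finally show "(\<Sum>i<n. B j i * (\<Sum>l<n. M i l * f l)) = f j" using sum_times_delta[OF assms(2)] by simp
  have "(\<Sum>i<n. M j i * (\<Sum>l<n. B i l * f l)) = (\<Sum>l<n. (\<Sum>i<n. M j i * B i l) * f l)"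
    unfolding sum_distrib_left sum_distrib_right by (subst sum.swap) (simp add: mult_ac)
  also have "\<dots> = (\<Sum>l<n. (if j = l then 1 else 0) * f l)"
    using assms by (intro sum.cong) (auto simp: is_inverse_def)
  finally show "(\<Sum>i<n. M j i * (\<Sum>l<n. B i l * f l)) = f j" using sum_times_delta[OF assms(2)] by simp
qed

lemma shift_matrix_apply:
  assumes "j < n"
  shows "(\<Sum>l<n. shift_matrix A z j l * f l) = (\<Sum>l<n. A j l * f l) + z * f j"
proof -
  have "(\<Sum>l<n. shift_matrix A z j l * f l) = (\<Sum>l<n. A j l * f l) + (\<Sum>l<n. (if j = l then 1 else 0) * (z * f l))"
    unfolding sum.distrib[symmetric] by (rule sum.cong) (auto simp: shift_matrix_def algebra_simps)
  then show ?thesis using sum_times_delta[OF assms, of "\<lambda>l. z * f l"] by simp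
qed

text \<open>
  \<open>lift\<close> is the primitive with respect to \<open>\<zeta>\<close> that solves the underlying system with \<open>A + 1\<close>
  (\<open>B\<close> is the inverse of \<open>A + 1\<close>), \<open>lower\<close> is minus the derivative with respect to \<open>x\<close>.
\<close>

definition lift :: "nat \<Rightarrow> (nat \<Rightarrow> complex) \<Rightarrow> (nat \<Rightarrow> nat \<Rightarrow> complex) \<Rightarrow> (nat \<Rightarrow> complex \<Rightarrow> complex) \<Rightarrow> nat \<Rightarrow> complex \<Rightarrow> complex" where
  "lift n \<tau> B w j \<omega> = (\<Sum>l<n. B j l * ((exp (- \<omega>) - 1 / \<tau> l) * w l \<omega>))"

definition lower :: "(nat \<Rightarrow> complex \<Rightarrow> complex) \<Rightarrow> nat \<Rightarrow> complex \<Rightarrow> complex" where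
  "lower u j \<omega> = - exp (- \<omega>) * deriv (u j) \<omega>"

text \<open>The product rule and the system give -e^(-\<omega>) ((A + 1) w)_l as derivative of
  (e^(-\<omega>) - 1/\<tau>_l) w_l, and \<open>B\<close> removes A + 1. Since d\<zeta>/d\<omega> =
  -e^(-\<omega>), the \<zeta>-derivative of \<open>lift\<close> is \<open>w\<close>.\<close>

lemma lift_derivative:
  assumes w: "underlying_solution n \<tau> A S w" and "open S" and \<tau>: "\<And>j. j < n \<Longrightarrow> \<tau> j \<noteq> 0"
    and B: "is_inverse n (shift_matrix A 1) B" and j: "j < n" and \<omega>: "\<omega> \<in> S"
  shows "(lift n \<tau> B w j has_field_derivative - exp (- \<omega>) * w j \<omega>) (at \<omega>)"
proof -
  have d: "((\<lambda>\<omega>. (exp (- \<omega>) - 1 / \<tau> l) * w l \<omega>) has_field_derivative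
      (\<Sum>i<n. shift_matrix A 1 l i * (- exp (- \<omega>) * w i \<omega>))) (at \<omega>)" if l: "l < n" for l
  proof -
    have hol: "w l holomorphic_on S" and ode: "(1 - \<tau> l * exp (- \<omega>)) * deriv (w l) \<omega> = \<tau> l * exp (- \<omega>) * (\<Sum>i<n. A l i * w i \<omega>)"
      using w l \<omega> by (auto simp: underlying_solution_def)
    have "((\<lambda>\<omega>. (exp (- \<omega>) - 1 / \<tau> l) * w l \<omega>) has_field_derivative
      - exp (- \<omega>) * w l \<omega> + (exp (- \<omega>) - 1 / \<tau> l) * deriv (w l) \<omega>) (at \<omega>)"
      by (rule derivative_eq_intros holomorphic_derivI[OF hol \<open>open S\<close> \<omega>] refl | simp)+
    moreover have "(exp (- \<omega>) - 1 / \<tau> l) * deriv (w l) \<omega> = - exp (- \<omega>) * (\<Sum>i<n. A l i * w i \<omega>)"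
    proof -
      have "(exp (- \<omega>) - 1 / \<tau> l) * deriv (w l) \<omega> = - (1 / \<tau> l) * ((1 - \<tau> l * exp (- \<omega>)) * deriv (w l) \<omega>)"
        using \<tau>[OF l] by (simp add: field_simps)
      then show ?thesis using \<tau>[OF l] unfolding ode by simp
    qed
    moreover have "(\<Sum>i<n. shift_matrix A 1 l i * (- exp (- \<omega>) * w i \<omega>)) =
        - exp (- \<omega>) * (\<Sum>i<n. A l i * w i \<omega>) - exp (- \<omega>) * w l \<omega>"
      unfolding shift_matrix_apply[OF l] by (simp add: sum_distrib_left sum_negf mult_ac)
    ultimately show ?thesis by (simp only: diff_conv_add_uminus mult_minus_left add.commute)
  qed
  have "(lift n \<tau> B w j has_field_derivative (\<Sum>l<n. B j l * (\<Sum>i<n. shift_matrix A 1 l i * (- exp (- \<omega>) * w i \<omega>)))) (at \<omega>)"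
    unfolding lift_def[abs_def] by (intro DERIV_sum DERIV_cmult d) auto
  then show ?thesis unfolding is_inverse_apply(1)[OF B j] .
qed

text \<open>Applying A + 1 to \<open>lift\<close> returns (\<zeta> - t'_j) w_j, and w_j is the
  \<zeta>-derivative of \<open>lift\<close>; together these form the system for A + 1.\<close>

lemma lift_solution:
  assumes w: "underlying_solution n \<tau> A S w" and "open S" and \<tau>: "\<And>j. j < n \<Longrightarrow> \<tau> j \<noteq> 0"
    and B: "is_inverse n (shift_matrix A 1) B"
  shows "underlying_solution n \<tau> (shift_matrix A 1) S (lift n \<tau> B w)"
  unfolding underlying_solution_def
proof (intro allI impI conjI ballI)
  fix j assume j: "j < n"
  note d = lift_derivative[OF w \<open>open S\<close> \<tau> B j]
  show "lift n \<tau> B w j holomorphic_on S"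
    using d by (auto simp: holomorphic_on_open[OF \<open>open S\<close>])
  fix \<omega> assume "\<omega> \<in> S"
  then have 1: "deriv (lift n \<tau> B w j) \<omega> = - exp (- \<omega>) * w j \<omega>" by (intro DERIV_imp_deriv d) auto
  have 2: "(\<Sum>l<n. shift_matrix A 1 j l * lift n \<tau> B w l \<omega>) = (exp (- \<omega>) - 1 / \<tau> j) * w j \<omega>"
    unfolding lift_def by (rule is_inverse_apply(2)[OF B j])
  show "(1 - \<tau> j * exp (- \<omega>)) * deriv (lift n \<tau> B w j) \<omega> =
      \<tau> j * exp (- \<omega>) * (\<Sum>l<n. shift_matrix A 1 j l * lift n \<tau> B w l \<omega>)"
    unfolding 1 2 using \<tau>[OF j] by (simp add: field_simps)
qed

text \<open>The parameters c + 2 and d + c + 1 are the sum and the product of \<rho>1 + 1 and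
  \<rho>2 + 1. The equation of \<open>u\<close> is differentiated and multiplied by -e^(-\<omega>);
  in terms of \<open>lower u\<close> the result is the equation for A, c, d.\<close>

lemma lower_solution:
  assumes u: "extended_solution n \<tau> (shift_matrix A 1) (c + 2) (d + c + 1) S u" and "open S"
  shows "extended_solution n \<tau> A c d S (lower u)"
  unfolding extended_solution_def
proof (intro allI impI conjI ballI)
  have u0: "u j holomorphic_on S" if "j < n" for j using u that by (simp add: extended_solution_def)
  have u1: "deriv (u j) holomorphic_on S" if "j < n" for j by (intro holomorphic_deriv u0 that \<open>open S\<close>)
  have u2: "deriv (deriv (u j)) holomorphic_on S" if "j < n" for j by (intro holomorphic_deriv u1 that \<open>open S\<close>)
  note D = holomorphic_derivI[OF u0 \<open>open S\<close>] holomorphic_derivI[OF u1 \<open>open S\<close>] holomorphic_derivI[OF u2 \<open>open S\<close>]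
  have dl: "deriv (lower u j) \<omega> = - exp (- \<omega>) * (deriv (deriv (u j)) \<omega> - deriv (u j) \<omega>)" if "j < n" "\<omega> \<in> S" for j \<omega>
    unfolding lower_def
    by (rule DERIV_imp_deriv) ((rule derivative_eq_intros D that refl | simp)+, simp add: algebra_simps)
  have ddl: "deriv (deriv (lower u j)) \<omega> =
     - exp (- \<omega>) * (deriv (deriv (deriv (u j))) \<omega> - 2 * deriv (deriv (u j)) \<omega> + deriv (u j) \<omega>)" if "j < n" "\<omega> \<in> S" for j \<omega>
  proof -
    have "deriv (deriv (lower u j)) \<omega> = deriv (\<lambda>\<omega>. - exp (- \<omega>) * (deriv (deriv (u j)) \<omega> - deriv (u j) \<omega>)) \<omega>"
      by (rule deriv_cong_on[OF \<open>open S\<close> that(2)]) (rule dl[OF that(1)])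
    also have "\<dots> = - exp (- \<omega>) * (deriv (deriv (deriv (u j))) \<omega> - 2 * deriv (deriv (u j)) \<omega> + deriv (u j) \<omega>)"
      by (rule DERIV_imp_deriv) ((rule derivative_eq_intros D that refl | simp)+, simp add: algebra_simps)
    finally show ?thesis .
  qed
  fix j assume j: "j < n"
  show "lower u j holomorphic_on S" unfolding lower_def by (intro holomorphic_intros u1 j)
  fix \<omega> assume \<omega>: "\<omega> \<in> S"
  let ?E = "exp (- \<omega>)" and ?s1 = "\<Sum>l<n. A j l * (\<tau> l * deriv (u l) \<omega>)" and ?s2 = "\<Sum>l<n. A j l * (\<tau> l * deriv (deriv (u l)) \<omega>)"
  let ?L = "deriv (deriv (deriv (u j))) \<omega> - (c + 2) * deriv (deriv (u j)) \<omega> + (d + c + 1) * deriv (u j) \<omega>"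
  let ?R = "\<tau> j * ?E * (deriv (deriv (deriv (u j))) \<omega> - (3 + c) * deriv (deriv (u j)) \<omega>
      - deriv (deriv (u j)) \<omega> + (3 + c) * deriv (u j) \<omega>) + ?E * (?s2 + \<tau> j * deriv (deriv (u j)) \<omega> - ?s1 - \<tau> j * deriv (u j) \<omega>)"
  have "((\<lambda>\<omega>. deriv (deriv (u j)) \<omega> - (c + 2) * deriv (u j) \<omega> + (d + c + 1) * u j \<omega>) has_field_derivative ?L) (at \<omega>)"
    by (intro DERIV_add DERIV_diff DERIV_cmult D j \<omega>)
  then have "((\<lambda>\<omega>. \<tau> j * exp (- \<omega>) * (deriv (deriv (u j)) \<omega> - (3 + c) * deriv (u j) \<omega>) +
        exp (- \<omega>) * ((\<Sum>l<n. A j l * (\<tau> l * deriv (u l) \<omega>)) + \<tau> j * deriv (u j) \<omega>)) has_field_derivative ?L) (at \<omega>)"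
  proof (rule has_field_derivative_transform_within_open[OF _ \<open>open S\<close> \<omega>])
    fix z assume z: "z \<in> S"
    have "(\<Sum>l<n. shift_matrix A 1 j l * \<tau> l * deriv (u l) z) = (\<Sum>l<n. A j l * (\<tau> l * deriv (u l) z)) + \<tau> j * deriv (u j) z"
      using shift_matrix_apply[OF j, of A 1 "\<lambda>l. \<tau> l * deriv (u l) z"] by (simp add: mult_ac)
    moreover have "deriv (deriv (u j)) z - (c + 2) * deriv (u j) z + (d + c + 1) * u j z =
       \<tau> j * exp (- z) * (deriv (deriv (u j)) z - (1 + (c + 2)) * deriv (u j) z)
        + exp (- z) * (\<Sum>l<n. shift_matrix A 1 j l * \<tau> l * deriv (u l) z)"
      using u j z by (simp add: extended_solution_def)
    ultimately show "deriv (deriv (u j)) z - (c + 2) * deriv (u j) z + (d + c + 1) * u j z =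
      \<tau> j * exp (- z) * (deriv (deriv (u j)) z - (3 + c) * deriv (u j) z) +
        exp (- z) * ((\<Sum>l<n. A j l * (\<tau> l * deriv (u l) z)) + \<tau> j * deriv (u j) z)"
      by (simp add: add_ac)
  qed
  moreover have "((\<lambda>\<omega>. \<tau> j * exp (- \<omega>) * (deriv (deriv (u j)) \<omega> - (3 + c) * deriv (u j) \<omega>) +
        exp (- \<omega>) * ((\<Sum>l<n. A j l * (\<tau> l * deriv (u l) \<omega>)) + \<tau> j * deriv (u j) \<omega>)) has_field_derivative ?R) (at \<omega>)"
  proof -
    have s: "((\<lambda>\<omega>. (\<Sum>l<n. A j l * (\<tau> l * deriv (u l) \<omega>)) + \<tau> j * deriv (u j) \<omega>) has_field_derivative
        ?s2 + \<tau> j * deriv (deriv (u j)) \<omega>) (at \<omega>)"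
      by (intro DERIV_add DERIV_sum DERIV_cmult D j \<omega>) auto
    show ?thesis
      by (rule derivative_eq_intros s D j \<omega> refl | simp)+ (simp add: algebra_simps)
  qed
  ultimately have LR: "?L = ?R" by (rule DERIV_unique)
  have s: "(\<Sum>l<n. A j l * \<tau> l * deriv (lower u l) \<omega>) = - ?E * (?s2 - ?s1)"
    using \<omega> by (simp add: dl sum_distrib_left sum_subtractf right_diff_distrib sum_negf mult_ac)
  have "deriv (deriv (lower u j)) \<omega> - c * deriv (lower u j) \<omega> + d * lower u j \<omega> = - ?E * ?L"
    unfolding dl[OF j \<omega>] ddl[OF j \<omega>] by (simp add: lower_def algebra_simps)
  also have "\<dots> = \<tau> j * ?E * (deriv (deriv (lower u j)) \<omega> - (1 + c) * deriv (lower u j) \<omega>) +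
      ?E * (\<Sum>l<n. A j l * \<tau> l * deriv (lower u l) \<omega>)"
    unfolding LR s dl[OF j \<omega>] ddl[OF j \<omega>] by (simp add: algebra_simps)
  finally show "deriv (deriv (lower u j)) \<omega> - c * deriv (lower u j) \<omega> + d * lower u j \<omega> =
     \<tau> j * ?E * (deriv (deriv (lower u j)) \<omega> - (1 + c) * deriv (lower u j) \<omega>) +
      ?E * (\<Sum>l<n. A j l * \<tau> l * deriv (lower u l) \<omega>)" .
qed

section \<open>Leading coefficients under the shift\<close>

context strip_endpoint
begin

lemma S_ball_nonempty:
  assumes "0 < r"
  shows "S \<inter> ball a r \<noteq> {}"
proof -
  define s where "s = min (r / 2) ((\<beta> - \<alpha>) / 2)"
  have "0 < s" "s \<le> r / 2" "s \<le> (\<beta> - \<alpha>) / 2"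
    unfolding s_def using assms width by (simp, intro min.cobounded1, intro min.cobounded2)
  moreover have "r / 2 < r" "(\<beta> - \<alpha>) / 2 < \<beta> - \<alpha>" using assms width by (simp_all add: field_simps)
  ultimately have s: "0 < s" "s < r" "s < \<beta> - \<alpha>" by linarith+
  have "a + \<i> * of_real s \<in> S \<inter> ball a r \<or> a - \<i> * of_real s \<in> S \<inter> ball a r"
    using endpoint s by (auto simp: S dist_norm norm_mult)
  then show ?thesis by blast
qed

text \<open>Identity theorem: \<open>S\<close> meets every disc about its boundary point
  \<open>a\<close> in a nonempty open set. Relations between holomorphic parts found on
  \<open>S\<close> thereby hold at \<open>a\<close> itself, where leading coefficients are read
  off.\<close>

lemma vanish_on_ball:
  assumes "0 < r" "G holomorphic_on ball a r" "\<And>\<omega>. \<omega> \<in> S \<Longrightarrow> \<omega> \<in> ball a r \<Longrightarrow> G \<omega> = 0" "\<omega> \<in> ball a r"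
  shows "G \<omega> = 0"
  by (rule analytic_continuation_open[of "S \<inter> ball a r" "ball a r" G "\<lambda>_. 0"])
     (use assms S_ball_nonempty open_S in \<open>auto intro: connected_ball\<close>)

text \<open>With f = (\<omega> - a)^lam \<Psi>, comparing derivatives gives lam \<Psi> + (\<omega> -
  a) (\<Psi>' + e^(-\<omega>) \<Phi>) = 0 near \<open>a\<close>. Its value at \<open>a\<close>
  forces \<Psi> a = 0, so one more power splits off; its derivative at \<open>a\<close> determines
  \<Psi>' a, the new leading coefficient.\<close>

lemma branch_at_primitive:
  assumes f: "branch_at S a lam e0 f" and g: "branch_at S a lam e g"
    and df: "\<And>\<omega>. \<omega> \<in> S \<Longrightarrow> (f has_field_derivative - exp (- \<omega>) * g \<omega>) (at \<omega>)"
    and lam: "lam \<noteq> 0" "lam + 1 \<noteq> 0"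
  shows "branch_at S a (lam + 1) (- exp (- a) * e / (lam + 1)) f"
proof -
  obtain r1 \<Phi> where 1: "0 < r1" "\<Phi> holomorphic_on ball a r1" "\<Phi> a = e"
    "\<And>\<omega>. \<omega> \<in> S \<Longrightarrow> \<omega> \<in> ball a r1 \<Longrightarrow> g \<omega> = (\<omega> - a) powr lam * \<Phi> \<omega>"
    using g unfolding branch_at_def by auto
  obtain r2 \<Psi> where 2: "0 < r2" "\<Psi> holomorphic_on ball a r2"
    "\<And>\<omega>. \<omega> \<in> S \<Longrightarrow> \<omega> \<in> ball a r2 \<Longrightarrow> f \<omega> = (\<omega> - a) powr lam * \<Psi> \<omega>"
    using f unfolding branch_at_def by auto
  define r where "r = min r1 r2"
  have r: "0 < r" using 1(1) 2(1) by (simp add: r_def)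
  have hol: "\<Phi> holomorphic_on ball a r" "\<Psi> holomorphic_on ball a r"
    using 1(2) 2(2) by (auto simp: r_def elim!: holomorphic_on_subset)
  have hol': "deriv \<Psi> holomorphic_on ball a r" by (intro holomorphic_deriv hol open_ball)
  let ?G = "\<lambda>\<omega>. lam * \<Psi> \<omega> + (\<omega> - a) * (deriv \<Psi> \<omega> + exp (- \<omega>) * \<Phi> \<omega>)"
  have "?G holomorphic_on ball a r" by (intro holomorphic_intros hol hol')
  moreover have "?G \<omega> = 0" if \<omega>: "\<omega> \<in> S" "\<omega> \<in> ball a r" for \<omega>
  proof -
    have ne: "\<omega> - a \<noteq> 0" using \<omega>(1) a_notin by auto
    have "((\<lambda>\<omega>. \<omega> - a) has_field_derivative 1) (at \<omega>)"
      by (auto intro!: derivative_eq_intros)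
    from DERIV_chain2[where f = "\<lambda>z. z powr lam" and g = "\<lambda>\<omega>. \<omega> - a", OF
          has_field_derivative_powr[OF not_nonpos[OF \<omega>(1)]] this]
    have "((\<lambda>\<omega>. (\<omega> - a) powr lam) has_field_derivative lam * (\<omega> - a) powr (lam - 1)) (at \<omega>)" by simp
    from DERIV_mult[OF this holomorphic_derivI[OF hol(2) open_ball \<omega>(2)]]
    have "((\<lambda>\<omega>. (\<omega> - a) powr lam * \<Psi> \<omega>) has_field_derivative
       lam * (\<omega> - a) powr (lam - 1) * \<Psi> \<omega> + deriv \<Psi> \<omega> * (\<omega> - a) powr lam) (at \<omega>)" .
    then have "(f has_field_derivative lam * (\<omega> - a) powr (lam - 1) * \<Psi> \<omega> + deriv \<Psi> \<omega> * (\<omega> - a) powr lam) (at \<omega>)"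
      by (rule has_field_derivative_transform_within_open[of _ _ _ "S \<inter> ball a r"])
         (use \<omega> 2(3) open_S in \<open>auto simp: r_def\<close>)
    then have "lam * (\<omega> - a) powr (lam - 1) * \<Psi> \<omega> + deriv \<Psi> \<omega> * (\<omega> - a) powr lam =
        - exp (- \<omega>) * ((\<omega> - a) powr lam * \<Phi> \<omega>)"
      using DERIV_unique[OF _ df[OF \<omega>(1)]] 1(4) \<omega> by (simp add: r_def)
    moreover have "(\<omega> - a) powr lam = (\<omega> - a) * (\<omega> - a) powr (lam - 1)"
      using ne by (simp add: powr_diff)
    ultimately have "(\<omega> - a) powr (lam - 1) * ?G \<omega> = 0"
      by (simp add: algebra_simps)
    then show ?thesis using ne by simp
  qed
  ultimately have G: "?G \<omega> = 0" if "\<omega> \<in> ball a r" for \<omega>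
    using vanish_on_ball[OF r, of ?G] that by blast
  have a_in: "a \<in> ball a r" using r by simp
  have \<Psi>a: "\<Psi> a = 0" using G[OF a_in] lam by simp
  have "(?G has_field_derivative (lam + 1) * deriv \<Psi> a + exp (- a) * \<Phi> a) (at a)"
    by (rule derivative_eq_intros holomorphic_derivI[OF hol(1) open_ball a_in] holomorphic_derivI[OF hol(2) open_ball a_in]
       holomorphic_derivI[OF hol' open_ball a_in] refl | simp)+ (simp add: algebra_simps)
  moreover have "(?G has_field_derivative 0) (at a)"
    by (rule has_field_derivative_transform_within_open[OF DERIV_const open_ball a_in]) (simp add: G)
  ultimately have "(lam + 1) * deriv \<Psi> a + exp (- a) * \<Phi> a = 0" by (rule DERIV_unique)
  then have val: "deriv \<Psi> a = - exp (- a) * e / (lam + 1)"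
    using lam 1(3) by (simp add: field_simps add_eq_0_iff2)
  let ?X = "\<lambda>z. if z = a then deriv \<Psi> a else (\<Psi> z - \<Psi> a) / (z - a)"
  have "?X holomorphic_on ball a r" by (intro pole_lemma_open hol open_ball)
  then show ?thesis
  proof (rule branch_atI[OF r])
    fix \<omega> assume \<omega>: "\<omega> \<in> S" "\<omega> \<in> ball a r"
    then have "\<omega> \<noteq> a" using a_notin by auto
    then show "f \<omega> = (\<omega> - a) powr (lam + 1) * ?X \<omega>"
      using 2(3)[OF \<omega>(1)] \<omega>(2) \<Psi>a by (simp add: powr_add r_def)
  qed (simp add: val)
qed

lemma lift_branch:
  assumes w: "underlying_solution n \<tau> A S w" and \<tau>: "\<And>j. j < n \<Longrightarrow> \<tau> j \<noteq> 0"
    and B: "is_inverse n (shift_matrix A 1) B"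
    and wb: "\<And>j. j < n \<Longrightarrow> branch_at S a lam (e j) (w j)" and lam: "lam \<notin> \<int>" and j: "j < n"
  shows "branch_at S a (lam + 1) (- exp (- a) * e j / (lam + 1)) (lift n \<tau> B w j)"
proof (rule branch_at_primitive[OF _ wb[OF j]])
  have "branch_at S a lam (\<Sum>l<n. B j l * ((exp (- a) - 1 / \<tau> l) * e l)) (\<lambda>\<omega>. \<Sum>l<n. B j l * ((exp (- \<omega>) - 1 / \<tau> l) * w l \<omega>))"
    by (intro branch_at_sum branch_at_mult[of _ _ _ _ _ "\<lambda>_. B j _"] branch_at_mult[of _ _ _ _ _ "\<lambda>\<omega>. exp (- \<omega>) - 1 / \<tau> _"]
         wb holomorphic_intros) (auto)
  then show "branch_at S a lam (\<Sum>l<n. B j l * ((exp (- a) - 1 / \<tau> l) * e l)) (lift n \<tau> B w j)"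
    by (simp add: lift_def[abs_def])
  show "lam \<noteq> 0" using lam by auto
  show "lam + 1 \<noteq> 0" using lam by (metis Ints_1 Ints_minus add_eq_0_iff2)
qed (rule lift_derivative[OF w open_S \<tau> B j])

text \<open>The factor lam + 1 of the derivative cancels the divisor introduced by
  \<open>lift\<close>, and the two factors e^(-a) from lifting and lowering reduce e^((c + 2) a) to
  e^(c a). So a shift and its reversal leave no trace in the leading coefficient.\<close>

lemma lower_branch:
  assumes "branch_at S a (lam + 1) (exp ((c + 2) * a) * (- exp (- a) * e / (lam + 1))) (u j)" "lam \<notin> \<int>"
  shows "branch_at S a lam (exp (c * a) * e) (lower u j)"
proof -
  have "lam + 1 \<noteq> 0" using assms(2) by (metis Ints_1 Ints_minus add_eq_0_iff2)
  have "branch_at S a (lam + 1 - 1) (- exp (- a) * ((lam + 1) * (exp ((c + 2) * a) * (- exp (- a) * e / (lam + 1)))))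
     (\<lambda>\<omega>. - exp (- \<omega>) * deriv (u j) \<omega>)"
    by (intro branch_at_mult[of _ _ _ _ _ "\<lambda>\<omega>. - exp (- \<omega>)"] branch_at_deriv assms open_S not_nonpos holomorphic_intros)
  moreover have "- exp (- a) * ((lam + 1) * (exp ((c + 2) * a) * (- exp (- a) * e / (lam + 1)))) =
     (exp (- a) * exp (- a) * exp ((c + 2) * a)) * e"
    using \<open>lam + 1 \<noteq> 0\<close> by (simp add: field_simps)
  moreover have "exp (- a) * exp (- a) * exp ((c + 2) * a) = exp (c * a)"
    by (simp add: exp_add[symmetric] algebra_simps)
  ultimately show ?thesis by (simp add: lower_def[abs_def])
qed

end

context strip_endpoints
begin

text \<open>Induction on the number \<open>m\<close> of shifts that bring all exponents to real part
  above 1. For m = 0 the convolution applies directly. Otherwise the data are lifted to A + 1, with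
  parameters c + 2 and d + c + 1, and the solutions obtained there are lowered; both operations are
  linear and preserve holomorphy at \<open>b\<close>, so the coefficients \<open>cc\<close> stay the
  same. The inverses of A + k for all k >= 1 make repeated lifting possible.\<close>

lemma connection_transfer:
  fixes m :: nat
  assumes \<tau>: "\<And>j. j < n \<Longrightarrow> \<tau> j \<noteq> 0"
    and inv: "\<And>k::nat. 1 \<le> k \<Longrightarrow> \<exists>B. is_inverse n (shift_matrix A (of_nat k)) B"
    and wa: "underlying_solution n \<tau> A S wa" "\<And>j. j < n \<Longrightarrow> branch_at S a la (ea j) (wa j)" "la \<notin> \<int>" "1 < Re la + m"
    and I: "finite I"
    and wb: "\<And>i. i \<in> I \<Longrightarrow> underlying_solution n \<tau> A S (wb i)"
      "\<And>i j. i \<in> I \<Longrightarrow> j < n \<Longrightarrow> branch_at S b (lb i) (eb i j) (wb i j)"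
      "\<And>i. i \<in> I \<Longrightarrow> lb i \<notin> \<int>" "\<And>i. i \<in> I \<Longrightarrow> 1 < Re (lb i) + m"
    and conn: "\<And>j. j < n \<Longrightarrow> extends_at S b (\<lambda>\<omega>. wa j \<omega> - (\<Sum>i\<in>I. cc i * wb i j \<omega>))"
  shows "\<exists>u ub. extended_solution n \<tau> A c d S u \<and> (\<forall>j<n. branch_at S a la (exp (c * a) * ea j) (u j)) \<and>
    (\<forall>i\<in>I. extended_solution n \<tau> A c d S (ub i) \<and> (\<forall>j<n. branch_at S b (lb i) (exp (c * b) * eb i j) (ub i j))) \<and>
    (\<forall>j<n. extends_at S b (\<lambda>\<omega>. u j \<omega> - (\<Sum>i\<in>I. cc i * ub i j \<omega>)))"
  using inv wa wb conn
proof (induction m arbitrary: A c d wa wb la lb ea eb)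
  case 0
  note wa = 0(2-4) 0(5)[simplified] and wb = 0(6-8) 0(9)[simplified] and conn = 0(10)
  obtain K where K: "K holomorphic_on wide_strip" "K 0 = 1"
    "\<And>z. z \<in> wide_strip \<Longrightarrow> deriv (deriv K) z + c * deriv K z + d * K z =
       exp (- z) * (deriv (deriv K) z + (c - 1) * deriv K z - c * K z)"
    using kernel_exists by blast
  let ?u = "A.extension n A c wa K" and ?ub = "\<lambda>i. B.extension n A c (wb i) K"
  have wa_hol: "wa j holomorphic_on S" if "j < n" for j using wa(1) that by (simp add: underlying_solution_def)
  have wb_hol: "wb i j holomorphic_on S" if "i \<in> I" "j < n" for i j using wb(1) that by (simp add: underlying_solution_def)
  have ta: "A.transform K (wa j) holomorphic_on S" if "j < n" for j
    by (rule A.transform_holomorphic[OF wa(1,2,4) K K(1) that])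
  have tb: "B.transform K (wb i j) holomorphic_on S" if "i \<in> I" "j < n" for i j
    using B.transform_holomorphic[OF wb(1) wb(2) wb(4) K K(1)] that by blast
  have y: "extends_at S b (\<lambda>\<omega>. A.transform K (wa j) \<omega> - (\<Sum>i\<in>I. cc i * B.transform K (wb i j) \<omega>))" if "j < n" for j
    by (rule transform_connection[OF K(1) wa_hol wa(2,4) I wb_hol wb(2,4) conn]) (use that in auto)
  have "extends_at S b (\<lambda>\<omega>. ?u j \<omega> - (\<Sum>i\<in>I. cc i * ?ub i j \<omega>))" if j: "j < n" for j
  proof -
    let ?D = "\<lambda>j \<omega>. A.transform K (wa j) \<omega> - (\<Sum>i\<in>I. cc i * B.transform K (wb i j) \<omega>)"
    \<comment> \<open>The operator e^(c \<omega>) (d/d\<omega> + A) is applied to the difference of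
      the convolutions, already known to be holomorphic at \<open>b\<close>.\<close>
    have "extends_at S b (\<lambda>\<omega>. exp (c * \<omega>) * (deriv (?D j) \<omega> + (\<Sum>l<n. A j l * ?D l \<omega>)))"
      by (intro extends_at_mult[of _ _ _ "\<lambda>\<omega>. exp (c * \<omega>)"] extends_at_mult[of _ _ _ "\<lambda>_. A j _"]
           extends_at_add extends_at_sum extends_at_deriv y j A.open_S holomorphic_intros) auto
    then show ?thesis
    proof (rule extends_at_cong)
      fix \<omega> assume \<omega>: "\<omega> \<in> S"
      have "deriv (?D j) \<omega> = deriv (A.transform K (wa j)) \<omega> - (\<Sum>i\<in>I. cc i * deriv (B.transform K (wb i j)) \<omega>)"
        by (intro DERIV_imp_deriv DERIV_diff DERIV_sum DERIV_cmult holomorphic_derivI[OF _ A.open_S \<omega>] ta tb j)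
      moreover have "(\<Sum>l<n. A j l * ?D l \<omega>) = (\<Sum>l<n. A j l * A.transform K (wa l) \<omega>) -
          (\<Sum>i\<in>I. cc i * (\<Sum>l<n. A j l * B.transform K (wb i l) \<omega>))"
        unfolding right_diff_distrib sum_subtractf sum_distrib_left by (subst sum.swap) (simp add: mult_ac)
      ultimately show "exp (c * \<omega>) * (deriv (?D j) \<omega> + (\<Sum>l<n. A j l * ?D l \<omega>)) = ?u j \<omega> - (\<Sum>i\<in>I. cc i * ?ub i j \<omega>)"
        using A.extension_def[OF wa(1,2,4) K] B.extension_def[OF wb(1) wb(2) wb(4) K]
        by (simp add: distrib_left right_diff_distrib sum.distrib sum_distrib_left mult_ac)
    qed
  qed
  then show ?case
    using A.extension_solution[OF wa(1,2,4) K] A.extension_branch[OF wa(1,2,4) K]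
      B.extension_solution[OF wb(1) wb(2) wb(4) K] B.extension_branch[OF wb(1) wb(2) wb(4) K]
    by (intro exI[of _ ?u] exI[of _ ?ub]) blast
next
  case (Suc m)
  note inv = Suc.prems(1) and wa = Suc.prems(2-5) and wb = Suc.prems(6-9) and conn = Suc.prems(10)
  obtain B where B: "is_inverse n (shift_matrix A 1) B" using inv[of 1] by auto
  have sh: "shift_matrix (shift_matrix A 1) (of_nat k) = shift_matrix A (of_nat (Suc k))" for k
    by (auto simp: shift_matrix_def fun_eq_iff)
  have int: "z + 1 \<notin> \<int>" if "z \<notin> \<int>" for z :: complex
    using that by (metis Ints_1 Ints_diff add_diff_cancel_right')
  have "\<exists>u ub. extended_solution n \<tau> (shift_matrix A 1) (c + 2) (d + c + 1) S u \<and>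
    (\<forall>j<n. branch_at S a (la + 1) (exp ((c + 2) * a) * (- exp (- a) * ea j / (la + 1))) (u j)) \<and>
    (\<forall>i\<in>I. extended_solution n \<tau> (shift_matrix A 1) (c + 2) (d + c + 1) S (ub i) \<and>
       (\<forall>j<n. branch_at S b (lb i + 1) (exp ((c + 2) * b) * (- exp (- b) * eb i j / (lb i + 1))) (ub i j))) \<and>
    (\<forall>j<n. extends_at S b (\<lambda>\<omega>. u j \<omega> - (\<Sum>i\<in>I. cc i * ub i j \<omega>)))"
  proof (rule Suc.IH[of "shift_matrix A 1" "lift n \<tau> B wa" "la + 1" _ "\<lambda>i. lift n \<tau> B (wb i)" "\<lambda>i. lb i + 1"])
    show "\<exists>B. is_inverse n (shift_matrix (shift_matrix A 1) (of_nat k)) B" if "1 \<le> k" for k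
      unfolding sh by (rule inv) simp
    show "underlying_solution n \<tau> (shift_matrix A 1) S (lift n \<tau> B wa)"
      by (rule lift_solution[OF wa(1) A.open_S \<tau> B])
    show "\<And>j. j < n \<Longrightarrow> branch_at S a (la + 1) (- exp (- a) * ea j / (la + 1)) (lift n \<tau> B wa j)"
      by (rule A.lift_branch[OF wa(1) \<tau> B wa(2,3)])
    show "\<And>i. i \<in> I \<Longrightarrow> underlying_solution n \<tau> (shift_matrix A 1) S (lift n \<tau> B (wb i))"
      by (rule lift_solution[OF wb(1) A.open_S \<tau> B])
    show "\<And>i j. i \<in> I \<Longrightarrow> j < n \<Longrightarrow> branch_at S b (lb i + 1) (- exp (- b) * eb i j / (lb i + 1)) (lift n \<tau> B (wb i) j)"
      by (rule B.lift_branch[OF wb(1) \<tau> B wb(2,3)])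
    fix j assume j: "j < n"
    have "extends_at S b (\<lambda>\<omega>. \<Sum>l<n. B j l * ((exp (- \<omega>) - 1 / \<tau> l) * (wa l \<omega> - (\<Sum>i\<in>I. cc i * wb i l \<omega>))))"
      by (intro extends_at_sum extends_at_mult[of _ _ _ "\<lambda>_. B j _"] extends_at_mult[of _ _ _ "\<lambda>\<omega>. exp (- \<omega>) - 1 / \<tau> _"]
          conn holomorphic_intros) auto
    then show "extends_at S b (\<lambda>\<omega>. lift n \<tau> B wa j \<omega> - (\<Sum>i\<in>I. cc i * lift n \<tau> B (wb i) j \<omega>))"
    proof (rule extends_at_cong)
      fix \<omega>
      show "(\<Sum>l<n. B j l * ((exp (- \<omega>) - 1 / \<tau> l) * (wa l \<omega> - (\<Sum>i\<in>I. cc i * wb i l \<omega>)))) =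
        lift n \<tau> B wa j \<omega> - (\<Sum>i\<in>I. cc i * lift n \<tau> B (wb i) j \<omega>)"
        unfolding lift_def right_diff_distrib sum_subtractf sum_distrib_left
        by (subst sum.swap) (simp add: mult_ac)
    qed
  qed (use wa(3,4) wb(3,4) int in auto)
  then obtain u ub where u: "extended_solution n \<tau> (shift_matrix A 1) (c + 2) (d + c + 1) S u"
    "\<And>j. j < n \<Longrightarrow> branch_at S a (la + 1) (exp ((c + 2) * a) * (- exp (- a) * ea j / (la + 1))) (u j)"
    and ub: "\<And>i. i \<in> I \<Longrightarrow> extended_solution n \<tau> (shift_matrix A 1) (c + 2) (d + c + 1) S (ub i)"
    "\<And>i j. i \<in> I \<Longrightarrow> j < n \<Longrightarrow> branch_at S b (lb i + 1) (exp ((c + 2) * b) * (- exp (- b) * eb i j / (lb i + 1))) (ub i j)"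
    and ext: "\<And>j. j < n \<Longrightarrow> extends_at S b (\<lambda>\<omega>. u j \<omega> - (\<Sum>i\<in>I. cc i * ub i j \<omega>))"
    by blast
  have u_hol: "u j holomorphic_on S" if "j < n" for j using u(1) that by (simp add: extended_solution_def)
  have ub_hol: "ub i j holomorphic_on S" if "i \<in> I" "j < n" for i j using ub(1) that by (simp add: extended_solution_def)
  have "extends_at S b (\<lambda>\<omega>. lower u j \<omega> - (\<Sum>i\<in>I. cc i * lower (ub i) j \<omega>))" if j: "j < n" for j
  proof -
    have "extends_at S b (\<lambda>\<omega>. - exp (- \<omega>) * deriv (\<lambda>\<omega>. u j \<omega> - (\<Sum>i\<in>I. cc i * ub i j \<omega>)) \<omega>)"
      by (intro extends_at_mult[of _ _ _ "\<lambda>\<omega>. - exp (- \<omega>)"] extends_at_deriv ext j A.open_S holomorphic_intros)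
    then show ?thesis
    proof (rule extends_at_cong)
      fix \<omega> assume \<omega>: "\<omega> \<in> S"
      have "deriv (\<lambda>\<omega>. u j \<omega> - (\<Sum>i\<in>I. cc i * ub i j \<omega>)) \<omega> = deriv (u j) \<omega> - (\<Sum>i\<in>I. cc i * deriv (ub i j) \<omega>)"
        by (intro DERIV_imp_deriv DERIV_diff DERIV_sum DERIV_cmult holomorphic_derivI[OF _ A.open_S \<omega>] u_hol ub_hol j)
      then show "- exp (- \<omega>) * deriv (\<lambda>\<omega>. u j \<omega> - (\<Sum>i\<in>I. cc i * ub i j \<omega>)) \<omega> =
          lower u j \<omega> - (\<Sum>i\<in>I. cc i * lower (ub i) j \<omega>)"
        by (simp add: lower_def right_diff_distrib sum_distrib_left sum_negf mult_ac)
    qed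
  qed
  moreover have "branch_at S a la (exp (c * a) * ea j) (lower u j)" if "j < n" for j
    by (rule A.lower_branch[of la c "ea j" u j, OF u(2)[OF that] wa(3)])
  moreover have "branch_at S b (lb i) (exp (c * b) * eb i j) (lower (ub i) j)" if "i \<in> I" "j < n" for i j
    by (rule B.lower_branch[of "lb i" c "eb i j" "ub i" j, OF ub(2)[OF that] wb(3)[OF that(1)]])
  ultimately show ?case
    using lower_solution[OF u(1) A.open_S] lower_solution[OF ub(1) A.open_S]
    by (intro exI[of _ "lower u"] exI[of _ "\<lambda>i. lower (ub i)"]) blast
qed

end

section \<open>Uniqueness of the local solutions\<close>

lemma extended_solution_diff:
  assumes u: "extended_solution n \<tau> A c d S u" and v: "extended_solution n \<tau> A c d S v" and "open S"
  shows "extended_solution n \<tau> A c d S (\<lambda>j \<omega>. u j \<omega> - k * v j \<omega>)"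
  unfolding extended_solution_def
proof (intro allI impI conjI ballI)
  have u0: "u j holomorphic_on S" if "j < n" for j using u that by (simp add: extended_solution_def)
  have v0: "v j holomorphic_on S" if "j < n" for j using v that by (simp add: extended_solution_def)
  have u1: "deriv (u j) holomorphic_on S" if "j < n" for j by (intro holomorphic_deriv u0 that \<open>open S\<close>)
  have v1: "deriv (v j) holomorphic_on S" if "j < n" for j by (intro holomorphic_deriv v0 that \<open>open S\<close>)
  have d1: "deriv (\<lambda>\<omega>. u j \<omega> - k * v j \<omega>) \<omega> = deriv (u j) \<omega> - k * deriv (v j) \<omega>" if "j < n" "\<omega> \<in> S" for j \<omega>
    by (intro DERIV_imp_deriv DERIV_diff DERIV_cmult holomorphic_derivI[OF _ \<open>open S\<close>] u0 v0 that)
  have d2: "deriv (deriv (\<lambda>\<omega>. u j \<omega> - k * v j \<omega>)) \<omega> = deriv (deriv (u j)) \<omega> - k * deriv (deriv (v j)) \<omega>" if "j < n" "\<omega> \<in> S" for j \<omega>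
  proof -
    have "deriv (deriv (\<lambda>\<omega>. u j \<omega> - k * v j \<omega>)) \<omega> = deriv (\<lambda>\<omega>. deriv (u j) \<omega> - k * deriv (v j) \<omega>) \<omega>"
      by (rule deriv_cong_on[OF \<open>open S\<close> that(2)]) (rule d1[OF that(1)])
    also have "\<dots> = deriv (deriv (u j)) \<omega> - k * deriv (deriv (v j)) \<omega>"
      by (intro DERIV_imp_deriv DERIV_diff DERIV_cmult holomorphic_derivI[OF _ \<open>open S\<close>] u1 v1 that)
    finally show ?thesis .
  qed
  fix j assume j: "j < n"
  show "(\<lambda>\<omega>. u j \<omega> - k * v j \<omega>) holomorphic_on S" by (intro holomorphic_intros u0 v0 j)
  fix \<omega> assume \<omega>: "\<omega> \<in> S"
  define U0 U1 U2 Us V0 V1 V2 Vs where defs: "U0 = u j \<omega>" "U1 = deriv (u j) \<omega>" "U2 = deriv (deriv (u j)) \<omega>"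
    "Us = (\<Sum>l<n. A j l * \<tau> l * deriv (u l) \<omega>)" "V0 = v j \<omega>" "V1 = deriv (v j) \<omega>" "V2 = deriv (deriv (v j)) \<omega>"
    "Vs = (\<Sum>l<n. A j l * \<tau> l * deriv (v l) \<omega>)"
  have U: "U2 - c * U1 + d * U0 = \<tau> j * exp (- \<omega>) * (U2 - (1 + c) * U1) + exp (- \<omega>) * Us"
    using u j \<omega> unfolding extended_solution_def defs by blast
  have V: "V2 - c * V1 + d * V0 = \<tau> j * exp (- \<omega>) * (V2 - (1 + c) * V1) + exp (- \<omega>) * Vs"
    using v j \<omega> unfolding extended_solution_def defs by blast
  have s: "(\<Sum>l<n. A j l * \<tau> l * deriv (\<lambda>\<omega>. u l \<omega> - k * v l \<omega>) \<omega>) = Us - k * Vs"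
    unfolding defs sum_distrib_left sum_subtractf[symmetric]
    by (rule sum.cong) (use \<omega> in \<open>auto simp: d1 algebra_simps\<close>)
  have "(U2 - k * V2) - c * (U1 - k * V1) + d * (U0 - k * V0) = (U2 - c * U1 + d * U0) - k * (V2 - c * V1 + d * V0)"
    by (simp add: algebra_simps)
  also have "\<dots> = \<tau> j * exp (- \<omega>) * ((U2 - k * V2) - (1 + c) * (U1 - k * V1)) + exp (- \<omega>) * (Us - k * Vs)"
    unfolding U V by (simp add: algebra_simps)
  finally show "deriv (deriv (\<lambda>\<omega>. u j \<omega> - k * v j \<omega>)) \<omega> - c * deriv (\<lambda>\<omega>. u j \<omega> - k * v j \<omega>) \<omega> + d * (u j \<omega> - k * v j \<omega>) =
     \<tau> j * exp (- \<omega>) * (deriv (deriv (\<lambda>\<omega>. u j \<omega> - k * v j \<omega>)) \<omega> - (1 + c) * deriv (\<lambda>\<omega>. u j \<omega> - k * v j \<omega>) \<omega>) +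
     exp (- \<omega>) * (\<Sum>l<n. A j l * \<tau> l * deriv (\<lambda>\<omega>. u l \<omega> - k * v l \<omega>) \<omega>)"
    unfolding s d1[OF j \<omega>] d2[OF j \<omega>] by (simp add: defs)
qed

context strip_endpoint
begin

lemma branch_at_zero_coefficient:
  assumes "branch_at S a lam e f" "\<And>\<omega>. \<omega> \<in> S \<Longrightarrow> f \<omega> = 0"
  shows "e = 0"
  using assms(1)
proof (rule branch_atE)
  fix r \<Phi> assume *: "0 < r" "\<Phi> holomorphic_on ball a r" "\<Phi> a = e"
    "\<And>\<omega>. \<omega> \<in> S \<Longrightarrow> \<omega> \<in> ball a r \<Longrightarrow> f \<omega> = (\<omega> - a) powr lam * \<Phi> \<omega>"
  have "\<Phi> \<omega> = 0" if "\<omega> \<in> S" "\<omega> \<in> ball a r" for \<omega>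
    using *(4)[OF that] assms(2)[OF that(1)] that(1) a_notin by auto
  then have "\<Phi> a = 0" using vanish_on_ball[OF *(1,2)] *(1) by simp
  then show ?thesis using *(3) by simp
qed

lemma branch_at_mult_diff:
  assumes "branch_at S a lam e f"
  shows "branch_at S a (lam + 1) e (\<lambda>\<omega>. (\<omega> - a) * f \<omega>)"
  using assms
proof (rule branch_atE)
  fix r \<Phi> assume *: "0 < r" "\<Phi> holomorphic_on ball a r" "\<Phi> a = e"
    "\<And>\<omega>. \<omega> \<in> S \<Longrightarrow> \<omega> \<in> ball a r \<Longrightarrow> f \<omega> = (\<omega> - a) powr lam * \<Phi> \<omega>"
  show ?thesis
    by (rule branch_atI[OF *(1,2,3)]) (use * a_notin in \<open>auto simp: powr_add\<close>)
qed

lemma branch_at_divide: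
  assumes "branch_at S a lam 0 f"
  shows "\<exists>e. branch_at S a (lam + 1) e f"
  using assms
proof (rule branch_atE)
  fix r \<Phi> assume *: "0 < r" "\<Phi> holomorphic_on ball a r" "\<Phi> a = 0"
    "\<And>\<omega>. \<omega> \<in> S \<Longrightarrow> \<omega> \<in> ball a r \<Longrightarrow> f \<omega> = (\<omega> - a) powr lam * \<Phi> \<omega>"
  let ?X = "\<lambda>z. if z = a then deriv \<Phi> a else (\<Phi> z - \<Phi> a) / (z - a)"
  have "branch_at S a (lam + 1) (?X a) f"
  proof (rule branch_atI[OF *(1)])
    show "?X holomorphic_on ball a r" by (intro pole_lemma_open * open_ball)
    fix \<omega> assume \<omega>: "\<omega> \<in> S" "\<omega> \<in> ball a r"
    then have "\<omega> \<noteq> a" using a_notin by auto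
    then show "f \<omega> = (\<omega> - a) powr (lam + 1) * ?X \<omega>"
      using *(4)[OF \<omega>] *(3) by (simp add: powr_add)
  qed simp
  then show ?thesis by blast
qed

text \<open>The coefficient of the lowest power in the equation is \<open>mu (mu - \<Lambda> j) (e j)\<close> if \<open>\<tau> j = exp a\<close>, and a nonzero
  multiple of \<open>mu (mu - 1) (e j)\<close> otherwise.\<close>

lemma leading_coefficient_zero:
  assumes u: "extended_solution n \<tau> A c d S u" and ub: "\<And>j. j < n \<Longrightarrow> branch_at S a mu (e j) (u j)"
    and diag: "\<And>j l. j < n \<Longrightarrow> l < n \<Longrightarrow> \<tau> j = exp a \<Longrightarrow> \<tau> l = exp a \<Longrightarrow> A j l = (if j = l then \<Lambda> j else 0)"
    and mu: "mu \<notin> \<int>" "\<And>j. j < n \<Longrightarrow> \<tau> j = exp a \<Longrightarrow> mu \<noteq> \<Lambda> j"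
    and j: "j < n"
  shows "e j = 0"
proof -
  have mu0: "mu \<noteq> 0" "mu - 1 \<noteq> 0" using mu(1) by auto
  note D = branch_at_deriv[OF ub open_S not_nonpos]
  note D2 = branch_at_deriv[OF D open_S not_nonpos]
  have R0: "branch_at S a (mu - 1) 0 (u j)" if "j < n" for j
    using branch_at_raise[of S a "mu - 1" "e j" "u j"] ub[OF that] a_notin by simp
  have R1: "branch_at S a (mu - 1 - 1) 0 (u j)" if "j < n" for j
    using branch_at_raise[of S a "mu - 1 - 1" 0 "u j"] R0[OF that] a_notin by simp
  have R2: "branch_at S a (mu - 1 - 1) 0 (deriv (u j))" if "j < n" for j
    using branch_at_raise[of S a "mu - 1 - 1" _ "deriv (u j)"] D[OF that] a_notin by simp
  have ode: "(1 - \<tau> j * exp (- \<omega>)) * deriv (deriv (u j)) \<omega> + (\<tau> j * (1 + c) * exp (- \<omega>) - c) * deriv (u j) \<omega> + d * u j \<omega>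
      + (\<Sum>l<n. (- A j l * \<tau> l * exp (- \<omega>)) * deriv (u l) \<omega>) = 0" if "j < n" "\<omega> \<in> S" for j \<omega>
  proof -
    have "deriv (deriv (u j)) \<omega> - c * deriv (u j) \<omega> + d * u j \<omega> =
        \<tau> j * exp (- \<omega>) * (deriv (deriv (u j)) \<omega> - (1 + c) * deriv (u j) \<omega>)
        + exp (- \<omega>) * (\<Sum>l<n. A j l * \<tau> l * deriv (u l) \<omega>)"
      using u that by (simp add: extended_solution_def)
    moreover have "(\<Sum>l<n. (- A j l * \<tau> l * exp (- \<omega>)) * deriv (u l) \<omega>) = - exp (- \<omega>) * (\<Sum>l<n. A j l * \<tau> l * deriv (u l) \<omega>)"
      by (simp add: sum_distrib_left sum_negf mult_ac)
    ultimately show ?thesis by (simp add: algebra_simps)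
  qed
  \<comment> \<open>For \<tau>_j different from e^a the coefficient of u_j'' does not vanish at
    \<open>a\<close>. At exponent mu - 2 this term stands alone, since u_j and all the u_l' start
    later.\<close>
  have off: "e j = 0" if j: "j < n" "\<tau> j \<noteq> exp a" for j
  proof -
    have "branch_at S a (mu - 1 - 1) ((1 - \<tau> j * exp (- a)) * ((mu - 1) * (mu * e j)) + (\<tau> j * (1 + c) * exp (- a) - c) * 0 + d * 0
       + (\<Sum>l<n. (- A j l * \<tau> l * exp (- a)) * 0))
       (\<lambda>\<omega>. (1 - \<tau> j * exp (- \<omega>)) * deriv (deriv (u j)) \<omega> + (\<tau> j * (1 + c) * exp (- \<omega>) - c) * deriv (u j) \<omega> + d * u j \<omega>
      + (\<Sum>l<n. (- A j l * \<tau> l * exp (- \<omega>)) * deriv (u l) \<omega>))"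
      by (intro branch_at_add branch_at_sum branch_at_mult[of _ _ _ _ _ "\<lambda>\<omega>. 1 - \<tau> j * exp (- \<omega>)"]
        branch_at_mult[of _ _ _ _ _ "\<lambda>\<omega>. \<tau> j * (1 + c) * exp (- \<omega>) - c"] branch_at_mult[of _ _ _ _ _ "\<lambda>\<omega>. d"]
        branch_at_mult[of _ _ _ _ _ "\<lambda>\<omega>. - A j _ * \<tau> _ * exp (- \<omega>)"] D2 R1 R2 j holomorphic_intros) auto
    from branch_at_zero_coefficient[OF this ode[OF j(1)]]
    have "(1 - \<tau> j * exp (- a)) * ((mu - 1) * (mu * e j)) = 0" by simp
    moreover have "1 - \<tau> j * exp (- a) \<noteq> 0" using j(2) by (auto simp: exp_minus field_simps)
    ultimately show ?thesis using mu0 by simp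
  qed
  show ?thesis
  proof (cases "\<tau> j = exp a")
    case True
    obtain g :: "complex \<Rightarrow> complex" where g: "g holomorphic_on UNIV" "g 0 = 1" "\<And>z. 1 - exp (- z) = z * g z"
      using exp_difference_factor by blast
    have g': "(\<lambda>\<omega>. g (\<omega> - a)) holomorphic_on UNIV"
    proof -
      have "(\<lambda>\<omega>. \<omega> - a) holomorphic_on UNIV" by (intro holomorphic_intros)
      from holomorphic_on_compose_gen[OF this g(1)] show ?thesis by (simp add: o_def)
    qed
    \<comment> \<open>Here the coefficient of u_j'' has a simple zero at \<open>a\<close>, so u_j''
      and the first derivatives meet at exponent mu - 1. As \<tau>_j e^(-a) = 1, their sum is ((mu -
      1) mu + mu - mu \<Lambda>_j) e_j.\<close>
    have fac: "1 - \<tau> j * exp (- \<omega>) = (\<omega> - a) * g (\<omega> - a)" for \<omega>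
      using g(3)[of "\<omega> - a"] True by (simp add: exp_diff exp_minus field_simps)
    have D2': "branch_at S a (mu - 1) ((mu - 1) * (mu * e j)) (\<lambda>\<omega>. (\<omega> - a) * deriv (deriv (u j)) \<omega>)"
      using branch_at_mult_diff[OF D2[OF j]] by simp
    have "branch_at S a (mu - 1) (g (a - a) * ((mu - 1) * (mu * e j)) + (\<tau> j * (1 + c) * exp (- a) - c) * (mu * e j) + d * 0
       + (\<Sum>l<n. (- A j l * \<tau> l * exp (- a)) * (mu * e l)))
       (\<lambda>\<omega>. g (\<omega> - a) * ((\<omega> - a) * deriv (deriv (u j)) \<omega>) + (\<tau> j * (1 + c) * exp (- \<omega>) - c) * deriv (u j) \<omega> + d * u j \<omega>
      + (\<Sum>l<n. (- A j l * \<tau> l * exp (- \<omega>)) * deriv (u l) \<omega>))"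
      by (intro branch_at_add branch_at_sum branch_at_mult[of _ _ _ _ _ "\<lambda>\<omega>. g (\<omega> - a)"]
        branch_at_mult[of _ _ _ _ _ "\<lambda>\<omega>. \<tau> j * (1 + c) * exp (- \<omega>) - c"] branch_at_mult[of _ _ _ _ _ "\<lambda>\<omega>. d"]
        branch_at_mult[of _ _ _ _ _ "\<lambda>\<omega>. - A j _ * \<tau> _ * exp (- \<omega>)"] D2' D R0 j g' holomorphic_intros) auto
    then have "g (a - a) * ((mu - 1) * (mu * e j)) + (\<tau> j * (1 + c) * exp (- a) - c) * (mu * e j) + d * 0
       + (\<Sum>l<n. (- A j l * \<tau> l * exp (- a)) * (mu * e l)) = 0"
    proof (rule branch_at_zero_coefficient)
      fix \<omega> assume "\<omega> \<in> S"
      from ode[OF j this] show "g (\<omega> - a) * ((\<omega> - a) * deriv (deriv (u j)) \<omega>) + (\<tau> j * (1 + c) * exp (- \<omega>) - c) * deriv (u j) \<omega> + d * u j \<omega>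
        + (\<Sum>l<n. (- A j l * \<tau> l * exp (- \<omega>)) * deriv (u l) \<omega>) = 0"
        unfolding fac by (simp add: mult_ac)
    qed
    moreover have "(\<Sum>l<n. (- A j l * \<tau> l * exp (- a)) * (mu * e l)) = - \<Lambda> j * (mu * e j)"
    proof -
      \<comment> \<open>An index l with \<tau>_l different from e^a has e_l = 0 by
        \<open>off\<close>; within the block of j the matrix is diagonal. Only l = j
        remains.\<close>
      have "(\<Sum>l<n. (- A j l * \<tau> l * exp (- a)) * (mu * e l)) = (\<Sum>l<n. (if j = l then 1 else 0) * (- \<Lambda> j * (mu * e l)))"
      proof (rule sum.cong)
        fix l assume l: "l \<in> {..<n}"
        show "(- A j l * \<tau> l * exp (- a)) * (mu * e l) = (if j = l then 1 else 0) * (- \<Lambda> j * (mu * e l))"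
          using diag[OF j _ True, of l] l off[of l] by (cases "\<tau> l = exp a") (auto simp: exp_minus)
      qed simp
      then show ?thesis using sum_times_delta[OF j, of "\<lambda>l. - \<Lambda> j * (mu * e l)"] by simp
    qed
    ultimately have "mu * ((mu - \<Lambda> j) * e j) = 0"
      using True by (simp add: g(2) exp_minus algebra_simps)
    then show ?thesis using mu0 mu(2)[OF j True] by simp
  qed (rule off[OF j])
qed

text \<open>If \<Phi> were not identically zero near \<open>a\<close>, it would have a zero of
  finite order m there, while the representation of \<open>f\<close> with exponent lam + m + 1 makes
  it divisible by one power more. Hence \<Phi> vanishes near \<open>a\<close>, and \<open>f\<close>
  on the connected set \<open>S\<close>.\<close>

lemma branch_at_flat:
  assumes f: "branch_at S a lam 0 f" "f holomorphic_on S"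
    and flat: "\<And>k::nat. \<exists>e. branch_at S a (lam + of_nat k) e f" and \<omega>: "\<omega> \<in> S"
  shows "f \<omega> = 0"
proof -
  obtain r \<Phi> where *: "0 < r" "\<Phi> holomorphic_on ball a r" "\<Phi> a = 0"
    "\<And>\<omega>. \<omega> \<in> S \<Longrightarrow> \<omega> \<in> ball a r \<Longrightarrow> f \<omega> = (\<omega> - a) powr lam * \<Phi> \<omega>"
    using f(1) unfolding branch_at_def by auto
  have a_in: "a \<in> ball a r" using *(1) by simp
  have "(deriv ^^ k) \<Phi> a = 0" for k
  proof (rule ccontr)
    assume "(deriv ^^ k) \<Phi> a \<noteq> 0"
    then obtain m where m: "(deriv ^^ m) \<Phi> a \<noteq> 0" "\<And>i. i < m \<Longrightarrow> (deriv ^^ i) \<Phi> a = 0"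
      using exists_least_iff[of "\<lambda>m. (deriv ^^ m) \<Phi> a \<noteq> 0"] by blast
    have "0 < m" using m(1) *(3) by (cases m) auto
    then obtain g r1 where g: "0 < r1" "g holomorphic_on ball a r1"
        "\<And>w. w \<in> ball a r1 \<Longrightarrow> \<Phi> w - \<Phi> a = (w - a) ^ m * g w" "\<And>w. w \<in> ball a r1 \<Longrightarrow> g w \<noteq> 0"
      using holomorphic_factor_order_of_zero[OF *(2) open_ball a_in _ m(1)] m(2) by metis
    obtain r2 \<Psi> where \<Psi>: "0 < r2" "\<Psi> holomorphic_on ball a r2"
      "\<And>\<omega>. \<omega> \<in> S \<Longrightarrow> \<omega> \<in> ball a r2 \<Longrightarrow> f \<omega> = (\<omega> - a) powr (lam + of_nat (Suc m)) * \<Psi> \<omega>"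
      using flat[of "Suc m"] unfolding branch_at_def by auto
    define s where "s = min r (min r1 r2)"
    have s: "0 < s" using *(1) g(1) \<Psi>(1) by (simp add: s_def)
    have "(\<lambda>w. g w - (w - a) * \<Psi> w) holomorphic_on ball a s"
      using g(2) \<Psi>(2) by (auto simp: s_def intro!: holomorphic_intros elim!: holomorphic_on_subset)
    moreover have "g w - (w - a) * \<Psi> w = 0" if w: "w \<in> S" "w \<in> ball a s" for w
    proof -
      have ne: "w - a \<noteq> 0" using w(1) a_notin by auto
      have "(w - a) powr lam * ((w - a) ^ m * g w) = (w - a) powr (lam + of_nat (Suc m)) * \<Psi> w"
        using *(3) *(4)[OF w(1)] g(3)[of w] \<Psi>(3)[OF w(1)] w(2) by (simp add: s_def)
      also have "(w - a) powr (lam + of_nat (Suc m)) = (w - a) powr lam * (w - a) ^ Suc m"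
        using ne powr_nat[of "w - a" "Suc m"] by (simp only: powr_add)  simp
      finally show ?thesis using ne by simp
    qed
    ultimately have "g a - (a - a) * \<Psi> a = 0"
      using vanish_on_ball[OF s, of "\<lambda>w. g w - (w - a) * \<Psi> w" a] s by simp
    then show False using g(4)[of a] g(1) by simp
  qed
  then have \<Phi>0: "\<Phi> w = 0" if "w \<in> ball a r" for w
    using holomorphic_fun_eq_0_on_ball[OF *(2) that] by blast
  show ?thesis
    by (rule analytic_continuation_open[of "S \<inter> ball a r" S f "\<lambda>_. 0"])
       (use f(2) \<omega> open_S convex_S S_ball_nonempty[OF *(1)] *(4) \<Phi>0 in \<open>auto intro: convex_connected\<close>)
qed

text \<open>The leading coefficient is removed at lam, lam + 1, lam + 2, ... in turn: none of the
  later exponents is an integer or equals a \<Lambda>_j of the block, so the indicial factor does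
  not vanish. At lam itself it may vanish, namely for lam = \<Lambda>_j, and there the coefficient
  is 0 by assumption. A solution vanishing to infinite order is zero.\<close>

lemma extended_solution_zero:
  assumes u: "extended_solution n \<tau> A c d S u" and ub: "\<And>j. j < n \<Longrightarrow> branch_at S a lam 0 (u j)"
    and diag: "\<And>j l. j < n \<Longrightarrow> l < n \<Longrightarrow> \<tau> j = exp a \<Longrightarrow> \<tau> l = exp a \<Longrightarrow> A j l = (if j = l then \<Lambda> j else 0)"
    and lam: "lam \<notin> \<int>" "\<And>j. j < n \<Longrightarrow> \<tau> j = exp a \<Longrightarrow> lam = \<Lambda> j \<or> lam - \<Lambda> j \<notin> \<int>"
    and j: "j < n" and \<omega>: "\<omega> \<in> S"
  shows "u j \<omega> = 0"
proof -
  have *: "\<exists>e. \<forall>j<n. branch_at S a (lam + of_nat k) (e j) (u j) \<and> e j = 0" for k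
  proof (induction k)
    case 0
    then show ?case using ub by (intro exI[of _ "\<lambda>_. 0"]) simp
  next
    case (Suc k)
    then have "\<forall>j<n. \<exists>e. branch_at S a (lam + of_nat k + 1) e (u j)"
      using branch_at_divide by metis
    then obtain e where e: "\<And>j. j < n \<Longrightarrow> branch_at S a (lam + of_nat (Suc k)) (e j) (u j)"
      by (metis add.assoc add.commute of_nat_Suc)
    have "e j = 0" if "j < n" for j
    proof (rule leading_coefficient_zero[OF u e diag _ _ that])
      show "lam + of_nat (Suc k) \<notin> \<int>"
        using lam(1) by (metis Ints_diff Ints_of_nat add_diff_cancel_right')
      show "lam + of_nat (Suc k) \<noteq> \<Lambda> j" if j: "j < n" "\<tau> j = exp a" for j
      proof
        assume "lam + of_nat (Suc k) = \<Lambda> j"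
        then have "lam - \<Lambda> j = - of_nat (Suc k)" by (simp add: algebra_simps)
        moreover have "lam \<noteq> \<Lambda> j" using \<open>lam + of_nat (Suc k) = \<Lambda> j\<close>
          by (metis add_cancel_right_right of_nat_eq_0_iff nat.distinct(2))
        ultimately show False using lam(2)[OF j] by (metis Ints_minus Ints_of_nat)
      qed
    qed
    then show ?case using e by blast
  qed
  have "\<exists>e. branch_at S a (lam + of_nat k) e (u j)" for k using *[of k] j by blast
  moreover have "u j holomorphic_on S" using u j by (simp add: extended_solution_def)
  ultimately show ?thesis using branch_at_flat[OF ub[OF j] _ _ \<omega>] by blast
qed

end

section \<open>The logarithmic coordinate\<close>

lemma holomorphic_derivative_compose:
  assumes F: "F holomorphic_on U" and U: "open U" "\<psi> \<omega> \<in> U" and \<psi>: "(\<psi> has_field_derivative D) (at \<omega>)"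
  shows "((\<lambda>\<omega>. F (\<psi> \<omega>)) has_field_derivative deriv F (\<psi> \<omega>) * D) (at \<omega>)"
  by (rule DERIV_chain2[OF holomorphic_derivI[OF F U] \<psi>])

text \<open>
  Put \<open>p = (1 - \<tau> e\<^bsup>-\<omega>\<^esup>) u' = A u + P v\<close>. By \<open>A P = P D\<close> the second equation becomes
  \<open>p' = A (u' - p) + c p - d u\<close>, in which \<open>u' - p = \<tau> e\<^bsup>-\<omega>\<^esup> u'\<close>.
\<close>

lemma extended_solution_of_system:
  fixes A P Q :: "nat \<Rightarrow> nat \<Rightarrow> complex"
  assumes AP: "\<And>j l. j < n \<Longrightarrow> l < n \<Longrightarrow> (\<Sum>i<n. A j i * P i l) = P j l * D l"
    and PQ: "\<And>j l. j < n \<Longrightarrow> l < n \<Longrightarrow> (\<Sum>i<n. P j i * Q i l) = (if j = l then 1 else 0)"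
    and "open S" and u: "\<And>j. j < n \<Longrightarrow> u j holomorphic_on S" and v: "\<And>j. j < n \<Longrightarrow> v j holomorphic_on S"
    and eq1: "\<And>j \<omega>. j < n \<Longrightarrow> \<omega> \<in> S \<Longrightarrow>
      (1 - \<tau> j * exp (- \<omega>)) * deriv (u j) \<omega> = (\<Sum>l<n. A j l * u l \<omega>) + (\<Sum>l<n. P j l * v l \<omega>)"
    and eq2: "\<And>j \<omega>. j < n \<Longrightarrow> \<omega> \<in> S \<Longrightarrow>
      deriv (v j) \<omega> = - ((D j - \<rho>1) * (D j - \<rho>2)) * (\<Sum>l<n. Q j l * u l \<omega>) + (\<rho>1 + \<rho>2 - D j) * v j \<omega>"
  shows "extended_solution n \<tau> A (\<rho>1 + \<rho>2) (\<rho>1 * \<rho>2) S u"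
  unfolding extended_solution_def
proof (intro allI impI conjI ballI)
  have AP': "(\<Sum>l<n. P j l * (D l * y l)) = (\<Sum>i<n. A j i * (\<Sum>l<n. P i l * y l))" if "j < n" for j y
  proof -
    have "(\<Sum>i<n. A j i * (\<Sum>l<n. P i l * y l)) = (\<Sum>l<n. (\<Sum>i<n. A j i * P i l) * y l)"
      unfolding sum_distrib_left sum_distrib_right by (subst sum.swap) (simp add: mult_ac)
    also have "\<dots> = (\<Sum>l<n. P j l * (D l * y l))"
      by (rule sum.cong) (use AP that in auto)
    finally show ?thesis by simp
  qed
  have PQ': "(\<Sum>l<n. P j l * (\<Sum>i<n. Q l i * y i)) = y j" if "j < n" for j y
  proof -
    have "(\<Sum>l<n. P j l * (\<Sum>i<n. Q l i * y i)) = (\<Sum>i<n. (\<Sum>l<n. P j l * Q l i) * y i)"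
      unfolding sum_distrib_left sum_distrib_right by (subst sum.swap) (simp add: mult_ac)
    also have "\<dots> = (\<Sum>i<n. (if j = i then 1 else 0) * y i)"
      by (rule sum.cong) (use PQ that in auto)
    finally show ?thesis using sum_times_delta[OF that] by simp
  qed
  have u1: "deriv (u j) holomorphic_on S" if "j < n" for j by (intro holomorphic_deriv u that \<open>open S\<close>)
  fix j assume j: "j < n"
  show "u j holomorphic_on S" by (rule u[OF j])
  fix \<omega> assume \<omega>: "\<omega> \<in> S"
  let ?E = "exp (- \<omega>)"
  define p where "p = (\<lambda>l. (1 - \<tau> l * ?E) * deriv (u l) \<omega>)"
  define Qu where "Qu = (\<lambda>l. \<Sum>i<n. Q l i * u i \<omega>)"
  have p: "p l = (\<Sum>i<n. A l i * u i \<omega>) + (\<Sum>i<n. P l i * v i \<omega>)" if "l < n" for l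
    unfolding p_def using eq1[OF that \<omega>] .
  have "((\<lambda>\<omega>. (1 - \<tau> j * exp (- \<omega>)) * deriv (u j) \<omega>) has_field_derivative
     (1 - \<tau> j * ?E) * deriv (deriv (u j)) \<omega> + \<tau> j * ?E * deriv (u j) \<omega>) (at \<omega>)"
    by (rule derivative_eq_intros holomorphic_derivI[OF u1[OF j] \<open>open S\<close> \<omega>] refl | simp)+
  moreover have "((\<lambda>\<omega>. (1 - \<tau> j * exp (- \<omega>)) * deriv (u j) \<omega>) has_field_derivative
      (\<Sum>l<n. A j l * deriv (u l) \<omega>) + (\<Sum>l<n. P j l * deriv (v l) \<omega>)) (at \<omega>)"
  proof (rule has_field_derivative_transform_within_open[OF _ \<open>open S\<close> \<omega>])
    show "((\<lambda>\<omega>. (\<Sum>l<n. A j l * u l \<omega>) + (\<Sum>l<n. P j l * v l \<omega>)) has_field_derivative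
      (\<Sum>l<n. A j l * deriv (u l) \<omega>) + (\<Sum>l<n. P j l * deriv (v l) \<omega>)) (at \<omega>)"
      by (intro DERIV_add DERIV_sum DERIV_cmult holomorphic_derivI[OF _ \<open>open S\<close> \<omega>] u v) auto
  qed (simp add: eq1[OF j])
  ultimately have dp: "(1 - \<tau> j * ?E) * deriv (deriv (u j)) \<omega> + \<tau> j * ?E * deriv (u j) \<omega> =
      (\<Sum>l<n. A j l * deriv (u l) \<omega>) + (\<Sum>l<n. P j l * deriv (v l) \<omega>)"
    by (rule DERIV_unique)
  \<comment> \<open>Expanding (D - \<rho>1)(D - \<rho>2) and carrying P past D by A P = P D gives c
    p - d u - A p, with c and d the sum and product of \<rho>1 and \<rho>2.\<close>
  have "(\<Sum>l<n. P j l * deriv (v l) \<omega>) = (\<Sum>l<n. (\<rho>1 + \<rho>2) * (P j l * (D l * Qu l)) - P j l * (D l * (D l * Qu l))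
      - \<rho>1 * \<rho>2 * (P j l * Qu l) + (\<rho>1 + \<rho>2) * (P j l * v l \<omega>) - P j l * (D l * v l \<omega>))"
  proof (rule sum.cong)
    fix l assume "l \<in> {..<n}"
    then have *: "deriv (v l) \<omega> = - ((D l - \<rho>1) * (D l - \<rho>2)) * Qu l + (\<rho>1 + \<rho>2 - D l) * v l \<omega>"
      unfolding Qu_def by (intro eq2 \<omega>) simp
    show "P j l * deriv (v l) \<omega> = (\<rho>1 + \<rho>2) * (P j l * (D l * Qu l)) - P j l * (D l * (D l * Qu l))
      - \<rho>1 * \<rho>2 * (P j l * Qu l) + (\<rho>1 + \<rho>2) * (P j l * v l \<omega>) - P j l * (D l * v l \<omega>)"
      unfolding * by (simp add: algebra_simps)
  qed simp
  also have "\<dots> = (\<rho>1 + \<rho>2) * (\<Sum>l<n. P j l * (D l * Qu l)) - (\<Sum>l<n. P j l * (D l * (D l * Qu l)))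
      - \<rho>1 * \<rho>2 * (\<Sum>l<n. P j l * Qu l) + (\<rho>1 + \<rho>2) * (\<Sum>l<n. P j l * v l \<omega>) - (\<Sum>l<n. P j l * (D l * v l \<omega>))"
    by (simp only: sum.distrib sum_subtractf sum_distrib_left)
  also have "(\<Sum>l<n. P j l * Qu l) = u j \<omega>" unfolding Qu_def by (rule PQ'[OF j])
  also have "(\<Sum>l<n. P j l * (D l * Qu l)) = (\<Sum>i<n. A j i * u i \<omega>)"
    unfolding AP'[OF j] by (rule sum.cong) (auto simp: Qu_def PQ')
  also have "(\<Sum>l<n. P j l * (D l * (D l * Qu l))) = (\<Sum>i<n. A j i * (\<Sum>l<n. A i l * u l \<omega>))"
    unfolding AP'[OF j]
  proof (rule sum.cong)
    fix i assume "i \<in> {..<n}"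
    then have "(\<Sum>l<n. P i l * (D l * Qu l)) = (\<Sum>l<n. A i l * (\<Sum>k<n. P l k * Qu k))" by (intro AP') auto
    also have "\<dots> = (\<Sum>l<n. A i l * u l \<omega>)"
      by (rule sum.cong) (auto simp: Qu_def PQ')
    finally show "A j i * (\<Sum>l<n. P i l * (D l * Qu l)) = A j i * (\<Sum>l<n. A i l * u l \<omega>)" by simp
  qed simp
  also have "(\<Sum>l<n. P j l * (D l * v l \<omega>)) = (\<Sum>i<n. A j i * (\<Sum>l<n. P i l * v l \<omega>))" by (rule AP'[OF j])
  finally have "(\<Sum>l<n. P j l * deriv (v l) \<omega>) =
      (\<rho>1 + \<rho>2) * p j - \<rho>1 * \<rho>2 * u j \<omega> - ((\<Sum>i<n. A j i * (\<Sum>l<n. A i l * u l \<omega>)) + (\<Sum>i<n. A j i * (\<Sum>l<n. P i l * v l \<omega>)))"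
    unfolding p[OF j] by (simp add: algebra_simps)
  also have "(\<Sum>i<n. A j i * (\<Sum>l<n. A i l * u l \<omega>)) + (\<Sum>i<n. A j i * (\<Sum>l<n. P i l * v l \<omega>)) = (\<Sum>i<n. A j i * p i)"
    unfolding sum.distrib[symmetric] by (rule sum.cong) (auto simp: p distrib_left)
  finally have Pv: "(\<Sum>l<n. P j l * deriv (v l) \<omega>) = (\<rho>1 + \<rho>2) * p j - \<rho>1 * \<rho>2 * u j \<omega> - (\<Sum>i<n. A j i * p i)" .
  have Ap: "(\<Sum>i<n. A j i * p i) = (\<Sum>l<n. A j l * deriv (u l) \<omega>) - ?E * (\<Sum>l<n. A j l * \<tau> l * deriv (u l) \<omega>)"
    unfolding sum_distrib_left sum_subtractf[symmetric] by (rule sum.cong) (auto simp: p_def algebra_simps)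
  show "deriv (deriv (u j)) \<omega> - (\<rho>1 + \<rho>2) * deriv (u j) \<omega> + \<rho>1 * \<rho>2 * u j \<omega> =
      \<tau> j * ?E * (deriv (deriv (u j)) \<omega> - (1 + (\<rho>1 + \<rho>2)) * deriv (u j) \<omega>) + ?E * (\<Sum>l<n. A j l * \<tau> l * deriv (u l) \<omega>)"
    using dp unfolding Pv Ap by (simp add: p_def algebra_simps)
qed

section \<open>Arguments, sectors and strips\<close>

lemma is_arg_of_iff: "is_arg_of \<phi> z \<longleftrightarrow> z \<noteq> 0 \<and> z = exp (Complex (ln (cmod z)) \<phi>)"
proof -
  have "exp (Complex (ln (cmod z)) \<phi>) = of_real (cmod z) * cis \<phi>" if "z \<noteq> 0"
    using that by (simp add: exp_eq_polar)
  then show ?thesis by (auto simp: is_arg_of_def)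
qed

lemma is_arg_of_exp: "is_arg_of (Im \<omega>) (exp \<omega>)"
proof -
  have "Complex (ln (cmod (exp \<omega>))) (Im \<omega>) = \<omega>" by (simp add: complex_eq_iff)
  then show ?thesis unfolding is_arg_of_iff by simp
qed

lemma sector_eq: "sector c \<alpha> \<beta> = (\<lambda>\<omega>. c + exp \<omega>) ` {\<omega>. \<alpha> < Im \<omega> \<and> Im \<omega> < \<beta>}"
proof (intro equalityI subsetI)
  fix x assume "x \<in> sector c \<alpha> \<beta>"
  then obtain \<phi> where \<phi>: "\<alpha> < \<phi>" "\<phi> < \<beta>" "is_arg_of \<phi> (x - c)" by (auto simp: sector_def)
  then have "x = c + exp (Complex (ln (cmod (x - c))) \<phi>)" by (simp add: is_arg_of_iff algebra_simps)
  then show "x \<in> (\<lambda>\<omega>. c + exp \<omega>) ` {\<omega>. \<alpha> < Im \<omega> \<and> Im \<omega> < \<beta>}" using \<phi> by (intro image_eqI) auto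
next
  fix x assume "x \<in> (\<lambda>\<omega>. c + exp \<omega>) ` {\<omega>. \<alpha> < Im \<omega> \<and> Im \<omega> < \<beta>}"
  then obtain \<omega> where "x = c + exp \<omega>" "\<alpha> < Im \<omega>" "Im \<omega> < \<beta>" by auto
  then show "x \<in> sector c \<alpha> \<beta>" using is_arg_of_exp[of \<omega>] by (auto simp: sector_def)
qed

text \<open>Two logarithms of one number differ by a multiple of 2 pi i. The choices of branch are
  verified through this: it suffices to bound the difference of the imaginary parts.\<close>

lemma exp_eq_arg:
  assumes "exp X = exp Y" "\<bar>Im X - Im Y\<bar> < 2 * pi"
  shows "X = Y"
proof -
  obtain k :: int where k: "X = Y + of_int (2 * k) * pi * \<i>"
    using assms(1) unfolding exp_eq by auto
  then have "\<bar>real_of_int (2 * k) * pi\<bar> < 2 * pi" using assms(2) by simp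
  then have "k = 0" by (simp add: abs_mult)
  then show ?thesis using k by simp
qed

context strip
begin

lemma exp_inj: "inj_on exp S"
proof (rule inj_onI)
  fix x y assume xy: "x \<in> S" "y \<in> S" and eq: "exp x = exp y"
  have "\<bar>Im x - Im y\<bar> < 2 * pi" using xy width by (auto simp: S abs_less_iff)
  with eq show "x = y" by (rule exp_eq_arg)
qed

lemma open_image_exp: "open ((\<lambda>\<omega>. c + exp \<omega>) ` S)"
proof (rule open_mapping_thm3)
  show "inj_on (\<lambda>\<omega>. c + exp \<omega>) S" using exp_inj by (auto simp: inj_on_def)
qed (auto intro!: holomorphic_intros open_S)

lemma open_image_exp_minus: "open ((\<lambda>\<omega>. c + exp (- \<omega>)) ` S)"
proof (rule open_mapping_thm3)
  show "inj_on (\<lambda>\<omega>. c + exp (- \<omega>)) S"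
  proof (rule inj_onI)
    fix x y assume "x \<in> S" "y \<in> S" "c + exp (- x) = c + exp (- y)"
    then show "x = y" using inj_onD[OF exp_inj, of x y] by (simp add: exp_minus)
  qed
qed (auto intro!: holomorphic_intros open_S)

end

context strip_endpoint
begin

text \<open>A branch of log (x - c) is needed that inverts the exponential on the closed strip. The
  principal logarithm, rotated by \<kappa> so that its cut lies opposite to the middle of the strip,
  does so because the width is less than 2 pi.\<close>

lemma analytic_of_extends_at:
  assumes "extends_at S a (\<lambda>\<omega>. F (c + exp \<omega>))"
  shows "\<exists>H. H analytic_on {c + exp a} \<and> (\<forall>x\<in>(\<lambda>\<omega>. c + exp \<omega>) ` S. F x = H x)"
proof -
  obtain r H0 where r: "0 < r" and H0: "H0 holomorphic_on ball a r"
    and eq: "\<And>\<omega>. \<omega> \<in> S \<Longrightarrow> \<omega> \<in> ball a r \<Longrightarrow> F (c + exp \<omega>) = H0 \<omega>"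
    using assms unfolding extends_at_def by auto
  define \<kappa> where "\<kappa> = \<i> * of_real ((\<alpha> + \<beta>) / 2)"
  define L where "L = (\<lambda>x. Ln ((x - c) * exp (- \<kappa>)) + \<kappa>)"
  have mid: "(\<alpha> + \<beta>) / 2 < \<alpha> + pi" "\<beta> - pi < (\<alpha> + \<beta>) / 2" using width by (simp_all add: field_simps)
  have L: "L (c + exp \<omega>) = \<omega>" if "\<alpha> \<le> Im \<omega>" "Im \<omega> \<le> \<beta>" for \<omega>
  proof -
    have "- pi < Im \<omega> - (\<alpha> + \<beta>) / 2" "Im \<omega> - (\<alpha> + \<beta>) / 2 \<le> pi" using mid that by linarith+
    then have "Ln (exp (\<omega> - \<kappa>)) = \<omega> - \<kappa>" by (intro Ln_exp) (simp_all add: \<kappa>_def)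
    then show ?thesis by (simp add: L_def exp_diff exp_minus divide_inverse)
  qed
  have a_im: "\<alpha> \<le> Im a" "Im a \<le> \<beta>" using endpoint width by auto
  define x0 where "x0 = c + exp a"
  have "(x0 - c) * exp (- \<kappa>) \<notin> \<real>\<^sub>\<le>\<^sub>0"
  proof
    assume *: "(x0 - c) * exp (- \<kappa>) \<in> \<real>\<^sub>\<le>\<^sub>0"
    have "(x0 - c) * exp (- \<kappa>) = exp (a - \<kappa>)" by (simp add: x0_def exp_diff exp_minus divide_inverse)
    then have "exp (a - \<kappa>) \<in> \<real>\<^sub>\<le>\<^sub>0" using * by simp
    then have "Im (Ln (exp (a - \<kappa>))) = pi"
      using Im_Ln_eq_pi[of "exp (a - \<kappa>)"] complex_eq_iff[of "exp (a - \<kappa>)" 0]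
      by (auto simp: complex_nonpos_Reals_iff less_le)
    moreover have "- pi < Im a - (\<alpha> + \<beta>) / 2" "Im a - (\<alpha> + \<beta>) / 2 < pi" using mid a_im by linarith+
    then have "Ln (exp (a - \<kappa>)) = a - \<kappa>" "Im (a - \<kappa>) < pi" by (auto intro!: Ln_exp simp: \<kappa>_def)
    ultimately show False by simp
  qed
  moreover have "open (- (\<real>\<^sub>\<le>\<^sub>0 :: complex set))" by (rule open_Compl[OF closed_nonpos_Reals_complex])
  then have "open ((\<lambda>x. (x - c) * exp (- \<kappa>)) -` (- \<real>\<^sub>\<le>\<^sub>0))"
    by (rule open_vimage) (intro continuous_intros)
  ultimately obtain e1 where e1: "0 < e1" "ball x0 e1 \<subseteq> (\<lambda>x. (x - c) * exp (- \<kappa>)) -` (- \<real>\<^sub>\<le>\<^sub>0)"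
    unfolding open_contains_ball by (metis ComplI vimageI)
  have Lh: "L holomorphic_on ball x0 e1" unfolding L_def
    by (intro holomorphic_intros) (use e1(2) in auto)
  have Lx0: "L x0 = a" unfolding x0_def by (rule L[OF a_im])
  have "continuous_on (ball x0 e1) L" using Lh by (rule holomorphic_on_imp_continuous_on)
  then have "open (ball x0 e1 \<inter> L -` ball a r)" by (rule continuous_open_preimage) auto
  moreover have "x0 \<in> ball x0 e1 \<inter> L -` ball a r" using e1(1) r Lx0 by simp
  ultimately obtain e where e: "0 < e" "ball x0 e \<subseteq> ball x0 e1 \<inter> L -` ball a r"
    unfolding open_contains_ball by blast
  \<comment> \<open>The identity \<open>F x = H x\<close> is wanted on the whole image of
    \<open>S\<close>, but holomorphy only near \<open>x0\<close>; away from the small disc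
    \<open>H\<close> is \<open>F\<close> itself.\<close>
  define H where "H = (\<lambda>x. if x \<in> ball x0 e then H0 (L x) else F x)"
  have "(\<lambda>x. H0 (L x)) holomorphic_on ball x0 e"
  proof -
    have "L holomorphic_on ball x0 e" "L ` ball x0 e \<subseteq> ball a r"
      using e(2) holomorphic_on_subset[OF Lh] by blast+
    from holomorphic_on_compose_gen[OF this(1) H0 this(2)] show ?thesis by (simp add: o_def)
  qed
  then have "H holomorphic_on ball x0 e"
    by (rule holomorphic_transform) (simp add: H_def)
  then have "H analytic_on {x0}" using e(1) by (auto simp: analytic_on_def)
  moreover have "F x = H x" if "x \<in> (\<lambda>\<omega>. c + exp \<omega>) ` S" for x
  proof -
    obtain \<omega> where \<omega>: "\<omega> \<in> S" "x = c + exp \<omega>" using \<open>x \<in> _\<close> by auto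
    have "L x = \<omega>" using \<omega> by (auto simp: S intro!: L)
    then show ?thesis using eq[OF \<omega>(1)] e(2) \<omega>(2) by (auto simp: H_def)
  qed
  ultimately show ?thesis unfolding x0_def by blast
qed

section \<open>Local solutions in the logarithmic coordinate\<close>

lemma extends_at_compose:
  assumes H: "H analytic_on {\<psi> a}" and \<psi>: "\<psi> holomorphic_on UNIV" and f: "\<And>\<omega>. \<omega> \<in> S \<Longrightarrow> f \<omega> = H (\<psi> \<omega>)"
  shows "extends_at S a f"
proof -
  have "(H \<circ> \<psi>) analytic_on {a}"
    by (rule analytic_on_compose) (use H \<psi> in \<open>auto simp: analytic_on_open intro: analytic_on_subset[of _ UNIV]\<close>)
  then obtain e where "0 < e" "(H \<circ> \<psi>) holomorphic_on ball a e" by (auto simp: analytic_on_def)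
  then show ?thesis by (rule extends_atI) (simp add: f)
qed

text \<open>In the applications \<kappa> + Ln (\<omega> - a) + \<Gamma> \<omega> is a logarithm of
  \<psi> \<omega> - \<psi> a: \<kappa> comes from the derivative of \<psi> at \<open>a\<close>, and
  \<Gamma> is a correction vanishing at \<open>a\<close>. Only \<kappa> affects the leading
  coefficient.\<close>

lemma branch_at_compose:
  assumes r: "0 < r" and \<Gamma>: "\<Gamma> holomorphic_on ball a r" "\<Gamma> a = 0" and \<psi>: "\<psi> holomorphic_on UNIV"
    and R: "0 < R" and \<Phi>: "\<Phi> holomorphic_on ball (\<psi> a) R"
    and f: "\<And>\<omega>. \<omega> \<in> S \<Longrightarrow> \<omega> \<in> ball a r \<Longrightarrow> \<psi> \<omega> \<in> ball (\<psi> a) R \<Longrightarrow>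
      f \<omega> = exp (lam * (\<kappa> + Ln (\<omega> - a) + \<Gamma> \<omega>)) * \<Phi> (\<psi> \<omega>)"
  shows "branch_at S a lam (exp (lam * \<kappa>) * \<Phi> (\<psi> a)) f"
proof -
  have "open (\<psi> -` ball (\<psi> a) R)"
    using holomorphic_on_imp_continuous_on[OF \<psi>] by (intro open_vimage) auto
  then obtain e where e: "0 < e" "ball a e \<subseteq> \<psi> -` ball (\<psi> a) R"
    using R unfolding open_contains_ball by (metis centre_in_ball vimageI)
  define s where "s = min e r"
  have s: "0 < s" "ball a s \<subseteq> ball a r" "ball a s \<subseteq> \<psi> -` ball (\<psi> a) R"
    using e r by (auto simp: s_def)
  have "(\<lambda>\<omega>. \<Phi> (\<psi> \<omega>)) holomorphic_on ball a s"
  proof -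
    have "\<psi> holomorphic_on ball a s" "\<psi> ` ball a s \<subseteq> ball (\<psi> a) R"
      using \<psi> s(3) holomorphic_on_subset by blast+
    from holomorphic_on_compose_gen[OF this(1) \<Phi> this(2)] show ?thesis by (simp add: o_def)
  qed
  then have "(\<lambda>\<omega>. exp (lam * (\<kappa> + \<Gamma> \<omega>)) * \<Phi> (\<psi> \<omega>)) holomorphic_on ball a s"
    using \<Gamma>(1) s(2) by (intro holomorphic_intros) (auto elim: holomorphic_on_subset)
  then show ?thesis
  proof (rule branch_atI[OF s(1)])
    show "exp (lam * (\<kappa> + \<Gamma> a)) * \<Phi> (\<psi> a) = exp (lam * \<kappa>) * \<Phi> (\<psi> a)" by (simp add: \<Gamma>(2))
    fix \<omega> assume \<omega>: "\<omega> \<in> S" "\<omega> \<in> ball a s"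
    then have "\<omega> - a \<noteq> 0" using a_notin by auto
    then have "exp (lam * (\<kappa> + Ln (\<omega> - a) + \<Gamma> \<omega>)) = (\<omega> - a) powr lam * exp (lam * (\<kappa> + \<Gamma> \<omega>))"
      by (simp add: powr_def exp_add[symmetric] algebra_simps)
    then show "f \<omega> = (\<omega> - a) powr lam * (exp (lam * (\<kappa> + \<Gamma> \<omega>)) * \<Phi> (\<psi> \<omega>))"
    proof -
      have "\<omega> \<in> ball a r" "\<psi> \<omega> \<in> ball (\<psi> a) R" using \<omega>(2) s(2,3) by blast+
      from f[OF \<omega>(1) this] \<open>exp _ = _\<close> show ?thesis by (simp add: mult.assoc)
    qed
  qed
qed

text \<open>\<Gamma> is the principal logarithm of (1 - e^(-v)) / v, a function with value 1 at 0
  and positive real part nearby. The resulting bound on its imaginary part controls the branches of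
  both kinds of local solutions.\<close>

lemma log_factor:
  obtains r \<Gamma> where "0 < r" "\<Gamma> holomorphic_on ball 0 r" "\<Gamma> 0 = 0"
    "\<And>v::complex. v \<in> ball 0 r \<Longrightarrow> 1 - exp (- v) = v * exp (\<Gamma> v)" "\<And>v::complex. v \<in> ball 0 r \<Longrightarrow> \<bar>Im (\<Gamma> v)\<bar> < pi / 2"
proof -
  obtain g :: "complex \<Rightarrow> complex" where g: "g holomorphic_on UNIV" "g 0 = 1" "\<And>z. 1 - exp (- z) = z * g z"
    using exp_difference_factor by blast
  have "open (g -` {z. 0 < Re z})"
    using holomorphic_on_imp_continuous_on[OF g(1)] by (intro open_vimage open_halfspace_Re_gt)
  moreover have "0 \<in> g -` {z. 0 < Re z}" using g(2) by simp
  ultimately obtain r where r: "0 < r" "ball 0 r \<subseteq> g -` {z. 0 < Re z}"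
    unfolding open_contains_ball by blast
  show thesis
  proof (rule that[of r "\<lambda>v. Ln (g v)"])
    show "(\<lambda>v. Ln (g v)) holomorphic_on ball 0 r"
      using r(2) by (intro holomorphic_intros holomorphic_on_subset[OF g(1)]) (auto simp: complex_nonpos_Reals_iff)
    fix v :: complex assume "v \<in> ball 0 r"
    then have pos: "0 < Re (g v)" using r(2) by auto
    then have "g v \<noteq> 0" by auto
    then show "1 - exp (- v) = v * exp (Ln (g v))" using g(3) by simp
    show "\<bar>Im (Ln (g v))\<bar> < pi / 2" using pos Re_Ln_pos_lt[of "g v"] \<open>g v \<noteq> 0\<close> by simp
  qed (use r g in auto)
qed

lemma Im_Ln_endpoint:
  assumes "\<omega> \<in> S"
  shows "Im a = \<alpha> \<Longrightarrow> 0 < Im (Ln (\<omega> - a)) \<and> Im (Ln (\<omega> - a)) < pi"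
    "Im a = \<beta> \<Longrightarrow> - pi < Im (Ln (\<omega> - a)) \<and> Im (Ln (\<omega> - a)) < 0"
proof -
  have ne: "\<omega> - a \<noteq> 0" using assms a_notin by auto
  show "0 < Im (Ln (\<omega> - a)) \<and> Im (Ln (\<omega> - a)) < pi" if "Im a = \<alpha>"
    using Im_Ln_pos_lt_imp[of "\<omega> - a"] assms that by (auto simp: S)
  show "- pi < Im (Ln (\<omega> - a)) \<and> Im (Ln (\<omega> - a)) < 0" if "Im a = \<beta>"
    using Im_Ln_pos_le[OF ne] mpi_less_Im_Ln[OF ne] Im_Ln_le_pi[OF ne] assms that by (auto simp: S not_le)
qed

lemma solution_branchE:
  assumes "solution_branch N T B x0 lam v G E lo hi D U"
  obtains R \<Phi> where "0 < R"
    "\<And>x j. x \<in> ball x0 R \<Longrightarrow> j < N \<Longrightarrow> (\<lambda>m. G m $ j * (x - x0) ^ m) sums (\<Phi> x $ j)"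
    "\<And>x. x \<in> ball x0 R \<Longrightarrow> \<Phi> x \<in> carrier_vec N"
    "\<And>x. x \<in> ball x0 R \<Longrightarrow> x \<in> E \<Longrightarrow> \<exists>\<phi>. lo < \<phi> \<and> \<phi> < hi \<and> is_arg_of \<phi> (x - x0) \<and>
           U x = pow_arg (x - x0) \<phi> lam \<cdot>\<^sub>v \<Phi> x"
    "G 0 = v"
proof -
  obtain R \<Phi> where *: "0 < R"
    "\<forall>x\<in>ball x0 R. \<Phi> x \<in> carrier_vec N \<and> (\<forall>j<N. (\<lambda>m. G m $ j * (x - x0) ^ m) sums (\<Phi> x $ j))"
    "\<forall>x\<in>ball x0 R \<inter> E. \<exists>\<phi>. lo < \<phi> \<and> \<phi> < hi \<and> is_arg_of \<phi> (x - x0) \<and> U x = pow_arg (x - x0) \<phi> lam \<cdot>\<^sub>v \<Phi> x"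
    "G 0 = v"
    using assms unfolding solution_branch_def by blast
  show thesis by (rule that[of R \<Phi>]) (use * in blast)+
qed

text \<open>The increment e^\<omega> - e^a equals e^a (\<omega> - a) e^(\<Gamma>(a - \<omega>)), so
  a + Ln (\<omega> - a) + \<Gamma>(a - \<omega>) is its logarithm up to a multiple of 2 pi i. The
  prescribed half-turn of arguments and the side of \<open>a\<close> on which \<open>S\<close> lies
  leave less than 2 pi for the discrepancy, so it is zero and the leading factor is e^(lam
  a).\<close>

lemma branch_at_extended:
  assumes U: "solution_branch N T B (c + exp a) lam v G E lo hi D U"
    and side: "Im a = \<alpha> \<and> lo = \<alpha> \<and> hi = \<alpha> + pi \<or> Im a = \<beta> \<and> lo = \<beta> - pi \<and> hi = \<beta>"
    and E: "0 < r0" "\<And>\<omega>. \<omega> \<in> S \<Longrightarrow> \<omega> \<in> ball a r0 \<Longrightarrow> c + exp \<omega> \<in> E" and j: "j < N"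
  shows "branch_at S a lam (exp (lam * a) * v $ j) (\<lambda>\<omega>. U (c + exp \<omega>) $ j)"
proof -
  obtain R \<Phi> where R: "0 < R"
    and \<Phi>: "\<And>x j. x \<in> ball (c + exp a) R \<Longrightarrow> j < N \<Longrightarrow> (\<lambda>m. G m $ j * (x - (c + exp a)) ^ m) sums (\<Phi> x $ j)"
    and \<Phi>c: "\<And>x. x \<in> ball (c + exp a) R \<Longrightarrow> \<Phi> x \<in> carrier_vec N"
    and UE: "\<And>x. x \<in> ball (c + exp a) R \<Longrightarrow> x \<in> E \<Longrightarrow> \<exists>\<phi>. lo < \<phi> \<and> \<phi> < hi \<and> is_arg_of \<phi> (x - (c + exp a)) \<and>
           U x = pow_arg (x - (c + exp a)) \<phi> lam \<cdot>\<^sub>v \<Phi> x"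
    and G0: "G 0 = v"
    using U by (rule solution_branchE) blast
  have \<Phi>h: "(\<lambda>x. \<Phi> x $ j) holomorphic_on ball (c + exp a) R"
    by (rule power_series_holomorphic) (rule \<Phi>[OF _ j])
  have "\<Phi> (c + exp a) $ j = v $ j"
    using \<Phi>[of "c + exp a" j] R j powser_sums_zero[of "\<lambda>m. G m $ j"] sums_unique2 G0 by fastforce
  moreover obtain r1 \<Gamma> where \<Gamma>: "0 < r1" "\<Gamma> holomorphic_on ball 0 r1" "\<Gamma> 0 = 0"
    "\<And>v::complex. v \<in> ball 0 r1 \<Longrightarrow> 1 - exp (- v) = v * exp (\<Gamma> v)" "\<And>v::complex. v \<in> ball 0 r1 \<Longrightarrow> \<bar>Im (\<Gamma> v)\<bar> < pi / 2"
    using log_factor by blast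
  moreover have "branch_at S a lam (exp (lam * a) * \<Phi> (c + exp a) $ j) (\<lambda>\<omega>. U (c + exp \<omega>) $ j)"
  proof (rule branch_at_compose[where \<psi> = "\<lambda>\<omega>. c + exp \<omega>" and \<Gamma> = "\<lambda>\<omega>. \<Gamma> (a - \<omega>)" and r = "min r0 r1"])
    show "(\<lambda>\<omega>. \<Gamma> (a - \<omega>)) holomorphic_on ball a (min r0 r1)"
    proof -
      have "(\<lambda>\<omega>. a - \<omega>) holomorphic_on ball a (min r0 r1)" by (intro holomorphic_intros)
      moreover have "(\<lambda>\<omega>. a - \<omega>) ` ball a (min r0 r1) \<subseteq> ball 0 r1" by (auto simp: dist_norm norm_minus_commute)
      ultimately show ?thesis using holomorphic_on_compose_gen[OF _ \<Gamma>(2)] by (fastforce simp: o_def)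
    qed
    fix \<omega> assume \<omega>: "\<omega> \<in> S" "\<omega> \<in> ball a (min r0 r1)" "c + exp \<omega> \<in> ball (c + exp a) R"
    obtain \<phi> where \<phi>: "lo < \<phi>" "\<phi> < hi" "is_arg_of \<phi> (c + exp \<omega> - (c + exp a))"
      "U (c + exp \<omega>) = pow_arg (c + exp \<omega> - (c + exp a)) \<phi> lam \<cdot>\<^sub>v \<Phi> (c + exp \<omega>)"
      using UE[OF \<omega>(3) E(2)] \<omega>(1,2) by auto
    have in1: "a - \<omega> \<in> ball 0 r1" using \<omega>(2) by (simp add: dist_norm norm_minus_commute)
    have ne: "\<omega> - a \<noteq> 0" using \<omega>(1) a_notin by auto
    define X where "X = Complex (ln (cmod (c + exp \<omega> - (c + exp a)))) \<phi>"
    define Y where "Y = a + Ln (\<omega> - a) + \<Gamma> (a - \<omega>)"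
    have "exp Y = exp a * ((\<omega> - a) * exp (\<Gamma> (a - \<omega>)))" using ne by (simp add: Y_def exp_add)
    also have "(\<omega> - a) * exp (\<Gamma> (a - \<omega>)) = exp (\<omega> - a) - 1"
      using \<Gamma>(4)[OF in1] by (simp add: algebra_simps)
    also have "exp a * (exp (\<omega> - a) - 1) = c + exp \<omega> - (c + exp a)"
      by (simp add: exp_diff algebra_simps)
    also have "\<dots> = exp X" using \<phi>(3) unfolding X_def is_arg_of_iff by simp
    finally have "exp X = exp Y" by simp
    moreover have "\<bar>Im X - Im Y\<bar> < 2 * pi"
      using side \<phi>(1,2) \<Gamma>(5)[OF in1] Im_Ln_endpoint[OF \<omega>(1)] by (auto simp: X_def Y_def abs_less_iff)
    ultimately have "X = Y" by (rule exp_eq_arg)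
    then show "U (c + exp \<omega>) $ j = exp (lam * (a + Ln (\<omega> - a) + \<Gamma> (a - \<omega>))) * \<Phi> (c + exp \<omega>) $ j"
      using \<phi>(4) \<Phi>c[OF \<omega>(3)] j by (simp add: pow_arg_def X_def Y_def)
  qed (use R \<Gamma> E(1) \<Phi>h in \<open>auto intro!: holomorphic_intros\<close>)
  ultimately show ?thesis by simp
qed

text \<open>Now the increment is e^(-\<omega>) - e^(-a) = -e^(-a) (\<omega> - a)
  e^(\<Gamma>(\<omega> - a)), and the prescribed arguments realize the sign as e^(-i pi). They fill
  a full turn, so the ranges alone do not fix the branch: the sign of a sine is used as well, to
  confine the arguments to one side of a line through the singular point.\<close>

lemma branch_at_underlying:
  assumes U: "solution_branch N T B (c + exp (- a)) lam v G E (- Im a - 2 * pi) (- Im a) D U"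
    and E: "\<And>\<omega>. \<omega> \<in> S \<Longrightarrow> c + exp (- \<omega>) \<in> E" and j: "j < N"
  shows "branch_at S a lam (exp (lam * (- a - \<i> * of_real pi)) * v $ j) (\<lambda>\<omega>. U (c + exp (- \<omega>)) $ j)"
proof -
  obtain R \<Phi> where R: "0 < R"
    and \<Phi>: "\<And>x j. x \<in> ball (c + exp (- a)) R \<Longrightarrow> j < N \<Longrightarrow> (\<lambda>m. G m $ j * (x - (c + exp (- a))) ^ m) sums (\<Phi> x $ j)"
    and \<Phi>c: "\<And>x. x \<in> ball (c + exp (- a)) R \<Longrightarrow> \<Phi> x \<in> carrier_vec N"
    and UE: "\<And>x. x \<in> ball (c + exp (- a)) R \<Longrightarrow> x \<in> E \<Longrightarrow> \<exists>\<phi>. - Im a - 2 * pi < \<phi> \<and> \<phi> < - Im a \<and>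
      is_arg_of \<phi> (x - (c + exp (- a))) \<and> U x = pow_arg (x - (c + exp (- a))) \<phi> lam \<cdot>\<^sub>v \<Phi> x"
    and G0: "G 0 = v"
    using U by (rule solution_branchE) blast
  have \<Phi>h: "(\<lambda>x. \<Phi> x $ j) holomorphic_on ball (c + exp (- a)) R"
    by (rule power_series_holomorphic) (rule \<Phi>[OF _ j])
  have "\<Phi> (c + exp (- a)) $ j = v $ j"
    using \<Phi>[of "c + exp (- a)" j] R j powser_sums_zero[of "\<lambda>m. G m $ j"] sums_unique2 G0 by fastforce
  moreover obtain r1 \<Gamma> where \<Gamma>: "0 < r1" "\<Gamma> holomorphic_on ball 0 r1" "\<Gamma> 0 = 0"
    "\<And>v::complex. v \<in> ball 0 r1 \<Longrightarrow> 1 - exp (- v) = v * exp (\<Gamma> v)" "\<And>v::complex. v \<in> ball 0 r1 \<Longrightarrow> \<bar>Im (\<Gamma> v)\<bar> < pi / 2"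
    using log_factor by blast
  moreover have "branch_at S a lam (exp (lam * (- a - \<i> * of_real pi)) * \<Phi> (c + exp (- a)) $ j) (\<lambda>\<omega>. U (c + exp (- \<omega>)) $ j)"
  proof (rule branch_at_compose[where \<psi> = "\<lambda>\<omega>. c + exp (- \<omega>)" and \<Gamma> = "\<lambda>\<omega>. \<Gamma> (\<omega> - a)" and r = "min pi r1"])
    show "(\<lambda>\<omega>. \<Gamma> (\<omega> - a)) holomorphic_on ball a (min pi r1)"
    proof -
      have "(\<lambda>\<omega>. \<omega> - a) holomorphic_on ball a (min pi r1)" by (intro holomorphic_intros)
      moreover have "(\<lambda>\<omega>. \<omega> - a) ` ball a (min pi r1) \<subseteq> ball 0 r1" by (auto simp: dist_norm norm_minus_commute)
      ultimately show ?thesis using holomorphic_on_compose_gen[OF _ \<Gamma>(2)] by (fastforce simp: o_def)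
    qed
    fix \<omega> assume \<omega>: "\<omega> \<in> S" "\<omega> \<in> ball a (min pi r1)" "c + exp (- \<omega>) \<in> ball (c + exp (- a)) R"
    let ?z = "c + exp (- \<omega>) - (c + exp (- a))"
    obtain \<phi> where \<phi>: "- Im a - 2 * pi < \<phi>" "\<phi> < - Im a" "is_arg_of \<phi> ?z"
      "U (c + exp (- \<omega>)) = pow_arg ?z \<phi> lam \<cdot>\<^sub>v \<Phi> (c + exp (- \<omega>))"
      using UE[OF \<omega>(3) E] \<omega>(1) by auto
    have in1: "\<omega> - a \<in> ball 0 r1" using \<omega>(2) by (simp add: dist_norm norm_minus_commute)
    have ne: "\<omega> - a \<noteq> 0" using \<omega>(1) a_notin by auto
    define X where "X = Complex (ln (cmod ?z)) \<phi>"
    define Y where "Y = - a - \<i> * of_real pi + Ln (\<omega> - a) + \<Gamma> (\<omega> - a)"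
    have "exp Y = - exp (- a) * ((\<omega> - a) * exp (\<Gamma> (\<omega> - a)))"
      using ne by (simp add: Y_def exp_add exp_diff exp_pi_i' divide_inverse mult.commute[of \<i>] )
    also have "\<dots> = - exp (- a) * (1 - exp (- (\<omega> - a)))"
      unfolding \<Gamma>(4)[OF in1] ..
    also have "\<dots> = ?z" by (simp add: exp_diff exp_minus field_simps)
    finally have expY: "exp Y = ?z" .
    have expX: "exp X = ?z" using \<phi>(3) unfolding X_def is_arg_of_iff by simp
    \<comment> \<open>Rotation by Im a makes e^(-a) real, so this imaginary part comes from
      e^(-\<omega>) alone and its sign is decided by the side of \<open>a\<close> on which \<omega>
      lies.\<close>
    have "Im (exp (\<i> * of_real (Im a)) * ?z) = exp (- Re \<omega>) * sin (Im a - Im \<omega>)"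
    proof -
      have "exp (\<i> * of_real (Im a)) * ?z = exp (\<i> * of_real (Im a) - \<omega>) - exp (\<i> * of_real (Im a) - a)"
        by (simp add: exp_diff exp_minus algebra_simps divide_inverse)
      then show ?thesis by (simp add: Im_exp)
    qed
    moreover have "Im (exp (\<i> * of_real (Im a)) * exp Z) = exp (Re Z) * sin (Im a + Im Z)" for Z
      by (simp add: exp_add[symmetric] Im_exp)
    ultimately have sinX: "exp (Re X) * sin (Im a + Im X) = exp (- Re \<omega>) * sin (Im a - Im \<omega>)"
      and sinY: "exp (Re Y) * sin (Im a + Im Y) = exp (- Re \<omega>) * sin (Im a - Im \<omega>)"
      using expX expY by metis+
    have near: "\<bar>Im \<omega> - Im a\<bar> < pi"
      using \<omega>(2) abs_Im_le_cmod[of "\<omega> - a"] by (simp add: dist_norm norm_minus_commute)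
    have X_range: "- 2 * pi < Im a + Im X" "Im a + Im X < 0" using \<phi>(1,2) by (auto simp: X_def)
    have sin_nonpos: "sin p \<le> 0" if "- pi \<le> p" "p \<le> 0" for p :: real
      using sin_ge_zero[of "- p"] that by simp
    have "\<bar>Im X - Im Y\<bar> < 2 * pi"
    proof (cases "Im a = \<alpha>")
      case True
      then have "0 < sin (Im \<omega> - Im a)" using near \<omega>(1) by (intro sin_gt_zero) (auto simp: S)
      then have neg: "exp (- Re \<omega>) * sin (Im a - Im \<omega>) < 0"
        using sin_minus[of "Im \<omega> - Im a"] by (simp add: mult_pos_neg)
      have sX: "sin (Im a + Im X) < 0" using neg unfolding sinX[symmetric] by (simp add: mult_less_0_iff)
      have sY: "sin (Im a + Im Y) < 0" using neg unfolding sinY[symmetric] by (simp add: mult_less_0_iff)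
      have Y_range: "- (3 * pi / 2) < Im a + Im Y" "Im a + Im Y < pi / 2"
        using \<Gamma>(5)[OF in1] Im_Ln_endpoint(1)[OF \<omega>(1) True] by (auto simp: Y_def abs_less_iff)
      have "Im a + Im Y < 0"
      proof (rule ccontr)
        assume "\<not> Im a + Im Y < 0"
        then have "0 \<le> sin (Im a + Im Y)" using Y_range by (intro sin_ge_zero) auto
        then show False using sY by simp
      qed
      then show ?thesis using X_range Y_range unfolding abs_less_iff by (auto simp: field_simps)
    next
      case False
      then have b: "Im a = \<beta>" using endpoint by auto
      then have "0 < sin (Im a - Im \<omega>)" using near \<omega>(1) by (intro sin_gt_zero) (auto simp: S)
      then have pos: "0 < exp (- Re \<omega>) * sin (Im a - Im \<omega>)" by simp
      have sX: "0 < sin (Im a + Im X)" using pos unfolding sinX[symmetric] by (simp add: zero_less_mult_iff)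
      have sY: "0 < sin (Im a + Im Y)" using pos unfolding sinY[symmetric] by (simp add: zero_less_mult_iff)
      have Y_range: "- (5 * pi / 2) < Im a + Im Y" "Im a + Im Y < - (pi / 2)"
        using \<Gamma>(5)[OF in1] Im_Ln_endpoint(2)[OF \<omega>(1) b] by (auto simp: Y_def abs_less_iff)
      have "Im a + Im X < - pi"
        using sin_nonpos[of "Im a + Im X"] X_range sX by (cases "- pi \<le> Im a + Im X") auto
      moreover have "Im a + Im Y < - pi"
        using sin_nonpos[of "Im a + Im Y"] Y_range sY by (cases "- pi \<le> Im a + Im Y") auto
      ultimately show ?thesis using X_range Y_range unfolding abs_less_iff by (auto simp: field_simps)
    qed
    with expX expY have "X = Y" using exp_eq_arg[of X Y] by simp
    then show "U (c + exp (- \<omega>)) $ j = exp (lam * (- a - \<i> * of_real pi + Ln (\<omega> - a) + \<Gamma> (\<omega> - a))) * \<Phi> (c + exp (- \<omega>)) $ j"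
      using \<phi>(4) \<Phi>c[OF \<omega>(3)] j by (simp add: pow_arg_def X_def Y_def)
  qed (use R \<Gamma> \<Phi>h in \<open>auto intro!: holomorphic_intros\<close>)
  ultimately show ?thesis by simp
qed

end

section \<open>The matrices of the systems\<close>

lemma block_scalar_Suc:
  "block_scalar (Suc K) c d = four_block_mat (block_scalar K c d)
     (0\<^sub>m (dim_row (block_scalar K c d)) (d (Suc K))) (0\<^sub>m (d (Suc K)) (dim_col (block_scalar K c d)))
     (c (Suc K) \<cdot>\<^sub>m 1\<^sub>m (d (Suc K)))"
  unfolding block_scalar_def by (simp add: diag_block_mat_last Let_def)

lemma offset_Suc: "offset d (Suc K) = (\<Sum>k=1..K. d k)"
  unfolding offset_def by (rule sum.cong) auto

lemma offset_add: "1 \<le> k \<Longrightarrow> offset d k + d k = offset d (Suc k)"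
  unfolding offset_def by (simp add: atLeastLessThanSuc)

lemma offset_mono: "k \<le> k' \<Longrightarrow> offset d k \<le> offset d k'"
  unfolding offset_def by (rule sum_mono2) auto

lemma block_scalar_carrier: "block_scalar K c d \<in> carrier_mat (\<Sum>k=1..K. d k) (\<Sum>k=1..K. d k)"
proof (induction K)
  case 0
  show ?case by (auto simp: block_scalar_def)
next
  case (Suc K)
  then show ?case unfolding block_scalar_Suc by (intro carrier_matI) auto
qed

lemma block_scalar_off_diagonal:
  assumes "x < (\<Sum>k=1..K. d k)" "y < (\<Sum>k=1..K. d k)" "x \<noteq> y"
  shows "block_scalar K c d $$ (x, y) = 0"
  using assms
proof (induction K)
  case (Suc K)
  have "dim_row (block_scalar K c d) = (\<Sum>k=1..K. d k)" "dim_col (block_scalar K c d) = (\<Sum>k=1..K. d k)"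
    using block_scalar_carrier by auto
  then show ?case using Suc unfolding block_scalar_Suc by auto
qed simp

lemma block_scalar_diagonal:
  assumes "k \<in> {1..K}" "y < d k"
  shows "block_scalar K c d $$ (offset d k + y, offset d k + y) = c k"
  using assms(1)
proof (induction K)
  case (Suc K)
  have D: "dim_row (block_scalar K c d) = (\<Sum>k=1..K. d k)" "dim_col (block_scalar K c d) = (\<Sum>k=1..K. d k)"
    using block_scalar_carrier by auto
  show ?case
  proof (cases "k = Suc K")
    case True
    then show ?thesis using assms(2) D unfolding block_scalar_Suc by (simp add: offset_Suc)
  next
    case False
    then have k: "k \<in> {1..K}" using Suc.prems by auto
    have "offset d k + d k \<le> (\<Sum>k=1..K. d k)"
      using offset_mono[of "Suc k" "Suc K" d] k by (simp add: offset_add offset_Suc)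
    then have "offset d k + y < (\<Sum>k=1..K. d k)" using assms(2) by simp
    then show ?thesis using Suc.IH[OF k] D unfolding block_scalar_Suc by simp
  qed
qed simp

lemma block_index:
  fixes x :: nat
  assumes "x < (\<Sum>k=1..K. d k)"
  obtains k y where "k \<in> {1..K}" "y < d k" "x = offset d k + y"
  using assms
proof (induction K arbitrary: thesis)
  case (Suc K)
  show ?case
  proof (cases "x < (\<Sum>k=1..K. d k)")
    case True
    then obtain k y where "k \<in> {1..K}" "y < d k" "x = offset d k + y" using Suc.IH by blast
    then show ?thesis using Suc.prems(1)[of k y] by auto
  next
    case False
    then show ?thesis using Suc.prems by (intro Suc.prems(1)[of "Suc K" "x - offset d (Suc K)"]) (auto simp: offset_Suc)
  qed
qed simp

lemma mult_mat_entry: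
  assumes "A \<in> carrier_mat n n" "B \<in> carrier_mat n n" "j < n" "l < n"
  shows "(A * B) $$ (j, l) = (\<Sum>i<n. A $$ (j, i) * B $$ (i, l))"
  using assms by (simp add: scalar_prod_def atLeast0LessThan)

lemma diagonal_mult_entry:
  assumes "A \<in> carrier_mat n n" "B \<in> carrier_mat n n" "j < n" "l < n"
    and diag: "\<And>i. i < n \<Longrightarrow> i \<noteq> j \<Longrightarrow> A $$ (j, i) = 0"
  shows "(A * B) $$ (j, l) = A $$ (j, j) * (B $$ (j, l) :: complex)"
proof -
  have "(A * B) $$ (j, l) = (\<Sum>i<n. (if j = i then 1 else 0) * (A $$ (j, j) * B $$ (j, l)))"
    unfolding mult_mat_entry[OF assms(1-4)] by (rule sum.cong) (use diag in auto)
  then show ?thesis using sum_times_delta[OF assms(3), of "\<lambda>_. A $$ (j, j) * B $$ (j, l)"] by simp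
qed

lemma mult_diagonal_entry:
  assumes "A \<in> carrier_mat n n" "B \<in> carrier_mat n n" "j < n" "l < n"
    and diag: "\<And>i. i < n \<Longrightarrow> i \<noteq> l \<Longrightarrow> B $$ (i, l) = 0"
  shows "(A * B) $$ (j, l) = (A $$ (j, l) :: complex) * B $$ (l, l)"
proof -
  have "(A * B) $$ (j, l) = (\<Sum>i<n. (if l = i then 1 else 0) * (A $$ (j, l) * B $$ (l, l)))"
    unfolding mult_mat_entry[OF assms(1-4)] by (rule sum.cong) (use diag in auto)
  then show ?thesis using sum_times_delta[OF assms(4), of "\<lambda>_. A $$ (j, l) * B $$ (l, l)"] by simp
qed

lemma system_component:
  assumes sol: "system_solution N S B D U" and carrier: "S \<in> carrier_mat N N" "B \<in> carrier_mat N N"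
    and diag: "\<And>j l. j < N \<Longrightarrow> l < N \<Longrightarrow> j \<noteq> l \<Longrightarrow> S $$ (j, l) = 0" and x: "x \<in> D" and j: "j < N"
  shows "(x - S $$ (j, j)) * deriv (\<lambda>z. U z $ j) x = (\<Sum>l<N. B $$ (j, l) * U x $ l)"
proof -
  define f where "f = (\<lambda>j. deriv (\<lambda>z. U z $ j) x)"
  have Ux: "U x \<in> carrier_vec N" using sol x by (simp add: system_solution_def)
  have "((x \<cdot>\<^sub>m 1\<^sub>m N - S) *\<^sub>v vec N f) $ j = (\<Sum>l<N. (x * (if j = l then 1 else 0) - S $$ (j, l)) * f l)"
    using carrier j by (simp add: scalar_prod_def atLeast0LessThan)
  also have "\<dots> = (\<Sum>l<N. (if j = l then 1 else 0) * ((x - S $$ (j, j)) * f l))"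
    by (rule sum.cong) (use diag j in auto)
  also have "\<dots> = (x - S $$ (j, j)) * f j" by (rule sum_times_delta[OF j])
  finally have "(x - S $$ (j, j)) * f j = ((x \<cdot>\<^sub>m 1\<^sub>m N - S) *\<^sub>v vec N f) $ j" by simp
  also have "\<dots> = (B *\<^sub>v U x) $ j"
    using sol x by (simp add: system_solution_def f_def)
  also have "\<dots> = (\<Sum>l<N. B $$ (j, l) * U x $ l)"
    using carrier j Ux by (simp add: scalar_prod_def atLeast0LessThan)
  finally show ?thesis by (simp add: f_def)
qed

lemma system_holomorphic: "system_solution N S B D U \<Longrightarrow> j < N \<Longrightarrow> (\<lambda>x. U x $ j) holomorphic_on D"
  by (simp add: system_solution_def)

section \<open>The systems in the logarithmic coordinate\<close>

context strip
begin

text \<open>With \<zeta> = \<eta> + e^(-\<omega>) one has \<zeta> - t'_j = e^(-\<omega>) -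
  1/\<tau>_j and d\<zeta>/d\<omega> = -e^(-\<omega>); multiplying the system by \<tau>_j
  e^(-\<omega>) gives the form used on the strip.\<close>

lemma underlying_solution_of_system:
  assumes w: "system_solution n T B D w" and carrier: "T \<in> carrier_mat n n" "B \<in> carrier_mat n n"
    and diag: "\<And>j l. j < n \<Longrightarrow> l < n \<Longrightarrow> j \<noteq> l \<Longrightarrow> T $$ (j, l) = 0"
    and \<tau>: "\<And>j. j < n \<Longrightarrow> \<tau> j \<noteq> 0" "\<And>j. j < n \<Longrightarrow> T $$ (j, j) = \<eta> + 1 / \<tau> j"
    and D: "\<And>\<omega>. \<omega> \<in> S \<Longrightarrow> \<eta> + exp (- \<omega>) \<in> D"
  shows "underlying_solution n \<tau> (\<lambda>j l. B $$ (j, l)) S (\<lambda>j \<omega>. w (\<eta> + exp (- \<omega>)) $ j)"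
  unfolding underlying_solution_def
proof (intro allI impI conjI ballI)
  fix j assume j: "j < n"
  let ?O = "(\<lambda>\<omega>. \<eta> + exp (- \<omega>)) ` S"
  have hol: "(\<lambda>x. w x $ j) holomorphic_on ?O"
    using D by (intro holomorphic_on_subset[OF system_holomorphic[OF w j]]) auto
  have der: "((\<lambda>\<omega>. w (\<eta> + exp (- \<omega>)) $ j) has_field_derivative deriv (\<lambda>x. w x $ j) (\<eta> + exp (- \<omega>)) * (- exp (- \<omega>))) (at \<omega>)"
    if "\<omega> \<in> S" for \<omega>
    by (rule holomorphic_derivative_compose[OF hol open_image_exp_minus])
       (use that in \<open>auto intro!: derivative_eq_intros\<close>)
  then show "(\<lambda>\<omega>. w (\<eta> + exp (- \<omega>)) $ j) holomorphic_on S"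
    unfolding holomorphic_on_open[OF open_S] by blast
  fix \<omega> assume \<omega>: "\<omega> \<in> S"
  define W where "W = deriv (\<lambda>x. w x $ j) (\<eta> + exp (- \<omega>))"
  define R where "R = (\<Sum>l<n. B $$ (j, l) * w (\<eta> + exp (- \<omega>)) $ l)"
  have "(\<eta> + exp (- \<omega>) - (\<eta> + 1 / \<tau> j)) * W = R"
    using system_component[OF w carrier diag D[OF \<omega>] j] by (simp add: W_def R_def \<tau>(2)[OF j])
  then have R: "R = (exp (- \<omega>) - 1 / \<tau> j) * W" by simp
  have d: "deriv (\<lambda>\<omega>. w (\<eta> + exp (- \<omega>)) $ j) \<omega> = - (exp (- \<omega>) * W)"
    using DERIV_imp_deriv[OF der[OF \<omega>]] by (simp add: W_def)
  show "(1 - \<tau> j * exp (- \<omega>)) * deriv (\<lambda>\<omega>. w (\<eta> + exp (- \<omega>)) $ j) \<omega> =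
      \<tau> j * exp (- \<omega>) * (\<Sum>l<n. B $$ (j, l) * w (\<eta> + exp (- \<omega>)) $ l)"
    unfolding R_def[symmetric] R d using \<tau>(1)[OF j] by (simp add: field_simps)
qed

text \<open>The factor x - T_jj is e^\<omega> (1 - (T_jj - s) e^(-\<omega>)), and e^\<omega> d/dx is
  d/d\<omega>. For components with T_jj = s the factor becomes 1: the point s has moved to
  infinity.\<close>

lemma system_component_exp:
  assumes U: "system_solution N T B ((\<lambda>\<omega>. s + exp \<omega>) ` S) U" and carrier: "T \<in> carrier_mat N N" "B \<in> carrier_mat N N"
    and diag: "\<And>j l. j < N \<Longrightarrow> l < N \<Longrightarrow> j \<noteq> l \<Longrightarrow> T $$ (j, l) = 0" and j: "j < N"
  shows "(\<lambda>\<omega>. U (s + exp \<omega>) $ j) holomorphic_on S"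
    "\<omega> \<in> S \<Longrightarrow> (1 - (T $$ (j, j) - s) * exp (- \<omega>)) * deriv (\<lambda>\<omega>. U (s + exp \<omega>) $ j) \<omega> = (\<Sum>l<N. B $$ (j, l) * U (s + exp \<omega>) $ l)"
proof -
  have der: "((\<lambda>\<omega>. U (s + exp \<omega>) $ j) has_field_derivative deriv (\<lambda>x. U x $ j) (s + exp \<omega>) * exp \<omega>) (at \<omega>)"
    if "\<omega> \<in> S" for \<omega>
    by (rule holomorphic_derivative_compose[OF system_holomorphic[OF U j] open_image_exp])
       (use that in \<open>auto intro!: derivative_eq_intros\<close>)
  then show "(\<lambda>\<omega>. U (s + exp \<omega>) $ j) holomorphic_on S"
    unfolding holomorphic_on_open[OF open_S] by blast
  assume \<omega>: "\<omega> \<in> S"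
  define W where "W = deriv (\<lambda>x. U x $ j) (s + exp \<omega>)"
  have "s + exp \<omega> \<in> (\<lambda>\<omega>. s + exp \<omega>) ` S" using \<omega> by blast
  from system_component[OF U carrier diag this j]
  have *: "(s + exp \<omega> - T $$ (j, j)) * W = (\<Sum>l<N. B $$ (j, l) * U (s + exp \<omega>) $ l)" by (simp add: W_def)
  have "deriv (\<lambda>\<omega>. U (s + exp \<omega>) $ j) \<omega> = W * exp \<omega>"
    using DERIV_imp_deriv[OF der[OF \<omega>]] by (simp add: W_def)
  then show "(1 - (T $$ (j, j) - s) * exp (- \<omega>)) * deriv (\<lambda>\<omega>. U (s + exp \<omega>) $ j) \<omega> = (\<Sum>l<N. B $$ (j, l) * U (s + exp \<omega>) $ l)"
    unfolding *[symmetric] by (simp add: exp_minus field_simps)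
qed

end

lemma sum_lessThan_add: "(\<Sum>l<n + k. f l) = (\<Sum>l<n. f l) + (\<Sum>l<k. f (n + l) :: complex)" for n k :: nat
  by (induction k) (simp_all add: add.assoc)

text \<open>\<open>D\<close> is the diagonal form of \<open>A\<close>; in the application
  \<open>m2\<close> counts its entries before the last two blocks. From position \<open>m2\<close>
  on the entries are \<rho>1 or \<rho>2, so (D - \<rho>1)(D - \<rho>2) vanishes there. This is the
  reducibility that cuts the system of size 2n down to n + m2.\<close>

locale extension_data =
  fixes n m2 :: nat and A P Q D T :: "complex mat" and \<rho>1 \<rho>2 s :: complex
  assumes A: "A \<in> carrier_mat n n" and P: "P \<in> carrier_mat n n" and Q: "Q \<in> carrier_mat n n"
    and PQ: "P * Q = 1\<^sub>m n" and QP: "Q * P = 1\<^sub>m n" and D_eq: "D = Q * A * P"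
    and D_off: "\<And>j l. j < n \<Longrightarrow> l < n \<Longrightarrow> j \<noteq> l \<Longrightarrow> D $$ (j, l) = 0"
    and m2: "m2 \<le> n" and D_last: "\<And>j. m2 \<le> j \<Longrightarrow> j < n \<Longrightarrow> D $$ (j, j) \<in> {\<rho>1, \<rho>2}"
    and T: "T \<in> carrier_mat n n" and T_off: "\<And>j l. j < n \<Longrightarrow> l < n \<Longrightarrow> j \<noteq> l \<Longrightarrow> T $$ (j, l) = 0"
begin

lemma D: "D \<in> carrier_mat n n" using A P Q D_eq by auto

lemma AP_sum:
  assumes "j < n" "l < n"
  shows "(\<Sum>i<n. A $$ (j, i) * P $$ (i, l)) = P $$ (j, l) * D $$ (l, l)"
proof -
  have "P * D = P * (Q * (A * P))" using D_eq A P Q by (simp add: assoc_mult_mat[of _ n n _ n _ n])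
  also have "\<dots> = (P * Q) * (A * P)" using A P Q by (simp add: assoc_mult_mat[of P n n Q n "A * P" n])
  also have "\<dots> = A * P" using PQ A P by (simp add: left_mult_one_mat[of _ n n])
  finally have "A * P = P * D" by simp
  then show ?thesis
    using mult_mat_entry[OF A P assms] mult_diagonal_entry[OF P D assms] D_off assms by auto
qed

lemma PQ_sum:
  assumes "j < n" "l < n"
  shows "(\<Sum>i<n. P $$ (j, i) * Q $$ (i, l)) = (if j = l then 1 else 0)"
    "(\<Sum>i<n. Q $$ (j, i) * P $$ (i, l)) = (if j = l then 1 else 0)"
  using mult_mat_entry[OF P Q assms] mult_mat_entry[OF Q P assms] PQ QP assms by auto

definition system_matrix :: "complex mat" where
  "system_matrix = leading_block (n + m2) (extended_matrix n A P Q D \<rho>1 \<rho>2)"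

definition system_points :: "complex mat" where
  "system_points = diag_block_mat [T, s \<cdot>\<^sub>m 1\<^sub>m m2]"

lemma system_matrix_carrier: "system_matrix \<in> carrier_mat (n + m2) (n + m2)"
  by (simp add: system_matrix_def leading_block_def)

lemma system_points_eq: "system_points = four_block_mat T (0\<^sub>m n m2) (0\<^sub>m m2 n) (s \<cdot>\<^sub>m 1\<^sub>m m2)"
  unfolding system_points_def diag_block_mat.simps(2)[of T] diag_block_mat_singleton Let_def using T by simp

lemma system_points_carrier: "system_points \<in> carrier_mat (n + m2) (n + m2)"
  unfolding system_points_eq using T by (intro four_block_carrier_mat) auto

lemma system_points_entry:
  assumes "j < n + m2" "l < n + m2"
  shows "system_points $$ (j, l) = (if j \<noteq> l then 0 else if j < n then T $$ (j, j) else s)"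
  using assms T T_off by (auto simp: system_points_eq)

lemma system_matrix_entry:
  assumes "j < n" "l < n"
  shows "system_matrix $$ (j, l) = A $$ (j, l)"
    "l < m2 \<Longrightarrow> system_matrix $$ (j, n + l) = P $$ (j, l)"
    "j < m2 \<Longrightarrow> system_matrix $$ (n + j, l) = - ((D $$ (j, j) - \<rho>1) * (D $$ (j, j) - \<rho>2)) * Q $$ (j, l)"
    "j < m2 \<Longrightarrow> l < m2 \<Longrightarrow> system_matrix $$ (n + j, n + l) = (if j = l then \<rho>1 + \<rho>2 - D $$ (j, j) else 0)"
proof -
  let ?X = "D - \<rho>1 \<cdot>\<^sub>m 1\<^sub>m n" and ?Y = "D - \<rho>2 \<cdot>\<^sub>m 1\<^sub>m n"
  have X: "?X \<in> carrier_mat n n" "?Y \<in> carrier_mat n n" using D by auto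
  have XY: "?X * ?Y \<in> carrier_mat n n" using X by auto
  have dims: "dim_row A = n" "dim_col A = n" "dim_row P = n" "dim_col P = n" "dim_row Q = n" "dim_col Q = n"
    "dim_row D = n" "dim_col D = n"
    using A P Q D by auto
  have Xoff: "?X $$ (j, i) = 0" "?Y $$ (j, i) = 0" if "i < n" "i \<noteq> j" for i
    using that assms D_off dims by auto
  have XYe: "(?X * ?Y) $$ (j, i) = ?X $$ (j, j) * ?Y $$ (j, i)" if "i < n" for i
    by (rule diagonal_mult_entry[OF X assms(1) that]) (use Xoff in auto)
  have XYQ: "(?X * ?Y * Q) $$ (j, l) = (?X * ?Y) $$ (j, j) * Q $$ (j, l)"
    by (rule diagonal_mult_entry[OF XY Q assms]) (use Xoff XYe in auto)
  show "system_matrix $$ (j, l) = A $$ (j, l)"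
    "l < m2 \<Longrightarrow> system_matrix $$ (j, n + l) = P $$ (j, l)"
    using assms dims by (auto simp: system_matrix_def leading_block_def extended_matrix_def)
  show "system_matrix $$ (n + j, l) = - ((D $$ (j, j) - \<rho>1) * (D $$ (j, j) - \<rho>2)) * Q $$ (j, l)" if "j < m2"
  proof -
    have "system_matrix $$ (n + j, l) = - ((?X * ?Y * Q) $$ (j, l))"
      using assms dims that by (simp add: system_matrix_def leading_block_def extended_matrix_def)
    also have "\<dots> = - (?X $$ (j, j) * ?Y $$ (j, j)) * Q $$ (j, l)"
      unfolding XYQ XYe[OF assms(1)] by simp
    finally show ?thesis using assms dims by simp
  qed
  show "system_matrix $$ (n + j, n + l) = (if j = l then \<rho>1 + \<rho>2 - D $$ (j, j) else 0)" if "j < m2" "l < m2"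
    using assms dims that D_off by (auto simp: system_matrix_def leading_block_def extended_matrix_def)
qed

text \<open>Padding the last components by zeros gives a solution of the full system of size 2n,
  because the coefficients (D_j - \<rho>1)(D_j - \<rho>2) vanish from position \<open>m2\<close> on;
  the elimination then applies. The second claim inverts P: the components after the n-th are those
  of Q (p - A u) with p = (1 - \<tau> e^(-\<omega>)) u', so they are determined by the first
  n.\<close>

lemma extended_system:
  assumes "strip S \<alpha> \<beta>" and U: "system_solution (n + m2) system_points system_matrix ((\<lambda>\<omega>. s + exp \<omega>) ` S) U"
  defines "u \<equiv> \<lambda>j \<omega>. U (s + exp \<omega>) $ j" and "\<tau> \<equiv> \<lambda>j. T $$ (j, j) - s"
  shows "extended_solution n \<tau> (\<lambda>j l. A $$ (j, l)) (\<rho>1 + \<rho>2) (\<rho>1 * \<rho>2) S u"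
    and "\<And>j \<omega>. j < m2 \<Longrightarrow> \<omega> \<in> S \<Longrightarrow> u (n + j) \<omega> =
      (\<Sum>i<n. Q $$ (j, i) * ((1 - \<tau> i * exp (- \<omega>)) * deriv (u i) \<omega> - (\<Sum>l<n. A $$ (i, l) * u l \<omega>)))"
proof -
  interpret strip S \<alpha> \<beta> by fact
  have off: "system_points $$ (j, l) = 0" if "j < n + m2" "l < n + m2" "j \<noteq> l" for j l
    using that by (simp add: system_points_entry)
  note comp = system_component_exp[OF U system_points_carrier system_matrix_carrier off, folded u_def]
  define v where "v = (\<lambda>j. if j < m2 then u (n + j) else (\<lambda>_. 0))"
  have u_hol: "u j holomorphic_on S" if "j < n + m2" for j
    using comp(1)[OF _ _ _ that] by (simp add: u_def)
  have P_sum: "(\<Sum>l<n. P $$ (j, l) * v l \<omega>) = (\<Sum>l<m2. P $$ (j, l) * u (n + l) \<omega>)" for j \<omega>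
    by (rule sum.mono_neutral_cong_right) (use m2 in \<open>auto simp: v_def\<close>)
  have eq1: "(1 - \<tau> j * exp (- \<omega>)) * deriv (u j) \<omega> = (\<Sum>l<n. A $$ (j, l) * u l \<omega>) + (\<Sum>l<n. P $$ (j, l) * v l \<omega>)"
    if j: "j < n" and \<omega>: "\<omega> \<in> S" for j \<omega>
  proof -
    have j': "j < n + m2" using j by simp
    have "(1 - \<tau> j * exp (- \<omega>)) * deriv (u j) \<omega> = (\<Sum>l<n + m2. system_matrix $$ (j, l) * u l \<omega>)"
      using comp(2)[OF _ _ _ j' \<omega>] system_points_entry[OF j' j'] j by (simp add: u_def \<tau>_def)
    also have "\<dots> = (\<Sum>l<n. A $$ (j, l) * u l \<omega>) + (\<Sum>l<m2. P $$ (j, l) * u (n + l) \<omega>)"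
      unfolding sum_lessThan_add
      by (intro arg_cong2[of _ _ _ _ "(+)"] sum.cong) (use j m2 system_matrix_entry(1,2) in auto)
    finally show ?thesis unfolding P_sum .
  qed
  have eq2: "deriv (v j) \<omega> = - ((D $$ (j, j) - \<rho>1) * (D $$ (j, j) - \<rho>2)) * (\<Sum>l<n. Q $$ (j, l) * u l \<omega>) + (\<rho>1 + \<rho>2 - D $$ (j, j)) * v j \<omega>"
    if j: "j < n" and \<omega>: "\<omega> \<in> S" for j \<omega>
  proof (cases "j < m2")
    case True
    then have j': "n + j < n + m2" by simp
    have "deriv (u (n + j)) \<omega> = (\<Sum>l<n + m2. system_matrix $$ (n + j, l) * u l \<omega>)"
      using comp(2)[OF _ _ _ j' \<omega>] system_points_entry[OF j' j'] by (simp add: u_def)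
    also have "\<dots> = (\<Sum>l<n. - ((D $$ (j, j) - \<rho>1) * (D $$ (j, j) - \<rho>2)) * (Q $$ (j, l) * u l \<omega>)) +
        (\<Sum>l<m2. (if j = l then 1 else 0) * ((\<rho>1 + \<rho>2 - D $$ (j, j)) * u (n + l) \<omega>))"
      unfolding sum_lessThan_add
      by (intro arg_cong2[of _ _ _ _ "(+)"] sum.cong) (use True j m2 system_matrix_entry(3,4)[OF j] in auto)
    also have "\<dots> = - ((D $$ (j, j) - \<rho>1) * (D $$ (j, j) - \<rho>2)) * (\<Sum>l<n. Q $$ (j, l) * u l \<omega>) +
        (\<rho>1 + \<rho>2 - D $$ (j, j)) * u (n + j) \<omega>"
      unfolding sum_times_delta[OF True] by (simp add: sum_distrib_left)
    finally show ?thesis using True by (simp add: v_def)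
  next
    case False
    then show ?thesis using D_last[of j] j by (auto simp: v_def)
  qed
  show "extended_solution n \<tau> (\<lambda>j l. A $$ (j, l)) (\<rho>1 + \<rho>2) (\<rho>1 * \<rho>2) S u"
    by (rule extended_solution_of_system[where P = "\<lambda>j l. P $$ (j, l)" and Q = "\<lambda>j l. Q $$ (j, l)" and D = "\<lambda>j. D $$ (j, j)" and v = v])
       (use AP_sum PQ_sum(1) eq1 eq2 u_hol open_S m2 in \<open>auto simp: v_def\<close>)
  fix j \<omega> assume j: "j < m2" and \<omega>: "\<omega> \<in> S"
  then have jn: "j < n" using m2 by simp
  have "(\<Sum>i<n. Q $$ (j, i) * ((1 - \<tau> i * exp (- \<omega>)) * deriv (u i) \<omega> - (\<Sum>l<n. A $$ (i, l) * u l \<omega>))) =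
    (\<Sum>i<n. Q $$ (j, i) * (\<Sum>l<n. P $$ (i, l) * v l \<omega>))"
    by (rule sum.cong) (use eq1 \<omega> in auto)
  also have "\<dots> = (\<Sum>l<n. (\<Sum>i<n. Q $$ (j, i) * P $$ (i, l)) * v l \<omega>)"
    unfolding sum_distrib_left sum_distrib_right by (subst sum.swap) (simp add: mult_ac)
  also have "\<dots> = (\<Sum>l<n. (if j = l then 1 else 0) * v l \<omega>)"
    by (rule sum.cong) (use PQ_sum(2)[OF jn] in auto)
  also have "\<dots> = u (n + j) \<omega>" unfolding sum_times_delta[OF jn] using j by (simp add: v_def)
  finally show "u (n + j) \<omega> = (\<Sum>i<n. Q $$ (j, i) * ((1 - \<tau> i * exp (- \<omega>)) * deriv (u i) \<omega> - (\<Sum>l<n. A $$ (i, l) * u l \<omega>)))"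
    by simp
qed

text \<open>A + z = P (D + z) Q, and the diagonal factor is inverted entrywise.\<close>

lemma shifted_inverse:
  assumes "\<And>j. j < n \<Longrightarrow> D $$ (j, j) + z \<noteq> 0"
  shows "\<exists>B. is_inverse n (shift_matrix (\<lambda>j l. A $$ (j, l)) z) B"
proof -
  define B where "B = (\<lambda>j l. \<Sum>i<n. P $$ (j, i) * (Q $$ (i, l) / (D $$ (i, i) + z)))"
  have QA: "(\<Sum>i<n. Q $$ (j, i) * A $$ (i, l)) = D $$ (j, j) * Q $$ (j, l)" if "j < n" "l < n" for j l
  proof -
    have "D * Q = Q * A * (P * Q)"
      unfolding D_eq by (rule assoc_mult_mat[of _ n n _ n _ n]) (use A P Q in auto)
    also have "\<dots> = Q * A" using PQ A Q by (simp add: right_mult_one_mat[of _ n n])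
    finally have "Q * A = D * Q" by simp
    then show ?thesis
      using mult_mat_entry[OF Q A that] diagonal_mult_entry[OF D Q that] D_off that by auto
  qed
  have M1: "(\<Sum>i<n. Q $$ (j, i) * shift_matrix (\<lambda>j l. A $$ (j, l)) z i l) = (D $$ (j, j) + z) * Q $$ (j, l)" if "j < n" "l < n" for j l
  proof -
    have "(\<Sum>i<n. Q $$ (j, i) * shift_matrix (\<lambda>j l. A $$ (j, l)) z i l) =
      (\<Sum>i<n. Q $$ (j, i) * A $$ (i, l)) + (\<Sum>i<n. (if l = i then 1 else 0) * (z * Q $$ (j, i)))"
      unfolding sum.distrib[symmetric] by (rule sum.cong) (auto simp: shift_matrix_def algebra_simps)
    then show ?thesis unfolding QA[OF that] sum_times_delta[OF that(2)] by (simp add: algebra_simps)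
  qed
  have M2: "(\<Sum>i<n. shift_matrix (\<lambda>j l. A $$ (j, l)) z j i * P $$ (i, l)) = P $$ (j, l) * (D $$ (l, l) + z)" if "j < n" "l < n" for j l
    unfolding shift_matrix_apply[OF that(1)] AP_sum[OF that] by (simp add: algebra_simps)
  have "is_inverse n (shift_matrix (\<lambda>j l. A $$ (j, l)) z) B"
    unfolding is_inverse_def
  proof (intro allI impI conjI)
    fix j l assume jl: "j < n" "l < n"
    have "(\<Sum>i<n. B j i * shift_matrix (\<lambda>j l. A $$ (j, l)) z i l) =
      (\<Sum>k<n. P $$ (j, k) / (D $$ (k, k) + z) * (\<Sum>i<n. Q $$ (k, i) * shift_matrix (\<lambda>j l. A $$ (j, l)) z i l))"
      unfolding B_def sum_distrib_left sum_distrib_right by (subst sum.swap) (simp add: mult_ac)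
    also have "\<dots> = (\<Sum>k<n. P $$ (j, k) * Q $$ (k, l))"
      by (rule sum.cong) (use M1 jl assms in auto)
    finally show "(\<Sum>i<n. B j i * shift_matrix (\<lambda>j l. A $$ (j, l)) z i l) = (if j = l then 1 else 0)"
      unfolding PQ_sum(1)[OF jl] .
    have "(\<Sum>i<n. shift_matrix (\<lambda>j l. A $$ (j, l)) z j i * B i l) =
      (\<Sum>k<n. (\<Sum>i<n. shift_matrix (\<lambda>j l. A $$ (j, l)) z j i * P $$ (i, k)) * (Q $$ (k, l) / (D $$ (k, k) + z)))"
      unfolding B_def sum_distrib_left sum_distrib_right by (subst sum.swap) (simp add: mult_ac)
    also have "\<dots> = (\<Sum>k<n. P $$ (j, k) * Q $$ (k, l))"
      by (rule sum.cong) (use M2 jl assms in auto)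
    finally show "(\<Sum>i<n. shift_matrix (\<lambda>j l. A $$ (j, l)) z j i * B i l) = (if j = l then 1 else 0)"
      unfolding PQ_sum(1)[OF jl] .
  qed
  then show ?thesis by blast
qed

end

section \<open>The connection coefficients\<close>

lemma exists_shift:
  assumes "finite F"
  obtains m :: nat where "\<And>z. z \<in> F \<Longrightarrow> 1 < Re z + real m"
proof -
  obtain m :: nat where m: "1 + (\<Sum>z\<in>F. \<bar>Re z\<bar>) < real m" using reals_Archimedean2 by blast
  have "1 < Re z + real m" if "z \<in> F" for z
    using member_le_sum[of z F "\<lambda>z. \<bar>Re z\<bar>"] that assms m by auto
  then show thesis by (rule that)
qed

context extension_data
begin

text \<open>\<open>factor\<close> is the quotient of two leading coefficients: e^(lam z) for the
  given solution, e^(c z) e^(lam (-z - i pi)) for the transform of the underlying one. By uniqueness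
  the given solution is \<open>factor\<close> times the transform, at \<open>a\<close> as at
  \<open>b\<close>, so the coefficients \<open>cc\<close> are multiplied by the quotient of the two
  factors.\<close>

lemma connection_step:
  assumes strip: "strip_endpoints S \<alpha> \<beta> a b"
  defines "\<tau> \<equiv> \<lambda>j. T $$ (j, j) - s" and "c \<equiv> \<rho>1 + \<rho>2" and "A' \<equiv> \<lambda>j l. A $$ (j, l)"
  assumes I: "finite I" and \<tau>0: "\<And>j. j < n \<Longrightarrow> \<tau> j \<noteq> 0"
    and D_nonint: "\<And>j. j < n \<Longrightarrow> D $$ (j, j) \<notin> \<int>"
    and Ua: "system_solution (n + m2) system_points system_matrix ((\<lambda>\<omega>. s + exp \<omega>) ` S) Ua"
      "\<And>j. j < n \<Longrightarrow> branch_at S a la (exp (la * a) * ea j) (\<lambda>\<omega>. Ua (s + exp \<omega>) $ j)"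
    and Ub: "\<And>i. i \<in> I \<Longrightarrow> system_solution (n + m2) system_points system_matrix ((\<lambda>\<omega>. s + exp \<omega>) ` S) (Ub i)"
      "\<And>i j. i \<in> I \<Longrightarrow> j < n \<Longrightarrow> branch_at S b (lb i) (exp (lb i * b) * eb i j) (\<lambda>\<omega>. Ub i (s + exp \<omega>) $ j)"
    and wa: "underlying_solution n \<tau> A' S wa"
      "\<And>j. j < n \<Longrightarrow> branch_at S a la (exp (la * (- a - \<i> * of_real pi)) * ea j) (wa j)"
    and wb: "\<And>i. i \<in> I \<Longrightarrow> underlying_solution n \<tau> A' S (wb i)"
      "\<And>i j. i \<in> I \<Longrightarrow> j < n \<Longrightarrow> branch_at S b (lb i) (exp (lb i * (- b - \<i> * of_real pi)) * eb i j) (wb i j)"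
    and conn: "\<And>j. j < n \<Longrightarrow> extends_at S b (\<lambda>\<omega>. wa j \<omega> - (\<Sum>i\<in>I. cc i * wb i j \<omega>))"
    and nonint: "la \<notin> \<int>" "\<And>i. i \<in> I \<Longrightarrow> lb i \<notin> \<int>"
    and diag_a: "\<And>j l. j < n \<Longrightarrow> l < n \<Longrightarrow> \<tau> j = exp a \<Longrightarrow> \<tau> l = exp a \<Longrightarrow> A' j l = (if j = l then A' j j else 0)"
      "\<And>j. j < n \<Longrightarrow> \<tau> j = exp a \<Longrightarrow> la = A' j j \<or> la - A' j j \<notin> \<int>"
    and diag_b: "\<And>j l. j < n \<Longrightarrow> l < n \<Longrightarrow> \<tau> j = exp b \<Longrightarrow> \<tau> l = exp b \<Longrightarrow> A' j l = (if j = l then A' j j else 0)"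
      "\<And>i j. i \<in> I \<Longrightarrow> j < n \<Longrightarrow> \<tau> j = exp b \<Longrightarrow> lb i = A' j j \<or> lb i - A' j j \<notin> \<int>"
  defines "factor \<equiv> \<lambda>z lam. exp (of_real pi * \<i> * lam) * exp ((2 * lam - \<rho>1 - \<rho>2) * z)"
  assumes j: "j < n + m2"
  shows "extends_at S b (\<lambda>\<omega>. Ua (s + exp \<omega>) $ j - (\<Sum>i\<in>I. factor a la / factor b (lb i) * cc i * Ub i (s + exp \<omega>) $ j))"
proof -
  interpret strip_endpoints S \<alpha> \<beta> a b by fact
  obtain m :: nat where m: "\<And>z. z \<in> insert la (lb ` I) \<Longrightarrow> 1 < Re z + real m"
    using exists_shift[of "insert la (lb ` I)"] I by auto
  have inv: "\<exists>B. is_inverse n (shift_matrix A' (of_nat k)) B" if "1 \<le> k" for k :: nat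
    unfolding A'_def
  proof (rule shifted_inverse)
    fix j assume "j < n"
    from D_nonint[OF this] show "D $$ (j, j) + of_nat k \<noteq> 0"
      by (metis Ints_minus Ints_of_nat add_eq_0_iff2)
  qed
  from connection_transfer[OF \<tau>0 inv wa nonint(1) m[OF insertI1] I wb nonint(2) m[OF insertI2[OF imageI]] conn,
      of c "\<rho>1 * \<rho>2"]
  obtain u ub where tr: "extended_solution n \<tau> A' c (\<rho>1 * \<rho>2) S u \<and>
     (\<forall>j<n. branch_at S a la (exp (c * a) * (exp (la * (- a - \<i> * of_real pi)) * ea j)) (u j)) \<and>
     (\<forall>i\<in>I. extended_solution n \<tau> A' c (\<rho>1 * \<rho>2) S (ub i) \<and>
       (\<forall>j<n. branch_at S b (lb i) (exp (c * b) * (exp (lb i * (- b - \<i> * of_real pi)) * eb i j)) (ub i j))) \<and>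
     (\<forall>j<n. extends_at S b (\<lambda>\<omega>. u j \<omega> - (\<Sum>i\<in>I. cc i * ub i j \<omega>)))"
    by auto
  have u: "extended_solution n \<tau> A' c (\<rho>1 * \<rho>2) S u"
    "\<And>j. j < n \<Longrightarrow> branch_at S a la (exp (c * a) * (exp (la * (- a - \<i> * of_real pi)) * ea j)) (u j)"
    and ub: "\<And>i. i \<in> I \<Longrightarrow> extended_solution n \<tau> A' c (\<rho>1 * \<rho>2) S (ub i)"
    "\<And>i j. i \<in> I \<Longrightarrow> j < n \<Longrightarrow> branch_at S b (lb i) (exp (c * b) * (exp (lb i * (- b - \<i> * of_real pi)) * eb i j)) (ub i j)"
    and ext: "\<And>j. j < n \<Longrightarrow> extends_at S b (\<lambda>\<omega>. u j \<omega> - (\<Sum>i\<in>I. cc i * ub i j \<omega>))"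
    using tr by blast+
  have factor0: "factor z lam \<noteq> 0" for z lam by (simp add: factor_def)
  have cancel: "exp (lam * z) * e + - factor z lam * (exp (c * z) * (exp (lam * (- z - \<i> * of_real pi)) * e)) = 0" for lam z e
  proof -
    have "factor z lam * (exp (c * z) * exp (lam * (- z - \<i> * of_real pi))) = exp (lam * z)"
      unfolding factor_def c_def by (simp add: exp_add[symmetric] algebra_simps)
    then have *: "factor z lam * (exp (c * z) * (exp (lam * (- z - \<i> * of_real pi)) * e)) = exp (lam * z) * e"
      by (metis mult.assoc)
    show ?thesis unfolding mult_minus_left * by simp
  qed
  note strip' = A.strip_axioms
  note Ua_ext = extended_system(1)[OF strip' Ua(1), folded \<tau>_def c_def A'_def]
  have ua: "Ua (s + exp \<omega>) $ j = factor a la * u j \<omega>" if j: "j < n" and \<omega>: "\<omega> \<in> S" for j \<omega>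
  proof -
    have "Ua (s + exp \<omega>) $ j - factor a la * u j \<omega> = 0"
    proof (rule A.extended_solution_zero[OF extended_solution_diff[OF Ua_ext u(1) A.open_S] _ diag_a(1) nonint(1) diag_a(2) j \<omega>])
      fix l assume l: "l < n"
      have "branch_at S a la (exp (la * a) * ea l + - factor a la * (exp (c * a) * (exp (la * (- a - \<i> * of_real pi)) * ea l)))
        (\<lambda>\<omega>. Ua (s + exp \<omega>) $ l + - factor a la * u l \<omega>)"
        by (intro branch_at_add Ua(2) branch_at_mult[of _ _ _ _ _ "\<lambda>_. - factor a la"] u(2) l) simp
      then show "branch_at S a la 0 (\<lambda>\<omega>. Ua (s + exp \<omega>) $ l - factor a la * u l \<omega>)"
        unfolding cancel by simp
    qed
    then show ?thesis by simp
  qed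
  have ub': "Ub i (s + exp \<omega>) $ j = factor b (lb i) * ub i j \<omega>" if i: "i \<in> I" and j: "j < n" and \<omega>: "\<omega> \<in> S" for i j \<omega>
  proof -
    note Ub_ext = extended_system(1)[OF strip' Ub(1)[OF i], folded \<tau>_def c_def A'_def]
    have "Ub i (s + exp \<omega>) $ j - factor b (lb i) * ub i j \<omega> = 0"
    proof (rule B.extended_solution_zero[OF extended_solution_diff[OF Ub_ext ub(1)[OF i] A.open_S] _ diag_b(1) nonint(2)[OF i] diag_b(2)[OF i] j \<omega>])
      fix l assume l: "l < n"
      have "branch_at S b (lb i) (exp (lb i * b) * eb i l + - factor b (lb i) * (exp (c * b) * (exp (lb i * (- b - \<i> * of_real pi)) * eb i l)))
        (\<lambda>\<omega>. Ub i (s + exp \<omega>) $ l + - factor b (lb i) * ub i l \<omega>)"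
        by (intro branch_at_add Ub(2) branch_at_mult[of _ _ _ _ _ "\<lambda>_. - factor b (lb i)"] ub(2) i l) simp
      then show "branch_at S b (lb i) 0 (\<lambda>\<omega>. Ub i (s + exp \<omega>) $ l - factor b (lb i) * ub i l \<omega>)"
        unfolding cancel by simp
    qed
    then show ?thesis by simp
  qed
  let ?C = "\<lambda>i. factor a la / factor b (lb i) * cc i"
  let ?d = "\<lambda>j \<omega>. Ua (s + exp \<omega>) $ j - (\<Sum>i\<in>I. ?C i * Ub i (s + exp \<omega>) $ j)"
  have first: "extends_at S b (?d j)" if j: "j < n" for j
  proof -
    have "extends_at S b (\<lambda>\<omega>. factor a la * (u j \<omega> - (\<Sum>i\<in>I. cc i * ub i j \<omega>)))"
      by (intro extends_at_mult[of _ _ _ "\<lambda>_. factor a la"] ext j) simp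
    then show ?thesis
    proof (rule extends_at_cong)
      fix \<omega> assume \<omega>: "\<omega> \<in> S"
      have "(\<Sum>i\<in>I. ?C i * Ub i (s + exp \<omega>) $ j) = (\<Sum>i\<in>I. factor a la * (cc i * ub i j \<omega>))"
        by (rule sum.cong) (use ub' j \<omega> factor0 in auto)
      then show "factor a la * (u j \<omega> - (\<Sum>i\<in>I. cc i * ub i j \<omega>)) = ?d j \<omega>"
        unfolding ua[OF j \<omega>] by (simp add: right_diff_distrib sum_distrib_left)
    qed
  qed
  show ?thesis
  proof (cases "j < n")
    case True then show ?thesis by (rule first)
  next
    case False
    define j' where "j' = j - n"
    have j': "j' < m2" "j = n + j'" using False j by (auto simp: j'_def)
    \<comment> \<open>The remaining components arise from the first n by a linear differential
      operator with entire coefficients, so holomorphy at \<open>b\<close> carries over to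
      them.\<close>
    have "extends_at S b (\<lambda>\<omega>. \<Sum>i<n. Q $$ (j', i) * ((1 - \<tau> i * exp (- \<omega>)) * deriv (?d i) \<omega> + (\<Sum>l<n. - A' i l * ?d l \<omega>)))"
      by (intro extends_at_sum extends_at_mult[of _ _ _ "\<lambda>_. Q $$ (j', _)"] extends_at_add
          extends_at_mult[of _ _ _ "\<lambda>\<omega>. 1 - \<tau> _ * exp (- \<omega>)"] extends_at_mult[of _ _ _ "\<lambda>_. - A' _ _"]
          extends_at_deriv first A.open_S holomorphic_intros) auto
    then show ?thesis
    proof (rule extends_at_cong)
      fix \<omega> assume \<omega>: "\<omega> \<in> S"
      let ?ua = "\<lambda>l \<omega>. Ua (s + exp \<omega>) $ l" and ?ub = "\<lambda>i l \<omega>. Ub i (s + exp \<omega>) $ l"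
      have hol: "?ua l holomorphic_on S" "i \<in> I \<Longrightarrow> ?ub i l holomorphic_on S" if "l < n" for l i
        using extended_system(1)[OF strip' Ua(1)] extended_system(1)[OF strip' Ub(1)] that
        by (auto simp: extended_solution_def)
      have dd: "deriv (?d l) \<omega> = deriv (?ua l) \<omega> - (\<Sum>i\<in>I. ?C i * deriv (?ub i l) \<omega>)" if "l < n" for l
        by (intro DERIV_imp_deriv DERIV_diff DERIV_sum DERIV_cmult holomorphic_derivI[OF _ A.open_S \<omega>] hol that)
      let ?X = "\<lambda>f l. (1 - \<tau> l * exp (- \<omega>)) * deriv (f l) \<omega> - (\<Sum>k<n. A' l k * f k \<omega>)"
      have key: "(1 - \<tau> l * exp (- \<omega>)) * deriv (?d l) \<omega> + (\<Sum>k<n. - A' l k * ?d k \<omega>) =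
         ?X ?ua l - (\<Sum>i\<in>I. ?C i * ?X (?ub i) l)" if l: "l < n" for l
      proof -
        have "(\<Sum>k<n. - A' l k * ?d k \<omega>) = - (\<Sum>k<n. A' l k * ?ua k \<omega>) + (\<Sum>k<n. \<Sum>i\<in>I. A' l k * (?C i * ?ub i k \<omega>))"
          by (simp add: algebra_simps sum.distrib sum_subtractf sum_negf sum_distrib_left)
        also have "(\<Sum>k<n. \<Sum>i\<in>I. A' l k * (?C i * ?ub i k \<omega>)) = (\<Sum>i\<in>I. ?C i * (\<Sum>k<n. A' l k * ?ub i k \<omega>))"
          unfolding sum_distrib_left by (subst sum.swap) (simp add: mult_ac)
        finally show ?thesis
          unfolding dd[OF l] by (simp add: right_diff_distrib sum_subtractf sum_distrib_left mult_ac)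
      qed
      have "(\<Sum>l<n. Q $$ (j', l) * ((1 - \<tau> l * exp (- \<omega>)) * deriv (?d l) \<omega> + (\<Sum>k<n. - A' l k * ?d k \<omega>))) =
        (\<Sum>l<n. Q $$ (j', l) * ?X ?ua l) - (\<Sum>l<n. \<Sum>i\<in>I. Q $$ (j', l) * (?C i * ?X (?ub i) l))"
        unfolding sum_subtractf[symmetric]
      proof (rule sum.cong)
        fix l assume "l \<in> {..<n}"
        then have l: "l < n" by simp
        show "Q $$ (j', l) * ((1 - \<tau> l * exp (- \<omega>)) * deriv (?d l) \<omega> + (\<Sum>k<n. - A' l k * ?d k \<omega>)) =
          Q $$ (j', l) * ?X ?ua l - (\<Sum>i\<in>I. Q $$ (j', l) * (?C i * ?X (?ub i) l))"
          unfolding key[OF l] sum_distrib_left[symmetric, of "Q $$ (j', l)"] by (rule right_diff_distrib)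
      qed simp
      also have "(\<Sum>l<n. Q $$ (j', l) * ?X ?ua l) = ?ua j \<omega>"
        unfolding j'(2) A'_def \<tau>_def by (rule extended_system(2)[OF strip' Ua(1) j'(1) \<omega>, symmetric])
      also have "(\<Sum>l<n. \<Sum>i\<in>I. Q $$ (j', l) * (?C i * ?X (?ub i) l)) = (\<Sum>i\<in>I. ?C i * (\<Sum>l<n. Q $$ (j', l) * ?X (?ub i) l))"
        unfolding sum_distrib_left by (subst sum.swap) (simp only: mult.left_commute)
      also have "\<dots> = (\<Sum>i\<in>I. ?C i * ?ub i j \<omega>)"
      proof (rule sum.cong)
        fix i assume "i \<in> I"
        then have "(\<Sum>l<n. Q $$ (j', l) * ?X (?ub i) l) = ?ub i j \<omega>"
          unfolding j'(2) A'_def \<tau>_def by (intro extended_system(2)[OF strip' Ub(1) j'(1) \<omega>, symmetric])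
        then show "?C i * (\<Sum>l<n. Q $$ (j', l) * ?X (?ub i) l) = ?C i * ?ub i j \<omega>" by simp
      qed simp
      finally show "(\<Sum>l<n. Q $$ (j', l) * ((1 - \<tau> l * exp (- \<omega>)) * deriv (?d l) \<omega> + (\<Sum>k<n. - A' l k * ?d k \<omega>))) = ?d j \<omega>" .
    qed
  qed
qed

end

theorem theorem7p17:
  fixes p q n N :: nat
    and t t' \<mu> :: "nat \<Rightarrow> complex"
    and nb r m :: "nat \<Rightarrow> nat"
    and l :: "nat \<Rightarrow> nat \<Rightarrow> nat"
    and lam :: "nat \<Rightarrow> nat \<Rightarrow> complex"
    and T T' TT A A' P Q AP :: "complex mat"
    and \<theta> :: "nat \<Rightarrow> real"
    and \<delta> :: real
    and \<eta> :: complex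
    and Sp Sm :: "nat \<Rightarrow> complex set"
    and G g :: "nat \<Rightarrow> nat \<Rightarrow> nat \<Rightarrow> nat \<Rightarrow> complex vec"
    and Up Um w :: "nat \<Rightarrow> nat \<Rightarrow> nat \<Rightarrow> complex \<Rightarrow> complex vec"
    and c C :: "nat \<Rightarrow> nat \<Rightarrow> nat \<Rightarrow> nat \<Rightarrow> nat \<Rightarrow> nat \<Rightarrow> complex"
  assumes
    \<comment> \<open>the points and the sizes of the blocks\<close>
    p: "1 \<le> p" and q: "2 \<le> q"
    and t_distinct: "inj_on t {1..p + 1}"
    and t_no_three: "\<And>i j k. 1 \<le> i \<Longrightarrow> i < j \<Longrightarrow> j < k \<Longrightarrow> k \<le> p + 1 \<Longrightarrow> \<not> collinear {t i, t j, t k}"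
    and r_pos: "\<And>i. i \<in> {1..p} \<Longrightarrow> 1 \<le> r i"
    and l_pos: "\<And>i k. i \<in> {1..p} \<Longrightarrow> k \<in> {1..r i} \<Longrightarrow> 1 \<le> l i k"
    and nb: "\<And>i. i \<in> {1..p} \<Longrightarrow> nb i = (\<Sum>k=1..r i. l i k)"
    and n: "n = (\<Sum>i=1..p. nb i)"
    and m_pos: "\<And>k. k \<in> {1..q} \<Longrightarrow> 1 \<le> m k"
    and m_sum: "(\<Sum>k=1..q. m k) = n"
    and N: "N = 2 * n - m (q - 1) - m q"
    \<comment> \<open>the matrices\<close>
    and T: "T = block_scalar p t nb"
    and A: "A \<in> carrier_mat n n"
    and A_diag: "\<And>i. i \<in> {1..p} \<Longrightarrow> diagonal_block A nb i = block_scalar (r i) (lam i) (l i)"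
    and lam_distinct: "\<And>i. i \<in> {1..p} \<Longrightarrow> inj_on (lam i) {1..r i}"
    and P: "P \<in> carrier_mat n n" and Q: "Q \<in> carrier_mat n n"
    and P_inverse: "inverts_mat P Q" "inverts_mat Q P"
    and A'_def: "A' = Q * A * P"
    and A'_diag: "A' = block_scalar q \<mu> m"
    and \<mu>_distinct: "inj_on \<mu> {1..q}"
    and AP: "AP = leading_block N (extended_matrix n A P Q A' (\<mu> (q - 1)) (\<mu> q))"
    and TT: "TT = diag_block_mat [T, t (p + 1) \<cdot>\<^sub>m 1\<^sub>m (n - m (q - 1) - m q)]"
    \<comment> \<open>non-integrality\<close>
    and lam_nonint: "\<And>i k. i \<in> {1..p} \<Longrightarrow> k \<in> {1..r i} \<Longrightarrow> lam i k \<notin> \<int>"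
    and lam_diff_nonint: "\<And>i k h. i \<in> {1..p} \<Longrightarrow> k \<in> {1..r i} \<Longrightarrow> h \<in> {1..r i} \<Longrightarrow> k \<noteq> h \<Longrightarrow>
      lam i k - lam i h \<notin> \<int>"
    and \<mu>_nonint: "\<And>k. k \<in> {1..q} \<Longrightarrow> \<mu> k \<notin> \<int>"
    and \<mu>_diff_nonint: "\<And>k h. k \<in> {1..q} \<Longrightarrow> h \<in> {1..q} \<Longrightarrow> k \<noteq> h \<Longrightarrow> \<mu> k - \<mu> h \<notin> \<int>"
    and lam_\<mu>_nonint: "\<And>i k h. i \<in> {1..p} \<Longrightarrow> k \<in> {1..r i} \<Longrightarrow> h \<in> {1..q} \<Longrightarrow>
      lam i k - \<mu> h \<notin> \<int>"
    \<comment> \<open>arguments and sectors\<close>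
    and \<theta>_arg: "\<And>i. i \<in> {1..p} \<Longrightarrow> is_arg_of (\<theta> i) (t i - t (p + 1))"
    and \<theta>_mono: "\<And>i. i \<in> {1..<p} \<Longrightarrow> \<theta> i < \<theta> (i + 1)"
    and \<theta>_last: "\<theta> p < \<theta> 1 + 2 * pi"
    and \<theta>_extra: "\<theta> p < \<theta> (p + 1)" "\<theta> (p + 1) < \<theta> 1 + 2 * pi"
    and \<theta>_0: "\<theta> 0 = \<theta> (p + 1) - 2 * pi"
    and \<delta>_pos: "0 < \<delta>"
    and \<delta>_small: "\<And>i. i \<in> {0..p} \<Longrightarrow> 2 * \<delta> < \<theta> (i + 1) - \<theta> i"
    and Sp: "\<And>i. i \<in> {1..p} \<Longrightarrow> Sp i = sector_plus (t (p + 1)) \<theta> \<delta> i"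
    and Sm: "\<And>i. i \<in> {1..p} \<Longrightarrow> Sm i = sector_minus (t (p + 1)) \<theta> \<delta> i"
    \<comment> \<open>the local solutions of the extended system: branch on \<open>Sp i\<close> and branch on \<open>Sm i\<close>\<close>
    and Up: "\<And>i k h. i \<in> {1..p - 1} \<Longrightarrow> k \<in> {1..r i} \<Longrightarrow> h \<in> {1..l i k} \<Longrightarrow>
      solution_branch N TT AP (t i) (lam i k) (unit_at N (position nb l i k h)) (G i k h)
        (Sp i) (\<theta> i) (\<theta> i + pi) (Sp i \<union> Sm (i + 1)) (Up i k h)"
    and Um: "\<And>i k h. i \<in> {2..p} \<Longrightarrow> k \<in> {1..r i} \<Longrightarrow> h \<in> {1..l i k} \<Longrightarrow>
      solution_branch N TT AP (t i) (lam i k) (unit_at N (position nb l i k h)) (G i k h)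
        (Sm i) (\<theta> i - pi) (\<theta> i) (Sm i \<union> Sp (i - 1)) (Um i k h)"
    \<comment> \<open>the underlying system with \<open>\<rho> = 0\<close> and its connection coefficients\<close>
    and t': "\<And>i. i \<in> {1..p} \<Longrightarrow> t' i = \<eta> + 1 / (t i - t (p + 1))"
    and T': "T' = block_scalar p t' nb"
    and w: "\<And>i k h. i \<in> {1..p} \<Longrightarrow> k \<in> {1..r i} \<Longrightarrow> h \<in> {1..l i k} \<Longrightarrow>
      solution_branch n T' A (t' i) (lam i k) (unit_at n (position nb l i k h)) (g i k h)
        (cut_plane \<eta> p t') (- \<theta> i - 2 * pi) (- \<theta> i) (cut_plane \<eta> p t') (w i k h)"
    and c: "\<And>\<nu> i k h. \<nu> \<in> {1..p} \<Longrightarrow> i \<in> {1..p} \<Longrightarrow> \<nu> \<noteq> i \<Longrightarrow> k \<in> {1..r i} \<Longrightarrow> h \<in> {1..l i k} \<Longrightarrow>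
      connection_relation n (cut_plane \<eta> p t') (t' \<nu>) (r \<nu>) (l \<nu>) (w i k h)
        (\<lambda>k' h'. c \<nu> k' h' i k h) (w \<nu>)"
    and C: "\<And>\<nu> k' h' i k h. C \<nu> k' h' i k h =
      connection_factor t p \<theta> lam (\<mu> (q - 1)) (\<mu> q) i k /
      connection_factor t p \<theta> lam (\<mu> (q - 1)) (\<mu> q) \<nu> k' * c \<nu> k' h' i k h"
  shows "(\<forall>i\<in>{1..p - 1}. \<forall>k\<in>{1..r i}. \<forall>h\<in>{1..l i k}.
            connection_relation N (Sp i \<union> Sm (i + 1)) (t (i + 1)) (r (i + 1)) (l (i + 1)) (Up i k h)
              (\<lambda>k' h'. C (i + 1) k' h' i k h) (Um (i + 1))) \<and>
         (\<forall>i\<in>{2..p}. \<forall>k\<in>{1..r i}. \<forall>h\<in>{1..l i k}.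
            connection_relation N (Sm i \<union> Sp (i - 1)) (t (i - 1)) (r (i - 1)) (l (i - 1)) (Um i k h)
              (\<lambda>k' h'. C (i - 1) k' h' i k h) (Up (i - 1)))"
proof -

  \<comment> \<open>Matrices, points and exponents of the theorem\<close>
  let ?m2 = "n - m (q - 1) - m q"
  let ?s = "t (p + 1)"
  define \<rho>1 \<rho>2 where rho: "\<rho>1 = \<mu> (q - 1)" "\<rho>2 = \<mu> q"
  \<comment> \<open>The logarithm of t_i - t_(p+1) with imaginary part \<theta>_i. It represents t_i
    and, through \<zeta> = \<eta> + e^(-\<omega>), also t'_i.\<close>
  define om where "om = (\<lambda>i. Complex (ln (cmod (t i - ?s))) (\<theta> i))"
  have q': "1 \<le> q - 1" "q - 1 + 1 = q" using q by auto
  have offset_q: "offset m (q - 1) + m (q - 1) = offset m q" "offset m q + m q = n"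
    using offset_add[of "q - 1" m] offset_add[of q m] offset_Suc[of m q] q' m_sum by auto
  \<comment> \<open>\<open>offset m (q - 1)\<close> is the total size of the blocks before that of
    \<mu>_(q-1), which is what is left of n after removing the last two blocks.\<close>
  have m2: "?m2 = offset m (q - 1)" "?m2 \<le> n" and N': "N = n + ?m2"
    using offset_q N by auto
  note T_eq = T
  have T_carrier: "T \<in> carrier_mat n n" unfolding T n by (rule block_scalar_carrier)
  have T'_carrier: "T' \<in> carrier_mat n n" unfolding T' n by (rule block_scalar_carrier)
  have points_off: "T $$ (j, l) = 0" "T' $$ (j, l) = 0" if "j < n" "l < n" "j \<noteq> l" for j l
    using that unfolding T T' n by (auto intro: block_scalar_off_diagonal)
  have D_off: "A' $$ (j, l) = 0" if "j < n" "l < n" "j \<noteq> l" for j l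
    using that unfolding A'_diag m_sum[symmetric] by (auto intro: block_scalar_off_diagonal)
  have D_entry: "\<exists>k y. k \<in> {1..q} \<and> y < m k \<and> j = offset m k + y \<and> A' $$ (j, j) = \<mu> k" if j: "j < n" for j
  proof -
    obtain k y where ky: "k \<in> {1..q}" "y < m k" "j = offset m k + y"
      using block_index[of j m q] j unfolding m_sum[symmetric] by blast
    then show ?thesis unfolding A'_diag using block_scalar_diagonal[where k = k and d = m and y = y, OF ky(1,2)] ky by blast
  qed
  have D_nonint: "A' $$ (j, j) \<notin> \<int>" if "j < n" for j
    using D_entry[OF that] \<mu>_nonint by metis
  have D_last: "A' $$ (j, j) \<in> {\<rho>1, \<rho>2}" if j: "?m2 \<le> j" "j < n" for j
  proof -
    obtain k y where k: "k \<in> {1..q}" "y < m k" "j = offset m k + y" "A' $$ (j, j) = \<mu> k" using D_entry[OF j(2)] by blast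
    have "\<not> k < q - 1"
    proof
      assume "k < q - 1"
      then have "offset m k + m k \<le> offset m (q - 1)"
        using offset_mono[of "Suc k" "q - 1" m] k(1) by (simp add: offset_add)
      then show False using j(1) k(2,3) m2(1) by simp
    qed
    then have "k = q - 1 \<or> k = q" using k(1) by auto
    then show ?thesis using k(4) by (auto simp: rho)
  qed
  interpret extension_data n ?m2 A P Q A' T \<rho>1 \<rho>2 ?s
  proof
    show "P * Q = 1\<^sub>m n" "Q * P = 1\<^sub>m n" using P_inverse P Q by (auto simp: inverts_mat_def)
  qed (use A P Q A'_def D_off m2 D_last T_carrier points_off in auto)
  have sys: "TT = system_points" "AP = system_matrix"
    unfolding system_points_def system_matrix_def unfolding TT AP N' rho by (rule refl)+
  define \<tau> where "\<tau> = (\<lambda>j. T $$ (j, j) - ?s)"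
  have T_entry: "\<exists>i y. i \<in> {1..p} \<and> y < nb i \<and> j = offset nb i + y \<and> T $$ (j, j) = t i \<and> T' $$ (j, j) = t' i" if j: "j < n" for j
  proof -
    obtain i y where iy: "i \<in> {1..p}" "y < nb i" "j = offset nb i + y"
      using block_index[of j nb p] j unfolding n by blast
    then show ?thesis unfolding T_eq T' using block_scalar_diagonal[where k = i and d = nb and y = y, OF iy(1,2)] iy by blast
  qed
  have t_ne: "t i - ?s \<noteq> 0" if "i \<in> {1..p}" for i using \<theta>_arg[OF that] by (simp add: is_arg_of_def)
  have exp_om: "exp (om i) = t i - ?s" if "i \<in> {1..p}" for i
    using \<theta>_arg[OF that] unfolding is_arg_of_iff om_def by simp
  have Im_om: "Im (om i) = \<theta> i" for i by (simp add: om_def)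
  have \<tau>0: "\<tau> j \<noteq> 0" if "j < n" for j using T_entry[OF that] t_ne unfolding \<tau>_def by metis
  have T'_\<tau>: "T' $$ (j, j) = \<eta> + 1 / \<tau> j" if "j < n" for j using T_entry[OF that] t' unfolding \<tau>_def by metis
  have t'_om: "t' i = \<eta> + exp (- om i)" if "i \<in> {1..p}" for i
    using t'[OF that] exp_om[OF that] by (simp add: exp_minus divide_inverse)
  have block: "\<exists>y<nb i. j = offset nb i + y" if i: "i \<in> {1..p}" and j: "j < n" "\<tau> j = exp (om i)" for i j
  proof -
    obtain i' y where i': "i' \<in> {1..p}" "y < nb i'" "j = offset nb i' + y" "T $$ (j, j) = t i'" using T_entry[OF j(1)] by blast
    then have "t i' = t i" using j(2) exp_om[OF i] by (simp add: \<tau>_def)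
    then have "i' = i" using t_distinct i i'(1) by (auto dest: inj_onD)
    then show ?thesis using i' by blast
  qed
  have A_block: "A $$ (offset nb i + y, offset nb i + z) = block_scalar (r i) (lam i) (l i) $$ (y, z)"
    if "i \<in> {1..p}" "y < nb i" "z < nb i" for i y z
    using A_diag[OF that(1)] that(2,3) unfolding diagonal_block_def by (metis (no_types, lifting) case_prod_conv index_mat(1))
  have diag1: "A $$ (j, k) = (if j = k then A $$ (j, j) else 0)"
    if i: "i \<in> {1..p}" and jk: "j < n" "k < n" "\<tau> j = exp (om i)" "\<tau> k = exp (om i)" for i j k
  proof -
    obtain y z where yz: "y < nb i" "j = offset nb i + y" "z < nb i" "k = offset nb i + z"
      using block[OF i jk(1,3)] block[OF i jk(2,4)] by blast
    show ?thesis
      using A_block[OF i yz(1,3)] block_scalar_off_diagonal[of y "l i" "r i" z "lam i"] yz nb[OF i] by auto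
  qed
  \<comment> \<open>The diagonal entries of A in the block of t_i are the values lam i k', so the
    non-integrality of their differences gives the alternative.\<close>
  have diag2: "lam i k = A $$ (j, j) \<or> lam i k - A $$ (j, j) \<notin> \<int>"
    if i: "i \<in> {1..p}" "k \<in> {1..r i}" and j: "j < n" "\<tau> j = exp (om i)" for i k j
  proof -
    obtain y where y: "y < nb i" "j = offset nb i + y" using block[OF i(1) j] by blast
    obtain k' z where k': "k' \<in> {1..r i}" "z < l i k'" "y = offset (l i) k' + z"
      using block_index[of y "l i" "r i"] y(1) unfolding nb[OF i(1)] by blast
    have "A $$ (j, j) = lam i k'"
      using A_block[OF i(1) y(1) y(1)] block_scalar_diagonal[where k = k' and d = "l i" and y = z and c = "lam i", OF k'(1,2)] k'(3) y(2) by simp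
    then show ?thesis using lam_diff_nonint[OF i k'(1)] by metis
  qed

  \<comment> \<open>Strips, sectors and the cut plane\<close>
  have \<theta>_le: "\<theta> i \<le> \<theta> j" if "1 \<le> i" "i \<le> j" "j \<le> p" for i j
    using that(2,3)
  proof (induction j rule: dec_induct)
    case (step k)
    then show ?case using \<theta>_mono[of k] that(1) by simp
  qed simp
  define S where "S = (\<lambda>e. {z. \<theta> e < Im z \<and> Im z < \<theta> (e + 1)})"
  have strip_S: "strip (S e) (\<theta> e) (\<theta> (e + 1))" if e: "e \<in> {1..p - 1}" for e
  proof
    show "\<theta> e < \<theta> (e + 1)" using \<theta>_mono[of e] e by auto
    have "\<theta> (e + 1) \<le> \<theta> p" "\<theta> 1 \<le> \<theta> e" using e by (auto intro!: \<theta>_le)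
    then show "\<theta> (e + 1) < \<theta> e + 2 * pi" using \<theta>_last by simp
  qed (simp add: S_def)
  have \<delta>: "2 * \<delta> < \<theta> (e + 1) - \<theta> e" "\<delta> < pi" if e: "e \<in> {1..p - 1}" for e
  proof -
    show "2 * \<delta> < \<theta> (e + 1) - \<theta> e" using \<delta>_small[of e] e by auto
    then show "\<delta> < pi" using strip.width(2)[OF strip_S[OF e]] by simp
  qed
  \<comment> \<open>The sectors overlap because 2 \<delta> is less than the gap of the arguments,
    \<delta> < pi, and the gap is less than 2 pi; together they fill the strip.\<close>
  have union: "Sp e \<union> Sm (e + 1) = (\<lambda>\<omega>. ?s + exp \<omega>) ` S e" if e: "e \<in> {1..p - 1}" for e
  proof -
    have "e \<in> {1..p}" "e + 1 \<in> {1..p}" using e by auto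
    moreover have "{\<omega>. \<theta> e < Im \<omega> \<and> Im \<omega> < min (\<theta> (e + 1) - \<delta>) (\<theta> e + pi)} \<union>
        {\<omega>. max (\<theta> e + \<delta>) (\<theta> (e + 1) - pi) < Im \<omega> \<and> Im \<omega> < \<theta> (e + 1)} = S e"
      using \<delta>[OF e] \<delta>_pos strip.width[OF strip_S[OF e]] by (auto simp: S_def)
    ultimately show ?thesis
      unfolding Sp[OF \<open>e \<in> {1..p}\<close>] Sm[OF \<open>e + 1 \<in> {1..p}\<close>] sector_plus_def sector_minus_def sector_eq
      by (simp add: image_Un[symmetric])
  qed
  \<comment> \<open>Within \<delta> of the endpoint the strip lies below both upper limits of the
    sector, so the branch prescribed on the sector covers all points of the strip near the
    endpoint.\<close>
  have in_Sp: "?s + exp \<omega> \<in> Sp e" if e: "e \<in> {1..p - 1}" and \<omega>: "\<omega> \<in> S e" "\<omega> \<in> ball (om e) \<delta>" for e \<omega>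
  proof -
    have "\<bar>Im \<omega> - \<theta> e\<bar> < \<delta>" using \<omega>(2) abs_Im_le_cmod[of "\<omega> - om e"] by (simp add: dist_norm norm_minus_commute Im_om)
    moreover have "e \<in> {1..p}" using e by auto
    ultimately show ?thesis
      unfolding Sp[OF \<open>e \<in> {1..p}\<close>] sector_plus_def sector_eq
      using \<delta>[OF e] \<omega>(1) by (intro imageI) (auto simp: S_def)
  qed
  have in_Sm: "?s + exp \<omega> \<in> Sm (e + 1)" if e: "e \<in> {1..p - 1}" and \<omega>: "\<omega> \<in> S e" "\<omega> \<in> ball (om (e + 1)) \<delta>" for e \<omega>
  proof -
    have "\<bar>Im \<omega> - \<theta> (e + 1)\<bar> < \<delta>" using \<omega>(2) abs_Im_le_cmod[of "\<omega> - om (e + 1)"] by (simp add: dist_norm norm_minus_commute Im_om)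
    moreover have "e + 1 \<in> {1..p}" using e by auto
    ultimately show ?thesis
      unfolding Sm[OF \<open>e + 1 \<in> {1..p}\<close>] sector_minus_def sector_eq
      using \<delta>[OF e] \<omega>(1) by (intro imageI) (auto simp: S_def)
  qed
  \<comment> \<open>In the coordinate \<omega> the cut from t'_i is the half-line Im \<omega> =
    \<theta>_i, Re \<omega> <= Re \<omega>_i. No \<theta>_i lies strictly between two neighbours,
    and a total width below 2 pi excludes the other logarithms.\<close>
  have in_cut: "\<eta> + exp (- \<omega>) \<in> cut_plane \<eta> p t'" if e: "e \<in> {1..p - 1}" and \<omega>: "\<omega> \<in> S e" for e \<omega>
  proof (rule ccontr)
    assume "\<eta> + exp (- \<omega>) \<notin> cut_plane \<eta> p t'"
    then obtain i x where i: "i \<in> {1..p}" "1 \<le> (x :: real)" "\<eta> + exp (- \<omega>) = \<eta> + (t' i - \<eta>) * of_real x"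
      by (auto simp: cut_plane_def)
    then have "exp (- \<omega>) = exp (- om i) * exp (of_real (ln x))"
      using t'_om[OF i(1)] by (simp add: exp_of_real)
    then have "exp (- \<omega>) = exp (- om i + of_real (ln x))" by (simp only: exp_add)
    moreover have "\<bar>Im (- \<omega>) - Im (- om i + of_real (ln x))\<bar> < 2 * pi"
    proof -
      have "\<theta> 1 \<le> \<theta> i" "\<theta> i \<le> \<theta> p" "\<theta> 1 \<le> \<theta> e" "\<theta> (e + 1) \<le> \<theta> p" using e i(1) by (auto intro!: \<theta>_le)
      then show ?thesis using \<omega> \<theta>_last by (auto simp: S_def Im_om abs_less_iff)
    qed
    ultimately have "- \<omega> = - om i + of_real (ln x)" by (rule exp_eq_arg)
    then have "Im (- \<omega>) = Im (- om i + of_real (ln x))" by (rule arg_cong)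
    then have "Im \<omega> = \<theta> i" by (simp add: Im_om)
    moreover have "\<theta> i \<le> \<theta> e \<or> \<theta> (e + 1) \<le> \<theta> i"
      using \<theta>_le[of i e] \<theta>_le[of "e + 1" i] i(1) e by (cases "i \<le> e") auto
    ultimately show False using \<omega> by (auto simp: S_def)
  qed
  \<comment> \<open>The common content of \<open>Up\<close> and \<open>Um\<close>: on the strip of
    index \<open>e\<close> both have the same form of leading term, so a single argument serves both
    parts of the theorem.\<close>
  define good where "good = (\<lambda>e i k h U. system_solution (n + ?m2) system_points system_matrix ((\<lambda>\<omega>. ?s + exp \<omega>) ` S e) U \<and>
     (\<forall>j<n. branch_at (S e) (om i) (lam i k) (exp (lam i k * om i) * unit_at n (position nb l i k h) $ j) (\<lambda>\<omega>. U (?s + exp \<omega>) $ j)))"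
  have unit_eq: "unit_at N x $ j = unit_at n x $ j" if "j < n" for x j
    using that N' by (simp add: unit_at_def unit_vec_def)
  have good_Up: "good e e k h (Up e k h)" if e: "e \<in> {1..p - 1}" and kh: "k \<in> {1..r e}" "h \<in> {1..l e k}" for e k h
  proof -
    interpret strip_endpoint "S e" "\<theta> e" "\<theta> (e + 1)" "om e"
      using strip_S[OF e] by (simp add: strip_endpoint_def strip_endpoint_axioms_def Im_om)
    have e': "e \<in> {1..p}" using e by auto
    have te: "t e = ?s + exp (om e)" using exp_om[OF e'] by simp
    note U = Up[OF e kh, unfolded union[OF e] te sys]
    have "branch_at (S e) (om e) (lam e k) (exp (lam e k * om e) * unit_at N (position nb l e k h) $ j) (\<lambda>\<omega>. Up e k h (?s + exp \<omega>) $ j)"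
      if "j < n" for j
      by (rule branch_at_extended[OF U _ \<delta>_pos in_Sp[OF e]]) (use that N' Im_om in auto)
    moreover have "system_solution (n + ?m2) system_points system_matrix ((\<lambda>\<omega>. ?s + exp \<omega>) ` S e) (Up e k h)"
      using U unfolding solution_branch_def N' by blast
    ultimately show ?thesis unfolding good_def using unit_eq by simp
  qed
  have good_Um: "good e (e + 1) k h (Um (e + 1) k h)" if e: "e \<in> {1..p - 1}" and kh: "k \<in> {1..r (e + 1)}" "h \<in> {1..l (e + 1) k}" for e k h
  proof -
    interpret strip_endpoint "S e" "\<theta> e" "\<theta> (e + 1)" "om (e + 1)"
      using strip_S[OF e] by (simp add: strip_endpoint_def strip_endpoint_axioms_def Im_om)
    have e': "e + 1 \<in> {1..p}" "e + 1 \<in> {2..p}" using e by auto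
    have te: "t (e + 1) = ?s + exp (om (e + 1))" using exp_om[OF e'(1)] by simp
    have un: "Sm (e + 1) \<union> Sp (e + 1 - 1) = (\<lambda>\<omega>. ?s + exp \<omega>) ` S e" using union[OF e] by (simp add: Un_commute)
    note U = Um[OF e'(2) kh, unfolded un te sys]
    have "branch_at (S e) (om (e + 1)) (lam (e + 1) k) (exp (lam (e + 1) k * om (e + 1)) * unit_at N (position nb l (e + 1) k h) $ j)
        (\<lambda>\<omega>. Um (e + 1) k h (?s + exp \<omega>) $ j)"
      if "j < n" for j
      by (rule branch_at_extended[OF U _ \<delta>_pos in_Sm[OF e]]) (use that N' Im_om in auto)
    moreover have "system_solution (n + ?m2) system_points system_matrix ((\<lambda>\<omega>. ?s + exp \<omega>) ` S e) (Um (e + 1) k h)"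
      using U unfolding solution_branch_def N' by blast
    ultimately show ?thesis unfolding good_def using unit_eq by simp
  qed
  \<comment> \<open>Either endpoint of the strip may be the starting one; the two cases of
    \<open>pair\<close> are the two parts of the theorem.\<close>
  have main: "connection_relation N ((\<lambda>\<omega>. ?s + exp \<omega>) ` S e) (t \<nu>) (r \<nu>) (l \<nu>) Ua (\<lambda>k' h'. C \<nu> k' h' i k h) Ub"
    if e: "e \<in> {1..p - 1}" and pair: "i = e \<and> \<nu> = e + 1 \<or> i = e + 1 \<and> \<nu> = e"
      and kh: "k \<in> {1..r i}" "h \<in> {1..l i k}"
      and Ua: "good e i k h Ua"
      and Ub: "\<And>k' h'. k' \<in> {1..r \<nu>} \<Longrightarrow> h' \<in> {1..l \<nu> k'} \<Longrightarrow> good e \<nu> k' h' (Ub k' h')"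
    for e i \<nu> k h Ua Ub
  proof -
    have i: "i \<in> {1..p}" "\<nu> \<in> {1..p}" "\<nu> \<noteq> i" using e pair by auto
    have ends: "strip_endpoint (S e) (\<theta> e) (\<theta> (e + 1)) (om i)" "strip_endpoint (S e) (\<theta> e) (\<theta> (e + 1)) (om \<nu>)"
      using strip_S[OF e] pair by (auto simp: strip_endpoint_def strip_endpoint_axioms_def Im_om)
    have "\<theta> i \<noteq> \<theta> \<nu>" using strip.width(1)[OF strip_S[OF e]] pair by auto
    then have both: "strip_endpoints (S e) (\<theta> e) (\<theta> (e + 1)) (om i) (om \<nu>)"
      using ends by (simp add: strip_endpoints_def strip_endpoints_axioms_def Im_om)
    define I where "I = Sigma {1..r \<nu>} (\<lambda>k'. {1..l \<nu> k'})"
    have I_fin: "finite I" by (simp add: I_def)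
    have sum_I: "(\<Sum>k'=1..r \<nu>. \<Sum>h'=1..l \<nu> k'. f k' h') = (\<Sum>x\<in>I. f (fst x) (snd x))" for f :: "nat \<Rightarrow> nat \<Rightarrow> complex"
      unfolding I_def by (subst sum.Sigma) (auto simp: split_beta)
    have I_mem: "fst x \<in> {1..r \<nu>}" "snd x \<in> {1..l \<nu> (fst x)}" if "x \<in> I" for x using that by (auto simp: I_def)
    have w_und: "underlying_solution n \<tau> (\<lambda>j l. A $$ (j, l)) (S e) (\<lambda>j \<omega>. w i k h (\<eta> + exp (- \<omega>)) $ j)"
      if "i \<in> {1..p}" "k \<in> {1..r i}" "h \<in> {1..l i k}" for i k h
    proof (rule strip.underlying_solution_of_system[OF strip_S[OF e] _ T'_carrier A points_off(2)])
      show "system_solution n T' A (cut_plane \<eta> p t') (w i k h)"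
        using w[OF that] unfolding solution_branch_def by blast
    qed (use \<tau>0 T'_\<tau> in_cut[OF e] in auto)
    have w_branch: "branch_at (S e) (om i) (lam i k) (exp (lam i k * (- om i - \<i> * of_real pi)) * unit_at n (position nb l i k h) $ j)
        (\<lambda>\<omega>. w i k h (\<eta> + exp (- \<omega>)) $ j)"
      if "i \<in> {1..p}" "k \<in> {1..r i}" "h \<in> {1..l i k}" "strip_endpoint (S e) (\<theta> e) (\<theta> (e + 1)) (om i)" "j < n" for i k h j
      by (rule strip_endpoint.branch_at_underlying[OF that(4) _ in_cut[OF e] that(5)])
         (use w[OF that(1-3)] t'_om[OF that(1)] in \<open>simp_all add: Im_om\<close>)
    have conn: "extends_at (S e) (om \<nu>) (\<lambda>\<omega>. w i k h (\<eta> + exp (- \<omega>)) $ j -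
        (\<Sum>x\<in>I. c \<nu> (fst x) (snd x) i k h * w \<nu> (fst x) (snd x) (\<eta> + exp (- \<omega>)) $ j))" if j: "j < n" for j
    proof -
      obtain H where H: "\<forall>j<n. (\<lambda>x. H x $ j) analytic_on {t' \<nu>}"
        "\<forall>x\<in>cut_plane \<eta> p t'. \<forall>j<n. w i k h x $ j = (\<Sum>k'=1..r \<nu>. \<Sum>h'=1..l \<nu> k'. c \<nu> k' h' i k h * w \<nu> k' h' x $ j) + H x $ j"
        using c[OF i(2,1,3) kh] unfolding connection_relation_def by blast
      show ?thesis
      proof (rule strip_endpoint.extends_at_compose[OF ends(2), of "\<lambda>x. H x $ j" "\<lambda>\<omega>. \<eta> + exp (- \<omega>)"])
        show "(\<lambda>x. H x $ j) analytic_on {\<eta> + exp (- om \<nu>)}" using H(1) j t'_om[OF i(2)] by simp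
        fix \<omega> assume "\<omega> \<in> S e"
        then have "w i k h (\<eta> + exp (- \<omega>)) $ j = (\<Sum>k'=1..r \<nu>. \<Sum>h'=1..l \<nu> k'. c \<nu> k' h' i k h * w \<nu> k' h' (\<eta> + exp (- \<omega>)) $ j) + H (\<eta> + exp (- \<omega>)) $ j"
          using H(2) in_cut[OF e] j by blast
        then show "w i k h (\<eta> + exp (- \<omega>)) $ j - (\<Sum>x\<in>I. c \<nu> (fst x) (snd x) i k h * w \<nu> (fst x) (snd x) (\<eta> + exp (- \<omega>)) $ j) = H (\<eta> + exp (- \<omega>)) $ j"
          unfolding sum_I by simp
      qed (intro holomorphic_intros)
    qed
    let ?f = "\<lambda>z lam. exp (of_real pi * \<i> * lam) * exp ((2 * lam - \<rho>1 - \<rho>2) * z)"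
    have ext: "extends_at (S e) (om \<nu>) (\<lambda>\<omega>. Ua (?s + exp \<omega>) $ j -
       (\<Sum>x\<in>I. ?f (om i) (lam i k) / ?f (om \<nu>) (lam \<nu> (fst x)) * c \<nu> (fst x) (snd x) i k h * Ub (fst x) (snd x) (?s + exp \<omega>) $ j))"
      if j: "j < n + ?m2" for j
    proof (rule connection_step[where la = "lam i k" and lb = "\<lambda>x. lam \<nu> (fst x)" and a = "om i" and b = "om \<nu>"
          and ea = "\<lambda>j. unit_at n (position nb l i k h) $ j"
          and eb = "\<lambda>x j. unit_at n (position nb l \<nu> (fst x) (snd x)) $ j"
          and wa = "\<lambda>j \<omega>. w i k h (\<eta> + exp (- \<omega>)) $ j"
          and wb = "\<lambda>x j \<omega>. w \<nu> (fst x) (snd x) (\<eta> + exp (- \<omega>)) $ j"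
          and cc = "\<lambda>x. c \<nu> (fst x) (snd x) i k h" and Ua = Ua and Ub = "\<lambda>x. Ub (fst x) (snd x)", OF both I_fin])
      show "\<And>j. j < n \<Longrightarrow> T $$ (j, j) - ?s \<noteq> 0" using \<tau>0 by (simp add: \<tau>_def)
      show "\<And>j. j < n \<Longrightarrow> A' $$ (j, j) \<notin> \<int>" by (rule D_nonint)
      show "system_solution (n + ?m2) system_points system_matrix ((\<lambda>\<omega>. ?s + exp \<omega>) ` S e) Ua"
        "\<And>j. j < n \<Longrightarrow> branch_at (S e) (om i) (lam i k) (exp (lam i k * om i) * unit_at n (position nb l i k h) $ j)
          (\<lambda>\<omega>. Ua (?s + exp \<omega>) $ j)"
        using Ua by (simp_all add: good_def)
      show "system_solution (n + ?m2) system_points system_matrix ((\<lambda>\<omega>. ?s + exp \<omega>) ` S e) (Ub (fst x) (snd x))"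
        if "x \<in> I" for x
        using Ub[OF I_mem(1)[OF that] I_mem(2)[OF that]] by (simp add: good_def)
      show "branch_at (S e) (om \<nu>) (lam \<nu> (fst x)) (exp (lam \<nu> (fst x) * om \<nu>) * unit_at n (position nb l \<nu> (fst x) (snd x)) $ j)
          (\<lambda>\<omega>. Ub (fst x) (snd x) (?s + exp \<omega>) $ j)" if "x \<in> I" "j < n" for x j
        using Ub[OF I_mem(1)[OF that(1)] I_mem(2)[OF that(1)]] that(2) by (simp add: good_def)
      show "underlying_solution n (\<lambda>j. T $$ (j, j) - ?s) (\<lambda>j l. A $$ (j, l)) (S e) (\<lambda>j \<omega>. w i k h (\<eta> + exp (- \<omega>)) $ j)"
        by (rule w_und[OF i(1) kh, unfolded \<tau>_def])
      show "underlying_solution n (\<lambda>j. T $$ (j, j) - ?s) (\<lambda>j l. A $$ (j, l)) (S e)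
          (\<lambda>j \<omega>. w \<nu> (fst x) (snd x) (\<eta> + exp (- \<omega>)) $ j)" if "x \<in> I" for x
        by (rule w_und[OF i(2) I_mem(1)[OF that] I_mem(2)[OF that], unfolded \<tau>_def])
      show "lam i k \<notin> \<int>" by (rule lam_nonint[OF i(1) kh(1)])
      show "lam \<nu> (fst x) \<notin> \<int>" if "x \<in> I" for x by (rule lam_nonint[OF i(2) I_mem(1)[OF that]])
      show "A $$ (j, l) = (if j = l then A $$ (j, j) else 0)"
        if "j < n" "l < n" "T $$ (j, j) - ?s = exp (om i)" "T $$ (l, l) - ?s = exp (om i)" for j l
        by (rule diag1[OF i(1), unfolded \<tau>_def, OF that])
      show "A $$ (j, l) = (if j = l then A $$ (j, j) else 0)"
        if "j < n" "l < n" "T $$ (j, j) - ?s = exp (om \<nu>)" "T $$ (l, l) - ?s = exp (om \<nu>)" for j l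
        by (rule diag1[OF i(2), unfolded \<tau>_def, OF that])
      show "lam i k = A $$ (j, j) \<or> lam i k - A $$ (j, j) \<notin> \<int>"
        if "j < n" "T $$ (j, j) - ?s = exp (om i)" for j
        by (rule diag2[OF i(1) kh(1), unfolded \<tau>_def, OF that])
      show "lam \<nu> (fst x) = A $$ (j, j) \<or> lam \<nu> (fst x) - A $$ (j, j) \<notin> \<int>"
        if "x \<in> I" "j < n" "T $$ (j, j) - ?s = exp (om \<nu>)" for x j
        by (rule diag2[OF i(2) I_mem(1)[OF that(1)], unfolded \<tau>_def, OF that(2,3)])
      show "branch_at (S e) (om i) (lam i k) (exp (lam i k * (- om i - \<i> * of_real pi)) * unit_at n (position nb l i k h) $ j)
          (\<lambda>\<omega>. w i k h (\<eta> + exp (- \<omega>)) $ j)" if "j < n" for j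
        by (rule w_branch[OF i(1) kh ends(1) that])
      show "branch_at (S e) (om \<nu>) (lam \<nu> (fst x)) (exp (lam \<nu> (fst x) * (- om \<nu> - \<i> * of_real pi)) *
          unit_at n (position nb l \<nu> (fst x) (snd x)) $ j) (\<lambda>\<omega>. w \<nu> (fst x) (snd x) (\<eta> + exp (- \<omega>)) $ j)"
        if "x \<in> I" "j < n" for x j
        by (rule w_branch[OF i(2) I_mem(1)[OF that(1)] I_mem(2)[OF that(1)] ends(2) that(2)])
    qed (fact conn j)+
    have factor: "?f (om i) (lam i k) = connection_factor t p \<theta> lam (\<mu> (q - 1)) (\<mu> q) i k" for i k
      by (simp add: connection_factor_def pow_arg_def om_def rho)
    let ?F = "\<lambda>j x. Ua x $ j - (\<Sum>k'=1..r \<nu>. \<Sum>h'=1..l \<nu> k'. C \<nu> k' h' i k h * Ub k' h' x $ j)"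
    have ex: "\<exists>H. H analytic_on {t \<nu>} \<and> (\<forall>x\<in>(\<lambda>\<omega>. ?s + exp \<omega>) ` S e. ?F j x = H x)" if j: "j < N" for j
    proof -
      have "extends_at (S e) (om \<nu>) (\<lambda>\<omega>. ?F j (?s + exp \<omega>))"
        using ext[of j] j unfolding N' factor C sum_I by simp
      from strip_endpoint.analytic_of_extends_at[OF ends(2) this] show ?thesis
        using exp_om[OF i(2)] by simp
    qed
    \<comment> \<open>The holomorphic remainder is found for each component separately; a choice of
      one \<open>H\<close> for each j assembles the vector function.\<close>
    have "\<forall>j\<in>{..<N}. \<exists>H. H analytic_on {t \<nu>} \<and> (\<forall>x\<in>(\<lambda>\<omega>. ?s + exp \<omega>) ` S e. ?F j x = H x)"
      by (intro ballI ex) simp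
    from bchoice[OF this] obtain H where H_all:
      "\<forall>j\<in>{..<N}. H j analytic_on {t \<nu>} \<and> (\<forall>x\<in>(\<lambda>\<omega>. ?s + exp \<omega>) ` S e. ?F j x = H j x)"
      by (rule exE)
    have H: "H j analytic_on {t \<nu>}" "x \<in> (\<lambda>\<omega>. ?s + exp \<omega>) ` S e \<Longrightarrow> ?F j x = H j x" if "j < N" for j x
    proof -
      have "j \<in> {..<N}" using that by simp
      note bspec[OF H_all this]
      then show "H j analytic_on {t \<nu>}" by (rule conjunct1)
      from \<open>_ \<and> _\<close> show "?F j x = H j x" if "x \<in> (\<lambda>\<omega>. ?s + exp \<omega>) ` S e"
        by (rule bspec[OF conjunct2 that])
    qed
    show ?thesis
      unfolding connection_relation_def
    proof (intro exI[of _ "\<lambda>x. vec N (\<lambda>j. H j x)"] conjI allI impI ballI)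
      fix j assume "j < N"
      then show "(\<lambda>x. vec N (\<lambda>j. H j x) $ j) analytic_on {t \<nu>}" using H(1) by simp
    next
      fix x j assume "x \<in> (\<lambda>\<omega>. ?s + exp \<omega>) ` S e" "j < N"
      then show "Ua x $ j = (\<Sum>k'=1..r \<nu>. \<Sum>h'=1..l \<nu> k'. C \<nu> k' h' i k h * Ub k' h' x $ j) + vec N (\<lambda>j. H j x) $ j"
        using H(2)[of j x] by (simp add: algebra_simps)
    qed
  qed
  show ?thesis
  proof (intro conjI ballI)
    fix i k h assume *: "i \<in> {1..p - 1}" "k \<in> {1..r i}" "h \<in> {1..l i k}"
    show "connection_relation N (Sp i \<union> Sm (i + 1)) (t (i + 1)) (r (i + 1)) (l (i + 1)) (Up i k h)
              (\<lambda>k' h'. C (i + 1) k' h' i k h) (Um (i + 1))"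
      unfolding union[OF *(1)] by (rule main[OF *(1) _ *(2,3) good_Up[OF *] good_Um[OF *(1)]]) simp
  next
    fix i k h assume *: "i \<in> {2..p}" "k \<in> {1..r i}" "h \<in> {1..l i k}"
    \<comment> \<open>The second part, from t_i to t_(i-1), uses the strip between \<theta>_(i-1)
      and \<theta>_i, starting from its upper edge.\<close>
    define e where "e = i - 1"
    have e: "e \<in> {1..p - 1}" and i: "i = e + 1" using *(1) by (auto simp: e_def)
    have "connection_relation N (Sp e \<union> Sm (e + 1)) (t e) (r e) (l e) (Um (e + 1) k h)
              (\<lambda>k' h'. C e k' h' (e + 1) k h) (Up e)"
      unfolding union[OF e] by (rule main[OF e _ _ _ good_Um[OF e] good_Up[OF e]]) (use * i in auto)
    then show "connection_relation N (Sm i \<union> Sp (i - 1)) (t (i - 1)) (r (i - 1)) (l (i - 1)) (Um i k h)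
              (\<lambda>k' h'. C (i - 1) k' h' i k h) (Up (i - 1))"
      unfolding i by (simp add: Un_commute)
  qed
qed

end
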